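(* Let $p$ be a prime, let $\mathcal{F}$ be a saturated fusion system over a finite $p$-group $S$, and let $Q\leq S$ be large in $\mathcal{F}$. (a) The subgroup $Q$ is weakly closed in $\mathcal{F}$. In particular, $Q$ is $\mathcal{F}$-centric. (b) Every subgroup $1\neq P\leq S$ with $Q\leq N_S(P)$ is $\mathcal{F}$-subcentric. In particular, $\mathcal{F}$ is of parabolic characteristic $p$.
   Context: For a fusion system $\mathcal{F}$ over $S$ and $P\leq S$, $N_{\mathcal{F}}(P)$ is the fusion system over $N_S(P)$ whose morphisms are the $\mathcal{F}$-morphisms $\phi\colon X\to Y$ ($X,Y\leq N_S(P)$) that extend to some $\hat\phi\in\mathrm{Hom}_{\mathcal{F}}(XP,YP)$ with $P\hat\phi=P$. For a fusion system $\mathcal{E}$ over $T$, $P\leq T$ is normal in $\mathcal{E}$ if $\mathcal{E}=N_{\mathcal{E}}(P)$, and $O_p(\mathcal{E})$ is the largest subgroup of $T$ normal in $\mathcal{E}$. $Q\leq S$ is large in $\mathcal{F}$ if $C_S(Q)\leq Q$ and $N_{\mathcal{F}}(U)\subseteq N_{\mathcal{F}}(Q)$ for all $1\neq U\leq Z(Q)$. $Q$ is weakly closed in $\mathcal{F}$ if $Q\phi=Q$ for every $\phi\in\mathrm{Hom}_{\mathcal{F}}(Q,S)$. $P\leq S$ is $\mathcal{F}$-centric if $C_S(P')\leq P'$ for every $\mathcal{F}$-conjugate $P'$ of $P$; it is fully $\mathcal{F}$-normalized if $|N_S(P)|\geq|N_S(P')|$ for every $\mathcal{F}$-conjugate $P'$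 of $P$. $P\leq S$ is $\mathcal{F}$-subcentric if, for some fully $\mathcal{F}$-normalized $\mathcal{F}$-conjugate $P'$ of $P$, the subgroup $O_p(N_{\mathcal{F}}(P'))$ is $\mathcal{F}$-centric. A saturated fusion system $\mathcal{E}$ is constrained if it has a normal subgroup that is $\mathcal{E}$-centric. The saturated fusion system $\mathcal{F}$ is of parabolic characteristic $p$ if $N_{\mathcal{F}}(P)$ is constrained for every non-trivial normal subgroup $P$ of $S$. *)

theory Defs
  imports "HOL-Algebra.Group_Action" "HOL-Computational_Algebra.Primes"
begin

section \<open>Groups\<close>

definition centralizer :: "('a, 'b) monoid_scheme \<Rightarrow> 'a set \<Rightarrow> 'a set" where
  "centralizer G H = {g \<in> carrier G. \<forall>h \<in> H. g \<otimes>\<^bsub>G\<^esub> h = h \<otimes>\<^bsub>G\<^esub> g}"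

definition center :: "('a, 'b) monoid_scheme \<Rightarrow> 'a set" where
  "center G = centralizer G (carrier G)"

definition sylow_subgroup :: "nat \<Rightarrow> 'a set \<Rightarrow> ('a, 'b) monoid_scheme \<Rightarrow> bool" where
  "sylow_subgroup p H G \<longleftrightarrow> subgroup H G \<and> card H = p ^ multiplicity p (order G)"

text \<open>Finiteness is implied: \<^const>\<open>order\<close> is \<open>0\<close> for infinite groups.\<close>

locale finite_p_group = group S for p :: nat and S (structure) +
  assumes prime_p: "prime p"
    and order_S: "\<exists>n. order S = p ^ n"

text \<open>\<open>conj_map S g P\<close> is \<open>c\<^sub>g\<close> restricted to \<open>P\<close>. We write maps on the left and conjugate by
  \<open>x \<mapsto> g x g\<^sup>-\<^sup>1\<close>; as \<open>g\<close> ranges over a subgroup, this gives the same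
  morphism sets as the convention with maps on the right and \<open>x \<mapsto> g\<^sup>-\<^sup>1 x g\<close>.\<close>

definition conj_map :: "('a, 'b) monoid_scheme \<Rightarrow> 'a \<Rightarrow> 'a set \<Rightarrow> 'a \<Rightarrow> 'a" where
  "conj_map S g P = (\<lambda>x\<in>P. g \<otimes>\<^bsub>S\<^esub> x \<otimes>\<^bsub>S\<^esub> inv\<^bsub>S\<^esub> g)"


section \<open>Fusion systems\<close>

text \<open>A fusion system over \<open>S\<close> is given by its morphism sets: \<open>F P Q\<close> is
  \<open>Hom\<^sub>F(P, Q)\<close>. Morphisms are made extensional on their domain (as in
  \<^const>\<open>BijGroup\<close>), and \<open>F P Q\<close> is empty unless \<open>P\<close> and \<open>Q\<close> are subgroups
  of \<open>S\<close>; hence equality of fusion systems over \<open>S\<close> is equality of functions.\<close>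

type_synonym 'a hom_sets = "'a set \<Rightarrow> 'a set \<Rightarrow> ('a \<Rightarrow> 'a) set"

locale fusion_system = finite_p_group p S for p :: nat and S (structure) +
  fixes F :: "'a hom_sets"
  assumes objects: "\<phi> \<in> F P Q \<Longrightarrow> subgroup P S \<and> subgroup Q S"
    and monomorphisms: "\<phi> \<in> F P Q \<Longrightarrow>
          \<phi> \<in> mon (S\<lparr>carrier := P\<rparr>) (S\<lparr>carrier := Q\<rparr>) \<inter> extensional P"
    and inner: "\<lbrakk>subgroup P S; subgroup Q S; g \<in> carrier S; conj_map S g P ` P \<subseteq> Q\<rbrakk>
          \<Longrightarrow> conj_map S g P \<in> F P Q"
    and comp: "\<lbrakk>\<phi> \<in> F P Q; \<psi> \<in> F Q R\<rbrakk> \<Longrightarrow> compose P \<psi> \<phi> \<in> F P R"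
    and onto_image: "\<phi> \<in> F P Q \<Longrightarrow> \<phi> \<in> F P (\<phi> ` P)"
    and inverse_image: "\<phi> \<in> F P Q \<Longrightarrow> restrict (inv_into P \<phi>) (\<phi> ` P) \<in> F (\<phi> ` P) P"

text \<open>The \<open>F\<close>-isomorphisms from \<open>P\<close> to \<open>Q\<close> are the surjective morphisms,
  by the last two axioms.\<close>

definition fs_iso :: "'a hom_sets \<Rightarrow> 'a set \<Rightarrow> 'a set \<Rightarrow> ('a \<Rightarrow> 'a) set" where
  "fs_iso F P Q = {\<phi> \<in> F P Q. \<phi> ` P = Q}"

definition fs_conjugates ::
    "('a, 'b) monoid_scheme \<Rightarrow> 'a hom_sets \<Rightarrow> 'a set \<Rightarrow> 'a set set" where
  "fs_conjugates S F P = {\<phi> ` P |\<phi>. \<phi> \<in> F P (carrier S)}"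

definition fs_aut :: "'a hom_sets \<Rightarrow> 'a set \<Rightarrow> ('a \<Rightarrow> 'a) monoid" where
  "fs_aut F P = (BijGroup P)\<lparr>carrier := F P P\<rparr>"

definition inner_aut :: "('a, 'b) monoid_scheme \<Rightarrow> 'a set \<Rightarrow> ('a \<Rightarrow> 'a) set" where
  "inner_aut S P = {conj_map S g P |g. g \<in> normalizer S P}"


section \<open>Saturation\<close>

definition fully_automized ::
    "nat \<Rightarrow> ('a, 'b) monoid_scheme \<Rightarrow> 'a hom_sets \<Rightarrow> 'a set \<Rightarrow> bool" where
  "fully_automized p S F P \<longleftrightarrow> sylow_subgroup p (inner_aut S P) (fs_aut F P)"

text \<open>The subgroup \<open>N\<^sub>\<phi>\<close> of elements \<open>g\<close> of \<open>N\<^sub>S(R)\<close> such that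
  \<open>\<phi> c\<^sub>g \<phi>\<^sup>-\<^sup>1\<close> lies in \<open>Aut\<^sub>S(P)\<close>, for an isomorphism \<open>\<phi>\<close> from \<open>R\<close> to \<open>P\<close>.\<close>

definition N_phi ::
    "('a, 'b) monoid_scheme \<Rightarrow> 'a set \<Rightarrow> 'a set \<Rightarrow> ('a \<Rightarrow> 'a) \<Rightarrow> 'a set" where
  "N_phi S R P \<phi> = {g \<in> normalizer S R.
     compose P (compose R \<phi> (conj_map S g R)) (restrict (inv_into R \<phi>) P) \<in> inner_aut S P}"

definition receptive :: "('a, 'b) monoid_scheme \<Rightarrow> 'a hom_sets \<Rightarrow> 'a set \<Rightarrow> bool" where
  "receptive S F P \<longleftrightarrow>
     (\<forall>R. \<forall>\<phi> \<in> fs_iso F R P. \<exists>\<psi> \<in> F (N_phi S R P \<phi>) (carrier S). \<forall>x \<in> R. \<psi> x = \<phi> x)"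

locale saturated_fusion_system = fusion_system p S F for p :: nat and S (structure) and F +
  assumes saturated: "subgroup P S \<Longrightarrow>
    \<exists>P' \<in> fs_conjugates S F P. fully_automized p S F P' \<and> receptive S F P'"


section \<open>Properties of subgroups\<close>

definition weakly_closed ::
    "('a, 'b) monoid_scheme \<Rightarrow> 'a hom_sets \<Rightarrow> 'a set \<Rightarrow> bool" where
  "weakly_closed S F Q \<longleftrightarrow> subgroup Q S \<and> (\<forall>\<phi> \<in> F Q (carrier S). \<phi> ` Q = Q)"

definition centric :: "('a, 'b) monoid_scheme \<Rightarrow> 'a hom_sets \<Rightarrow> 'a set \<Rightarrow> bool" where
  "centric S F P \<longleftrightarrow> subgroup P S \<and> (\<forall>P' \<in> fs_conjugates S F P. centralizer S P' \<subseteq> P')"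

definition fully_normalized ::
    "('a, 'b) monoid_scheme \<Rightarrow> 'a hom_sets \<Rightarrow> 'a set \<Rightarrow> bool" where
  "fully_normalized S F P \<longleftrightarrow> subgroup P S \<and>
     (\<forall>P' \<in> fs_conjugates S F P. card (normalizer S P') \<le> card (normalizer S P))"


section \<open>Normalizers and normal subgroups of fusion systems\<close>

abbreviation normalizer_group ::
    "('a, 'b) monoid_scheme \<Rightarrow> 'a set \<Rightarrow> ('a, 'b) monoid_scheme" where
  "normalizer_group S P \<equiv> S\<lparr>carrier := normalizer S P\<rparr>"

text \<open>The morphisms of \<open>N\<^sub>F(P)\<close>, a fusion system over \<^term>\<open>normalizer_group S P\<close>.\<close>

definition fs_normalizer ::
    "('a, 'b) monoid_scheme \<Rightarrow> 'a hom_sets \<Rightarrow> 'a set \<Rightarrow> 'a hom_sets" where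
  "fs_normalizer S F P X Y = {\<phi> \<in> F X Y. X \<subseteq> normalizer S P \<and> Y \<subseteq> normalizer S P \<and>
     (\<exists>\<psi> \<in> F (X <#>\<^bsub>S\<^esub> P) (Y <#>\<^bsub>S\<^esub> P). (\<forall>x \<in> X. \<psi> x = \<phi> x) \<and> \<psi> ` P = P)}"

text \<open>\<open>E = N\<^sub>E(P)\<close>, as fusion systems: both the underlying groups and the morphisms agree.\<close>

definition fs_normal :: "('a, 'b) monoid_scheme \<Rightarrow> 'a hom_sets \<Rightarrow> 'a set \<Rightarrow> bool" where
  "fs_normal T E P \<longleftrightarrow> subgroup P T \<and> T = normalizer_group T P \<and> E = fs_normalizer T E P"

text \<open>\<open>O\<^sub>p(E)\<close>. The greatest element exists for every fusion system, since the product
  of two normal subgroups is normal.\<close>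

definition fs_core :: "('a, 'b) monoid_scheme \<Rightarrow> 'a hom_sets \<Rightarrow> 'a set" where
  "fs_core T E = (GREATEST P. fs_normal T E P)"

definition large :: "('a, 'b) monoid_scheme \<Rightarrow> 'a hom_sets \<Rightarrow> 'a set \<Rightarrow> bool" where
  "large S F Q \<longleftrightarrow> subgroup Q S \<and> centralizer S Q \<subseteq> Q \<and>
     (\<forall>U. subgroup U S \<and> U \<subseteq> center (S\<lparr>carrier := Q\<rparr>) \<and> U \<noteq> {\<one>\<^bsub>S\<^esub>} \<longrightarrow>
        normalizer S U \<subseteq> normalizer S Q \<and>
        (\<forall>X Y. fs_normalizer S F U X Y \<subseteq> fs_normalizer S F Q X Y))"

definition subcentric :: "('a, 'b) monoid_scheme \<Rightarrow> 'a hom_sets \<Rightarrow> 'a set \<Rightarrow> bool" where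
  "subcentric S F P \<longleftrightarrow> subgroup P S \<and>
     (\<exists>P' \<in> fs_conjugates S F P. fully_normalized S F P' \<and>
        centric S F (fs_core (normalizer_group S P') (fs_normalizer S F P')))"

definition constrained :: "nat \<Rightarrow> ('a, 'b) monoid_scheme \<Rightarrow> 'a hom_sets \<Rightarrow> bool" where
  "constrained p T E \<longleftrightarrow> saturated_fusion_system p T E \<and> (\<exists>P. fs_normal T E P \<and> centric T E P)"

definition parabolic_characteristic ::
    "nat \<Rightarrow> ('a, 'b) monoid_scheme \<Rightarrow> 'a hom_sets \<Rightarrow> bool" where
  "parabolic_characteristic p S F \<longleftrightarrow> saturated_fusion_system p S F \<and>
     (\<forall>P. P \<lhd> S \<and> P \<noteq> {\<one>\<^bsub>S\<^esub>} \<longrightarrow> constrained p (normalizer_group S P) (fs_normalizer S F P))"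

end

theory Submission
  imports Defs "HOL-Algebra.Sylow" "HOL-Algebra.Multiplicative_Group"
begin

text \<open>(a) If \<open>Q \<le> R\<close> and \<open>\<alpha> \<in> Aut\<^sub>F(R)\<close>, then \<open>\<alpha>\<close> normalizes \<open>Z(R) \<le> C\<^sub>S(Q) \<le> Q\<close>. As \<open>Z(R)\<close> is a
  non-trivial subgroup of \<open>Z(Q)\<close>, largeness puts \<open>\<alpha>\<close> into \<open>N\<^sub>F(Q)\<close>, so \<open>\<alpha>\<close> fixes \<open>Q\<close>. The induction
  behind Alperin's fusion theorem passes from automorphisms to all morphisms.

  (b) Let \<open>P\<close> be fully normalized with \<open>Q \<le> T = N\<^sub>S(P)\<close>; then \<open>E = N\<^sub>F(P)\<close> is saturated. Since
  \<open>[P, Q] \<le> P \<inter> Q\<close> and \<open>C\<^sub>S(Q) \<le> Q\<close>, the group \<open>U = P \<inter> Z(Q)\<close> is non-trivial, and morphisms of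
  \<open>E\<close> that are trivial on \<open>P\<close> lie in \<open>N\<^sub>F(U) \<subseteq> N\<^sub>F(Q)\<close>. Hence \<open>C\<^sub>Q(P)\<close> is normal in \<open>C\<^sub>E(P)\<close>, and
  it lies in \<open>W = O\<^sub>p(E)\<close>. With \<open>C\<^sub>Q(W) \<le> W\<close> at hand, the automorphisms in \<open>E\<close> of a group
  \<open>X \<ge> W\<close> that are trivial on \<open>W\<close> form a normal \<open>p\<close>-subgroup. So \<open>C\<^sub>T(W)\<close> is normal in \<open>E\<close>, which
  gives \<open>C\<^sub>T(W) \<le> W\<close>. Every conjugate of \<open>W\<close> is moved back onto \<open>W\<close> by a morphism defined on its
  centralizer, so \<open>W\<close> is \<open>F\<close>-centric.\<close>

section \<open>Finite p-groups\<close>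

text \<open>Largeness controls only those morphisms that normalize a non-trivial subgroup of
  \<open>Z(Q)\<close>. A morphism of \<open>E\<close> may move \<open>U = P \<inter> Z(Q)\<close>,
  so nothing makes \<open>Q\<close> itself normal in \<open>E\<close>; morphisms that are trivial on
  \<open>P\<close> are the ones certain to fix \<open>U\<close>. This is why normal subgroups of
  \<open>E\<close> are obtained from centralizers. A Frattini argument writes a morphism with domain
  in \<open>C\<^sub>T(P)\<close> as one of \<open>C\<^sub>E(P)\<close> followed by one that permutes
  the normal subgroups of \<open>C\<^sub>E(P)\<close>, and the greatest of these is therefore
  invariant.

  A subgroup \<open>B\<close> is shown to be normal by enlarging domains. Let \<open>X\<close> be
  fully automized and receptive, and let the conjugations by \<open>B\<close> on \<open>X\<close>
  lie in a normal p-subgroup of \<open>Aut(X)\<close>. Every automorphism of \<open>X\<close> turns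
  them into conjugations by elements of \<open>T\<close>, so receptivity extends it to a larger
  group.

  Full normalization of \<open>P\<close> enters through one consequence, the hypothesis called
  \<open>FN\<close>: every conjugate of \<open>P\<close> is taken back to \<open>P\<close> by a
  morphism defined on the whole normalizer of that conjugate. It also holds for every
  \<open>P\<close> that is normal in the p-group.\<close>

lemma p_power_dvd:
  fixes p :: nat
  assumes "prime p" "m dvd p ^ n"
  shows "\<exists>k. m = p ^ k"
  using assms divides_primepow_nat by blast

text \<open>Orbits have p-power length by the orbit-stabilizer theorem, so those that are not single
  points together contribute a multiple of p. The action is a bare function \<open>a\<close>; its
  values off \<open>X\<close> are cut away by \<open>restrict\<close> to obtain a homomorphism to
  \<open>BijGroup X\<close>.\<close>

lemma card_fixed_points:
  fixes a :: "'g \<Rightarrow> 'x \<Rightarrow> 'x" and p :: nat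
  assumes "group H" "prime p" "order H = p ^ n" "finite X"
    and cl: "\<And>g x. g \<in> carrier H \<Longrightarrow> x \<in> X \<Longrightarrow> a g x \<in> X"
    and one: "\<And>x. x \<in> X \<Longrightarrow> a \<one>\<^bsub>H\<^esub> x = x"
    and mul: "\<And>g h x. g \<in> carrier H \<Longrightarrow> h \<in> carrier H \<Longrightarrow> x \<in> X
                \<Longrightarrow> a (g \<otimes>\<^bsub>H\<^esub> h) x = a g (a h x)"
  shows "\<exists>k. card X = card {x \<in> X. \<forall>g \<in> carrier H. a g x = x} + p * k"
proof -
  interpret H: group H by fact
  let ?f = "\<lambda>g. restrict (a g) X"
  have inv_l: "a (inv\<^bsub>H\<^esub> g) (a g x) = x" if "g \<in> carrier H" "x \<in> X" for g x
    using mul[of "inv\<^bsub>H\<^esub> g" g x] one that by simp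
  have inv_r: "a g (a (inv\<^bsub>H\<^esub> g) x) = x" if "g \<in> carrier H" "x \<in> X" for g x
    using mul[of g "inv\<^bsub>H\<^esub> g" x] one that by simp
  have bij: "?f g \<in> Bij X" if g: "g \<in> carrier H" for g
  proof -
    have "bij_betw (?f g) X X"
      by (rule bij_betw_byWitness[where f' = "a (inv\<^bsub>H\<^esub> g)"])
        (use g inv_l inv_r cl in auto)
    then show ?thesis by (simp add: Bij_def)
  qed
  have "?f \<in> hom H (BijGroup X)"
  proof (rule homI)
    show "?f g \<in> carrier (BijGroup X)" if "g \<in> carrier H" for g
      using bij that by (simp add: BijGroup_def)
    show "?f (g \<otimes>\<^bsub>H\<^esub> h) = ?f g \<otimes>\<^bsub>BijGroup X\<^esub> ?f h"
      if "g \<in> carrier H" "h \<in> carrier H" for g h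
      using that bij mul cl by (auto simp: BijGroup_def compose_def fun_eq_iff restrict_def)
  qed
  then interpret ga: group_action H X ?f
    using assms(1) group_BijGroup by (auto simp: group_action_def group_hom_def group_hom_axioms_def)
  let ?O = "orbits H X ?f"
  let ?F = "{x \<in> X. \<forall>g \<in> carrier H. a g x = x}"
  have orb: "orbit H ?f x = {a g x |g. g \<in> carrier H}" if "x \<in> X" for x
    using that by (auto simp: orbit_def)
  have refl: "x \<in> orbit H ?f x" if "x \<in> X" for x using ga.orbit_refl that .
  have finO: "finite ?O" using assms(4) by (simp add: orbits_def)
  have sub: "C \<subseteq> X" if "C \<in> ?O" for C using that cl orb by (auto simp: orbits_def)
  have cardX: "card X = (\<Sum>C\<in>?O. card C)"
    using ga.disjoint_sum[OF assms(4), of "\<lambda>_. 1::nat"] by simp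
  have single: "{C \<in> ?O. card C = 1} = (\<lambda>x. {x}) ` ?F"
  proof (intro equalityI subsetI)
    fix C assume "C \<in> {C \<in> ?O. card C = 1}"
    then obtain x y where x: "x \<in> X" "C = orbit H ?f x" "C = {y}"
      by (auto simp: orbits_def card_1_singleton_iff)
    have "y = x" using x refl[OF x(1)] by (metis singletonD)
    moreover have "a g x = x" if "g \<in> carrier H" for g
    proof -
      have "a g x \<in> C" using that x orb by blast
      then show ?thesis using x(3) \<open>y = x\<close> by simp
    qed
    ultimately show "C \<in> (\<lambda>x. {x}) ` ?F" using x by auto
  next
    fix C assume "C \<in> (\<lambda>x. {x}) ` ?F"
    then obtain x where x: "x \<in> X" "C = {x}" "\<forall>g \<in> carrier H. a g x = x" by auto
    then have "orbit H ?f x = {x}" using orb[of x] refl[of x] by auto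
    then show "C \<in> {C \<in> ?O. card C = 1}" using x by (auto simp: orbits_def)
  qed
  have pdvd: "p dvd card C" if C: "C \<in> ?O" "card C \<noteq> 1" for C
  proof -
    obtain x where "x \<in> X" "C = orbit H ?f x" using C by (auto simp: orbits_def)
    then have "card C dvd p ^ n"
      using ga.orbit_stabilizer_theorem[of x] assms(3) by (metis dvd_triv_left)
    then obtain k where "card C = p ^ k" using p_power_dvd assms(2) by blast
    then show ?thesis using C(2) by (cases k) auto
  qed
  have "card X = (\<Sum>C\<in>{C \<in> ?O. card C = 1}. card C) + (\<Sum>C\<in>{C \<in> ?O. card C \<noteq> 1}. card C)"
  proof -
    have "?O = {C \<in> ?O. card C = 1} \<union> {C \<in> ?O. card C \<noteq> 1}" by auto
    then show ?thesis
      unfolding cardX using sum.union_disjoint[of "{C \<in> ?O. card C = 1}" "{C \<in> ?O. card C \<noteq> 1}" card] finO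
      by (auto simp: Int_def)
  qed
  moreover have "(\<Sum>C\<in>{C \<in> ?O. card C = 1}. card C) = card ?F"
    unfolding single by (subst sum.reindex) (auto simp: inj_on_def)
  moreover have "p dvd (\<Sum>C\<in>{C \<in> ?O. card C \<noteq> 1}. card C)"
    using pdvd by (intro dvd_sum) auto
  then obtain k where "(\<Sum>C\<in>{C \<in> ?O. card C \<noteq> 1}. card C) = p * k" by (rule dvdE)
  ultimately show ?thesis by (intro exI[of _ k]) simp
qed

lemma order_restrict [simp]: "order (G\<lparr>carrier := H\<rparr>) = card H"
  by (simp add: order_def)

lemma (in group) subgroup_p_power:
  assumes "prime p" "finite (carrier G)" "subgroup H G" "subgroup K G" "K \<subseteq> H" "card H = p ^ n"
  shows "\<exists>k. card K = p ^ k"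
proof -
  have "card K dvd card H"
    using group.lagrange[OF subgroup_imp_group[OF assms(3)] subgroup_incl[OF assms(4,3,5)]]
    by (metis dvd_triv_right order_restrict)
  then show ?thesis using assms p_power_dvd by metis
qed

text \<open>\<open>J\<close> acts on the right cosets of \<open>H\<close> by right multiplication,
  and the inverse turns this into a left action. The representative of a fixed coset conjugates
  \<open>J\<close> into \<open>H\<close>; growth of normalizers and Sylow conjugacy both come from
  counting such cosets.\<close>

lemma (in group) card_fixed_cosets:
  assumes "prime p" "finite (carrier G)" and H: "subgroup H G" and J: "subgroup J G" and "card J = p ^ n"
  shows "\<exists>k. card (rcosets H) = card {C \<in> rcosets H. \<forall>j \<in> J. C #> inv j = C} + p * k"
proof -
  let ?J = "G\<lparr>carrier := J\<rparr>"
  have grp: "group ?J" using J by (rule subgroup_imp_group)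
  have JG: "\<And>j. j \<in> J \<Longrightarrow> j \<in> carrier G" using J subgroup.mem_carrier by metis
  have HG: "H \<subseteq> carrier G" using H subgroup.subset by metis
  have "finite (rcosets H)" using assms(2) by (simp add: RCOSETS_def)
  moreover have "C #> inv j \<in> rcosets H" if "C \<in> rcosets H" "j \<in> J" for C j
    using that JG HG by (auto simp: RCOSETS_def coset_mult_assoc)
  moreover have "C \<subseteq> carrier G" if "C \<in> rcosets H" for C
    using that HG by (auto simp: RCOSETS_def r_coset_def)
  ultimately show ?thesis
    using card_fixed_points[OF grp assms(1), of n "rcosets H" "\<lambda>j C. C #> inv j"] assms(5) JG
    by (simp add: coset_mult_assoc inv_mult_group)
qed

lemma (in group) coset_fixed_imp:
  assumes "subgroup H G" "g \<in> carrier G" "j \<in> carrier G" "H #> g #> inv j = H #> g"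
  shows "g \<otimes> j \<otimes> inv g \<in> H"
proof -
  have HG: "H \<subseteq> carrier G" using assms(1) subgroup.subset by metis
  have "H #> (g \<otimes> inv j \<otimes> inv g) = H #> g #> inv j #> inv g"
    using assms(2,3) HG by (simp add: coset_mult_assoc)
  also have "\<dots> = H" unfolding assms(4) using assms(2) HG by (simp add: coset_mult_assoc)
  finally have "g \<otimes> inv j \<otimes> inv g \<in> H"
    using assms HG by (metis coset_join1 inv_closed m_closed)
  then have "inv (g \<otimes> inv j \<otimes> inv g) \<in> H" using assms(1) subgroup.m_inv_closed by metis
  then show ?thesis using assms by (simp add: inv_mult_group m_assoc)
qed

text \<open>Let \<open>X\<close> act on its own cosets. Their number is a power of p other than 1,
  so p divides the number of fixed ones. The coset \<open>X\<close> is fixed, hence there is a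
  second one, and its representative normalizes \<open>X\<close>.\<close>

lemma (in group) normalizer_grows:
  assumes "prime p" "finite (carrier G)" "order G = p ^ n" "subgroup X G" "X \<noteq> carrier G"
  shows "\<exists>g \<in> carrier G - X. \<forall>x \<in> X. g \<otimes> x \<otimes> inv g \<in> X"
proof -
  obtain k where k: "card X = p ^ k"
    using subgroup_p_power[OF assms(1,2) subgroup_self assms(4)] assms(3,4) subgroup.subset
    by (metis order_def)
  have XG: "X \<subseteq> carrier G" using assms(4) subgroup.subset by metis
  have idx: "card (rcosets X) * card X = p ^ n" using lagrange[OF assms(4)] assms(3) by simp
  have "card X < card (carrier G)" using XG assms(2,5) by (simp add: psubset_card_mono psubset_eq)
  then have "card (rcosets X) \<noteq> 1" using idx assms(3) by (auto simp: order_def)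
  moreover obtain l where "card (rcosets X) = p ^ l"
    using idx p_power_dvd[OF assms(1)] by (metis dvd_triv_left)
  ultimately have pd: "p dvd card (rcosets X)" by (cases l) auto
  let ?F = "{C \<in> rcosets X. \<forall>j \<in> X. C #> inv j = C}"
  have pF: "p dvd card ?F"
  proof -
    obtain m where "card (rcosets X) = card ?F + p * m"
      using card_fixed_cosets[OF assms(1,2,4,4) k] by auto
    then show ?thesis using pd by (simp add: dvd_add_left_iff)
  qed
  have finF: "finite ?F" using assms(2) by (simp add: RCOSETS_def)
  have "X \<in> ?F"
  proof -
    have "X = X #> \<one>" using XG by (simp add: coset_mult_one)
    then have "X \<in> rcosets X" unfolding RCOSETS_def by blast
    moreover have "X #> inv j = X" if "j \<in> X" for j
      using that assms(4) XG by (simp add: coset_join2 subgroup.m_inv_closed subsetD)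
    ultimately show ?thesis by simp
  qed
  moreover have "card ?F \<noteq> 1" using pF assms(1) by (metis not_prime_unit)
  ultimately obtain C where C: "C \<in> ?F" "C \<noteq> X"
    by (metis (no_types, lifting) card_1_singleton_iff is_singletonI' is_singleton_altdef empty_iff)
  then obtain g where g: "g \<in> carrier G" "C = X #> g" by (auto simp: RCOSETS_def)
  have "g \<notin> X" using C(2) g assms(4) coset_join2 by metis
  moreover have "g \<otimes> x \<otimes> inv g \<in> X" if "x \<in> X" for x
    using coset_fixed_imp[OF assms(4) g(1), of x] C(1) g that XG by auto
  ultimately show ?thesis using g by blast
qed

text \<open>The number of cosets of a Sylow subgroup is prime to p, so the p-group \<open>J\<close>
  fixes at least one of them.\<close>

lemma (in group) sylow_conjugate:
  assumes "prime p" "finite (carrier G)" "sylow_subgroup p H G" "subgroup J G" "card J = p ^ n"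
  shows "\<exists>g \<in> carrier G. \<forall>j \<in> J. g \<otimes> j \<otimes> inv g \<in> H"
proof -
  have H: "subgroup H G" "card H = p ^ multiplicity p (order G)"
    using assms(3) by (auto simp: sylow_subgroup_def)
  have o: "order G \<noteq> 0" using assms(2) order_gt_0_iff_finite by simp
  have "\<not> p dvd card (rcosets H)"
  proof
    assume "p dvd card (rcosets H)"
    then have "p ^ Suc (multiplicity p (order G)) dvd card (rcosets H) * card H"
      unfolding H(2) by (simp add: mult_dvd_mono)
    then have "p ^ Suc (multiplicity p (order G)) dvd order G" using lagrange[OF H(1)] by simp
    then show False using o assms(1) multiplicity_geI not_prime_unit
      by (metis Suc_n_not_le_n)
  qed
  moreover obtain k where "card (rcosets H) = card {C \<in> rcosets H. \<forall>j \<in> J. C #> inv j = C} + p * k"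
    using card_fixed_cosets[OF assms(1,2) H(1) assms(4,5)] by auto
  ultimately have "card {C \<in> rcosets H. \<forall>j \<in> J. C #> inv j = C} \<noteq> 0"
    by (metis add_0 dvd_triv_left)
  then have "{C \<in> rcosets H. \<forall>j \<in> J. C #> inv j = C} \<noteq> {}" by (metis card.empty)
  then obtain C where C: "C \<in> rcosets H" "\<forall>j \<in> J. C #> inv j = C" by blast
  then obtain g where g: "g \<in> carrier G" "C = H #> g" by (auto simp: RCOSETS_def)
  have "g \<otimes> j \<otimes> inv g \<in> H" if "j \<in> J" for j
    using coset_fixed_imp[OF H(1) g(1), of j] C g that assms(4) subgroup.mem_carrier by metis
  then show ?thesis using g by blast
qed

lemma (in group) sylow_in_subgroup:
  assumes "prime p" "finite (carrier G)" "sylow_subgroup p H G" "subgroup L G" "H \<subseteq> L"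
  shows "sylow_subgroup p H (G\<lparr>carrier := L\<rparr>)"
proof -
  have H: "subgroup H G" "card H = p ^ multiplicity p (order G)"
    using assms(3) by (auto simp: sylow_subgroup_def)
  have sub: "subgroup H (G\<lparr>carrier := L\<rparr>)" using subgroup_incl[OF H(1) assms(4,5)] .
  have "card L dvd order G" using lagrange[OF assms(4)] by (metis dvd_triv_right)
  moreover have o: "order G \<noteq> 0" using assms(2) order_gt_0_iff_finite by simp
  ultimately have le: "multiplicity p (card L) \<le> multiplicity p (order G)"
    by (simp add: dvd_imp_multiplicity_le)
  have "card H dvd card L"
    using group.lagrange[OF subgroup_imp_group[OF assms(4)] sub] by (metis dvd_triv_right order_restrict)
  moreover have "card L \<noteq> 0" using \<open>card L dvd order G\<close> o by auto
  ultimately have "multiplicity p (order G) \<le> multiplicity p (card L)"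
    using assms(1) H(2) by (metis multiplicity_geI not_prime_unit)
  then show ?thesis using le sub H(2) by (simp add: sylow_subgroup_def)
qed

lemma (in group) sylow_exists:
  assumes "prime p" "finite (carrier G)"
  shows "\<exists>H. sylow_subgroup p H G"
proof -
  obtain m where "order G = p ^ multiplicity p (order G) * m"
    using multiplicity_dvd by (metis dvdE)
  then show ?thesis using sylow_thm[OF assms(1) is_group _ assms(2)]
    by (auto simp: sylow_subgroup_def)
qed

lemma (in group) p_subgroup_card_le:
  assumes "prime p" "finite (carrier G)" "subgroup H G" "card H = p ^ n"
  shows "card H \<le> p ^ multiplicity p (order G)"
proof -
  have "order G \<noteq> 0" using assms(2) order_gt_0_iff_finite by simp
  moreover have "p ^ n dvd order G" using lagrange[OF assms(3)] assms(4) by (metis dvd_triv_right)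
  ultimately have "n \<le> multiplicity p (order G)"
    using assms(1) by (metis multiplicity_geI not_prime_unit)
  then show ?thesis using assms prime_ge_1_nat[of p] by (auto intro: power_increasing)
qed

text \<open>The number of fixed points of \<open>T\<close> acting on \<open>N\<close> by conjugation
  is divisible by p, and \<one> is one of them, so there is another.\<close>

lemma (in group) central_element:
  assumes "prime p" "finite (carrier G)" and T: "subgroup T G" and N: "subgroup N G"
    and "card T = p ^ n" "N \<subseteq> T" "N \<noteq> {\<one>}"
    and nrm: "\<And>t x. t \<in> T \<Longrightarrow> x \<in> N \<Longrightarrow> t \<otimes> x \<otimes> inv t \<in> N"
  shows "\<exists>z \<in> N. z \<noteq> \<one> \<and> (\<forall>t \<in> T. t \<otimes> z = z \<otimes> t)"
proof -
  have TG: "\<And>t. t \<in> T \<Longrightarrow> t \<in> carrier G" using T subgroup.mem_carrier by metis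
  have NG: "\<And>t. t \<in> N \<Longrightarrow> t \<in> carrier G" using N subgroup.mem_carrier by metis
  have finN: "finite N" using NG assms(2) by (meson finite_subset subsetI)
  obtain k where k: "card N = p ^ k" using subgroup_p_power[OF assms(1,2) T N assms(6,5)] by blast
  have "\<one> \<in> N" using N subgroup.one_closed by metis
  then have "card N \<noteq> 1" using assms(7) by (auto simp: card_1_singleton_iff)
  then have pN: "p dvd card N" using k by (cases k) auto
  let ?F = "{x \<in> N. \<forall>t \<in> T. t \<otimes> x \<otimes> inv t = x}"
  have "\<exists>k. card N = card ?F + p * k"
    using card_fixed_points[OF subgroup_imp_group[OF T] assms(1), of n N "\<lambda>t x. t \<otimes> x \<otimes> inv t"]
      assms(5) finN nrm TG NG by (simp add: inv_mult_group m_assoc)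
  then obtain k where "card N = card ?F + p * k" by blast
  then have "p dvd card ?F" using pN by (simp add: dvd_add_left_iff)
  then have "card ?F \<noteq> 1" using assms(1) by (metis not_prime_unit)
  moreover have "\<one> \<in> ?F" using \<open>\<one> \<in> N\<close> TG by simp
  ultimately obtain z where z: "z \<in> ?F" "z \<noteq> \<one>"
    by (metis (no_types, lifting) is_singletonI' is_singleton_altdef empty_iff)
  have "t \<otimes> z = z \<otimes> t" if t: "t \<in> T" for t
  proof -
    have "z \<otimes> t = (t \<otimes> z \<otimes> inv t) \<otimes> t" using z t by simp
    also have "\<dots> = t \<otimes> z" using z t TG NG by (simp add: m_assoc)
    finally show ?thesis by simp
  qed
  then show ?thesis using z by blast
qed

text \<open>Cauchy's theorem, obtained from the existence of Sylow subgroups: a prime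
  \<open>q\<close> dividing the part of the order that is prime to p would yield an element of order
  \<open>q\<close>.\<close>

lemma (in group) p_group_of_p_elements:
  assumes "prime p" "finite (carrier G)" "\<And>x. x \<in> carrier G \<Longrightarrow> \<exists>n. x [^] (p ^ n :: nat) = \<one>"
  shows "\<exists>n. order G = p ^ n"
proof (rule ccontr)
  assume neg: "\<not> ?thesis"
  have o: "order G \<noteq> 0" using assms(2) order_gt_0_iff_finite by simp
  obtain m where m: "order G = p ^ multiplicity p (order G) * m" "\<not> p dvd m"
    using multiplicity_decompose'[of "order G" p] o assms(1) not_prime_unit by metis
  have "m \<noteq> 1" using neg m(1) by auto
  then obtain q where q: "prime q" "q dvd m" using prime_factor_nat by blast
  then obtain r where "order G = q ^ 1 * r" using m(1) by (metis dvdE dvd_mult power_one_right)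
  then obtain H where H: "subgroup H G" "card H = q"
    using sylow_thm[OF q(1) is_group _ assms(2)] by (metis power_one_right)
  have "H \<noteq> {\<one>}" using H(2) q(1) by auto
  then obtain x where x: "x \<in> H" "x \<noteq> \<one>" using H(1) subgroup.one_closed by blast
  have xG: "x \<in> carrier G" using x H subgroup.mem_carrier by metis
  have "x [^] q = \<one>"
    using group.pow_order_eq_1[OF subgroup_imp_group[OF H(1)], of x] x H(2)
    by (simp add: nat_pow_consistent[symmetric])
  then have "ord x dvd q" using pow_eq_id xG by simp
  moreover obtain n where "x [^] (p ^ n) = \<one>" using assms(3) xG by blast
  then have "ord x dvd p ^ n" using pow_eq_id xG by simp
  moreover have "coprime q (p ^ n)"
    using q m(2) assms(1) by (metis coprime_power_right_iff primes_coprime)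
  ultimately have "ord x = 1" by (metis coprime_common_divisor_nat dvd_refl nat_dvd_1_iff_1 coprime_common_divisor is_unit_gcd)
  then show False using x(2) xG ord_eq_1 by blast
qed

lemma (in group_hom) card_image_kernel:
  assumes "finite (carrier G)"
  shows "order G = card (h ` carrier G) * card (kernel G H h)"
proof -
  let ?H = "H\<lparr>carrier := h ` carrier G\<rparr>"
  have img: "subgroup (h ` carrier G) H" by (rule img_is_subgroup)
  have "group_hom G ?H h"
    using G.is_group subgroup.subgroup_is_group[OF img H.is_group]
    by (auto simp: group_hom_def group_hom_axioms_def hom_def)
  moreover have "kernel G ?H h = kernel G H h" by (simp add: kernel_def)
  ultimately have "G Mod kernel G H h \<cong> ?H"
    using group_hom.FactGroup_iso[of G ?H h] by simp
  then have "card (rcosets\<^bsub>G\<^esub> (kernel G H h)) = card (h ` carrier G)"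
    unfolding is_iso_def iso_def FactGroup_def by (auto intro: bij_betw_same_card)
  then show ?thesis using G.lagrange[OF subgroup_kernel] by simp
qed

lemma p_power_image:
  assumes "prime p" "group_hom G H h" "order G = p ^ n"
  shows "subgroup (h ` carrier G) H" "\<exists>k. card (h ` carrier G) = p ^ k"
proof -
  interpret group_hom G H h by fact
  have "finite (carrier G)"
    using assms by (metis G.order_gt_0_iff_finite prime_gt_0_nat zero_less_power)
  then show "\<exists>k. card (h ` carrier G) = p ^ k"
    using card_image_kernel assms p_power_dvd by (metis dvd_triv_left)
  show "subgroup (h ` carrier G) H" by (rule img_is_subgroup)
qed

text \<open>The order of \<open>P \<inter> ?K\<close> is at most the p-part of the order of the
  kernel \<open>?K\<close>. Dividing, the image of \<open>P\<close> has at least the p-part of the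
  order of \<open>H\<close>. This serves to push Sylow subgroups through restriction maps between
  automorphism groups.\<close>

lemma (in group_hom) sylow_image:
  assumes "prime p" "finite (carrier G)" "h ` carrier G = carrier H" "sylow_subgroup p P G"
  shows "sylow_subgroup p (h ` P) H"
proof -
  let ?m = "\<lambda>n. multiplicity p n"
  let ?K = "kernel G H h"
  let ?P = "G\<lparr>carrier := P\<rparr>"
  have P: "subgroup P G" "card P = p ^ ?m (order G)" using assms(4) by (auto simp: sylow_subgroup_def)
  have finP: "finite P" using P(1) assms(2) by (meson finite_subset subgroup.subset)
  have gh: "group_hom ?P H h"
    using P(1) G.subgroup_imp_group H.is_group subgroup.mem_carrier[OF P(1)]
    by (auto simp: group_hom_def group_hom_axioms_def hom_def)
  have sub: "subgroup (h ` P) H" and pw: "\<exists>k. card (h ` P) = p ^ k"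
    using p_power_image[OF assms(1) gh, of "?m (order G)"] P(2) by simp_all
  have finH: "finite (carrier H)" using assms(2,3) by (metis finite_imageI)
  have K: "subgroup ?K G" by (rule subgroup_kernel)
  have finK: "finite ?K" using K assms(2) by (meson finite_subset subgroup.subset)
  have kP: "kernel ?P H h = P \<inter> ?K" using subgroup.subset[OF P(1)] by (auto simp: kernel_def)
  have PK: "subgroup (P \<inter> ?K) G" using P(1) K G.subgroups_Inter_pair by blast
  have "subgroup (P \<inter> ?K) (G\<lparr>carrier := ?K\<rparr>)" using G.subgroup_incl[OF PK K] by simp
  moreover obtain j where "card (P \<inter> ?K) = p ^ j"
    using G.subgroup_p_power[OF assms(1,2) P(1) PK _ P(2)] by blast
  ultimately have le: "card (P \<inter> ?K) \<le> p ^ ?m (card ?K)"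
    using group.p_subgroup_card_le[OF G.subgroup_imp_group[OF K] assms(1), of "P \<inter> ?K"] finK by simp
  have cP: "card P = card (h ` P) * card (P \<inter> ?K)"
    using group_hom.card_image_kernel[OF gh] kP finP by simp
  have cG: "order G = order H * card ?K"
    using card_image_kernel[OF assms(2)] assms(3) by (simp add: order_def)
  have "order H \<noteq> 0" "card ?K \<noteq> 0"
    using finH finK H.order_gt_0_iff_finite subgroup.one_closed[OF K] by auto
  then have "p ^ ?m (order G) = p ^ ?m (order H) * p ^ ?m (card ?K)"
    using cG assms(1) by (simp add: prime_elem_multiplicity_mult_distrib power_add)
  then have "p ^ ?m (order H) * p ^ ?m (card ?K) \<le> card (h ` P) * p ^ ?m (card ?K)"
    using cP P(2) le by (metis mult_le_mono2)
  then have "p ^ ?m (order H) \<le> card (h ` P)" using assms(1) by (simp add: prime_gt_0_nat)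
  moreover have "card (h ` P) \<le> p ^ ?m (order H)"
    using H.p_subgroup_card_le[OF assms(1) finH sub] pw by blast
  ultimately show ?thesis using sub by (simp add: sylow_subgroup_def)
qed

section \<open>Conjugation and normalizers\<close>

context group
begin

definition conj_by :: "'a \<Rightarrow> 'a \<Rightarrow> 'a" where
  "conj_by g x = g \<otimes> x \<otimes> inv g"

text \<open>\<open>T\<close> is a parameter, so that normalizers inside normalizers are still
  computed in the one ambient group.\<close>

definition norm_in :: "'a set \<Rightarrow> 'a set \<Rightarrow> 'a set" where
  "norm_in T X = {g \<in> T. conj_by g ` X = X}"

lemma inv_telescope:
  assumes "x \<in> carrier G" "y \<in> carrier G" "z \<in> carrier G"
  shows "(inv x \<otimes> y) \<otimes> (inv y \<otimes> z) = inv x \<otimes> z"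
proof -
  have "y \<otimes> (inv y \<otimes> z) = z" using assms by (simp add: m_assoc[symmetric])
  then show ?thesis using assms by (simp add: m_assoc)
qed

lemma conj_by_closed [simp]: "g \<in> carrier G \<Longrightarrow> x \<in> carrier G \<Longrightarrow> conj_by g x \<in> carrier G"
  by (simp add: conj_by_def)

lemma conj_by_one [simp]: "x \<in> carrier G \<Longrightarrow> conj_by \<one> x = x"
  by (simp add: conj_by_def)

lemma conj_by_mult:
  "g \<in> carrier G \<Longrightarrow> x \<in> carrier G \<Longrightarrow> y \<in> carrier G
    \<Longrightarrow> conj_by g (x \<otimes> y) = conj_by g x \<otimes> conj_by g y"
  by (simp add: conj_by_def m_assoc inv_solve_left)

lemma conj_by_comp:
  "g \<in> carrier G \<Longrightarrow> h \<in> carrier G \<Longrightarrow> x \<in> carrier G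
    \<Longrightarrow> conj_by (g \<otimes> h) x = conj_by g (conj_by h x)"
  by (simp add: conj_by_def m_assoc inv_mult_group)

lemma conj_by_inv1 [simp]:
  "g \<in> carrier G \<Longrightarrow> x \<in> carrier G \<Longrightarrow> conj_by (inv g) (conj_by g x) = x"
  by (simp add: conj_by_comp[symmetric])

lemma conj_by_inv2 [simp]:
  "g \<in> carrier G \<Longrightarrow> x \<in> carrier G \<Longrightarrow> conj_by g (conj_by (inv g) x) = x"
  by (simp add: conj_by_comp[symmetric])

lemma inj_on_conj_by: "g \<in> carrier G \<Longrightarrow> X \<subseteq> carrier G \<Longrightarrow> inj_on (conj_by g) X"
  by (rule inj_on_inverseI[where g = "conj_by (inv g)"]) auto

lemma conj_by_commute:
  "g \<in> carrier G \<Longrightarrow> x \<in> carrier G \<Longrightarrow> conj_by g x = x \<longleftrightarrow> g \<otimes> x = x \<otimes> g"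
  unfolding conj_by_def by (metis inv_solve_right m_closed)

lemma conj_by_in_subgroup:
  "subgroup H G \<Longrightarrow> g \<in> H \<Longrightarrow> x \<in> H \<Longrightarrow> conj_by g x \<in> H"
  unfolding conj_by_def by (metis subgroup.m_closed subgroup.m_inv_closed)

lemma conj_by_image_subgroup:
  assumes "subgroup H G" "g \<in> H" shows "conj_by g ` H = H"
proof
  show "conj_by g ` H \<subseteq> H" using conj_by_in_subgroup[OF assms] by auto
  show "H \<subseteq> conj_by g ` H"
  proof
    fix x assume x: "x \<in> H"
    then have "conj_by (inv g) x \<in> H"
      using conj_by_in_subgroup[OF assms(1)] assms subgroup.m_inv_closed by metis
    moreover have "x = conj_by g (conj_by (inv g) x)"
      using x assms subgroup.mem_carrier by (metis conj_by_inv2)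
    ultimately show "x \<in> conj_by g ` H" by blast
  qed
qed

lemma norm_in_subset: "norm_in T X \<subseteq> T"
  by (auto simp: norm_in_def)

text \<open>Conjugation is injective, so for a finite set it is enough that the image is contained
  in the set.\<close>

lemma norm_inI:
  assumes "finite X" "X \<subseteq> carrier G" "T \<subseteq> carrier G" "g \<in> T" "\<And>x. x \<in> X \<Longrightarrow> conj_by g x \<in> X"
  shows "g \<in> norm_in T X"
proof -
  have "conj_by g ` X \<subseteq> X" using assms(5) by auto
  moreover have "card (conj_by g ` X) = card X"
    using assms(2-4) by (intro card_image inj_on_conj_by) auto
  ultimately show ?thesis using assms(1,4) by (simp add: norm_in_def card_subset_eq)
qed

lemma norm_inD: "g \<in> norm_in T X \<Longrightarrow> x \<in> X \<Longrightarrow> conj_by g x \<in> X"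
  by (auto simp: norm_in_def)

lemma norm_in_subgroup:
  assumes "subgroup T G" "X \<subseteq> carrier G" shows "subgroup (norm_in T X) G"
proof (rule subgroupI)
  have TG: "\<And>t. t \<in> T \<Longrightarrow> t \<in> carrier G" using assms(1) subgroup.mem_carrier by metis
  show "norm_in T X \<subseteq> carrier G" using TG by (auto simp: norm_in_def)
  have "conj_by \<one> ` X = X" using assms(2) by (simp add: subset_eq)
  then show "norm_in T X \<noteq> {}"
    using subgroup.one_closed[OF assms(1)] by (auto simp: norm_in_def)
  show "inv g \<in> norm_in T X" if "g \<in> norm_in T X" for g
  proof -
    have "conj_by (inv g) ` X = conj_by (inv g) ` (conj_by g ` X)"
      using that by (simp add: norm_in_def)
    also have "\<dots> = X"
    proof -
      have "g \<in> carrier G" using that TG by (simp add: norm_in_def)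
      then show ?thesis unfolding image_image using assms(2) by (simp add: subset_eq)
    qed
    finally show ?thesis using that subgroup.m_inv_closed[OF assms(1)] by (simp add: norm_in_def)
  qed
  show "g \<otimes> h \<in> norm_in T X" if gh: "g \<in> norm_in T X" "h \<in> norm_in T X" for g h
  proof -
    have "g \<in> carrier G" "h \<in> carrier G" using gh TG by (auto simp: norm_in_def)
    then have "conj_by (g \<otimes> h) ` X = conj_by g ` (conj_by h ` X)"
      unfolding image_image using assms(2) by (intro image_cong) (auto simp: conj_by_comp)
    also have "\<dots> = X" using gh by (simp add: norm_in_def)
    finally show ?thesis using gh subgroup.m_closed[OF assms(1)] by (simp add: norm_in_def)
  qed
qed

lemma subgroup_in_norm_in:
  assumes "subgroup X G" "X \<subseteq> T" shows "X \<subseteq> norm_in T X"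
  using assms conj_by_image_subgroup[OF assms(1)] unfolding norm_in_def by blast

lemma set_mult_memI: "x \<in> X \<Longrightarrow> r \<in> R \<Longrightarrow> x \<otimes> r \<in> X <#> R"
  by (auto simp: set_mult_def)

lemma set_mult_least:
  assumes "subgroup Z G" "X \<subseteq> Z" "R \<subseteq> Z" shows "X <#> R \<subseteq> Z"
  using assms subgroup.m_closed by (fastforce simp: set_mult_def)

lemma set_mult_left: "subgroup X G \<Longrightarrow> subgroup R G \<Longrightarrow> X \<subseteq> X <#> R"
  using set_mult_memI[of _ X \<one> R] subgroup.one_closed[of R G] subgroup.mem_carrier[of X G]
  by (metis r_one subsetI)

lemma set_mult_right: "subgroup X G \<Longrightarrow> subgroup R G \<Longrightarrow> R \<subseteq> X <#> R"
  using set_mult_memI[of \<one> X _ R] subgroup.one_closed[of X G] subgroup.mem_carrier[of R G]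
  by (metis l_one subsetI)

lemma set_mult_absorb:
  assumes "subgroup X G" "subgroup R G" "R \<subseteq> X" shows "X <#> R = X"
  using set_mult_left[OF assms(1,2)] set_mult_least[OF assms(1) _ assms(3)] by blast

lemma set_mult_subgroup:
  assumes X: "subgroup X G" and R: "subgroup R G" and n: "X \<subseteq> norm_in T R"
  shows "subgroup (X <#> R) G"
proof (rule subgroupI)
  note XG = subgroup.mem_carrier[OF X] and RG = subgroup.mem_carrier[OF R]
  show "X <#> R \<subseteq> carrier G" using XG RG by (auto simp: set_mult_def)
  show "X <#> R \<noteq> {}"
    using set_mult_left[OF X R] subgroup.one_closed[OF X] by blast
  have nr: "conj_by x r \<in> R" if "x \<in> X" "r \<in> R" for x r using n that norm_inD by blast
  show "inv g \<in> X <#> R" if gXR: "g \<in> X <#> R" for g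
  proof -
    obtain x r where g: "x \<in> X" "r \<in> R" "g = x \<otimes> r" using gXR by (auto simp: set_mult_def)
    have "inv g = inv x \<otimes> conj_by x (inv r)"
      using g XG RG by (simp add: conj_by_def inv_mult_group m_assoc inv_solve_left)
    moreover have "inv x \<in> X" "conj_by x (inv r) \<in> R"
      using g nr X R subgroup.m_inv_closed by metis+
    ultimately show ?thesis using set_mult_memI by metis
  qed
  show "g \<otimes> h \<in> X <#> R" if gh: "g \<in> X <#> R" "h \<in> X <#> R" for g h
  proof -
    obtain x r where g: "x \<in> X" "r \<in> R" "g = x \<otimes> r" using gh(1) by (auto simp: set_mult_def)
    obtain y s where h: "y \<in> X" "s \<in> R" "h = y \<otimes> s" using gh(2) by (auto simp: set_mult_def)
    have "y \<otimes> (inv y \<otimes> z) = z" if "z \<in> carrier G" for z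
      using that h XG by (simp add: m_assoc[symmetric])
    then have "g \<otimes> h = (x \<otimes> y) \<otimes> (conj_by (inv y) r \<otimes> s)"
      using g h XG RG by (simp add: conj_by_def m_assoc)
    moreover have "x \<otimes> y \<in> X" using g h X subgroup.m_closed by metis
    moreover have "conj_by (inv y) r \<otimes> s \<in> R"
      using g h nr X R subgroup.m_inv_closed subgroup.m_closed by metis
    ultimately show ?thesis using set_mult_memI by metis
  qed
qed

end


section \<open>Morphism predicates\<close>

text \<open>\<open>M X f\<close> says that the restriction of \<open>f\<close> to \<open>X\<close> is a morphism. Fixing one ambient group
  \<open>G\<close> and letting \<open>f\<close> be an arbitrary function avoids both the extensionality bookkeeping
  and the passage between a group and its subgroups.\<close>

locale fus = group G for p :: nat and G :: "('a, 'b) monoid_scheme" (structure) and T :: "'a set"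
    and M :: "'a set \<Rightarrow> ('a \<Rightarrow> 'a) \<Rightarrow> bool" +
  assumes prime_p: "prime p"
    and T_sub: "subgroup T G"
    and T_card: "\<exists>n. card T = p ^ n"
    and M_sub: "M X f \<Longrightarrow> subgroup X G"
    and M_dom: "M X f \<Longrightarrow> X \<subseteq> T"
    and M_img: "M X f \<Longrightarrow> f ` X \<subseteq> T"
    and M_mult: "M X f \<Longrightarrow> x \<in> X \<Longrightarrow> y \<in> X \<Longrightarrow> f (x \<otimes> y) = f x \<otimes> f y"
    and M_inj: "M X f \<Longrightarrow> inj_on f X"
    and M_conj: "subgroup X G \<Longrightarrow> X \<subseteq> T \<Longrightarrow> g \<in> T \<Longrightarrow> M X (conj_by g)"
    and M_res: "M X f \<Longrightarrow> subgroup Y G \<Longrightarrow> Y \<subseteq> X \<Longrightarrow> (\<And>y. y \<in> Y \<Longrightarrow> h y = f y) \<Longrightarrow> M Y h"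
    and M_comp: "M X f \<Longrightarrow> M Y h \<Longrightarrow> f ` X \<subseteq> Y \<Longrightarrow> M X (h \<circ> f)"
    and M_inv: "M X f \<Longrightarrow> M (f ` X) (inv_into X f)"
begin

lemma T_carrier: "T \<subseteq> carrier G" using T_sub subgroup.subset by metis

lemma finite_T: "finite T"
proof -
  obtain n where "card T = p ^ n" using T_card by blast
  then have "card T \<noteq> 0" using prime_p by (metis not_prime_0 power_not_zero)
  then show ?thesis by (metis card.infinite)
qed

lemma sub_finite: "X \<subseteq> T \<Longrightarrow> finite X" using finite_T finite_subset by blast

lemma sub_p_power: "subgroup X G \<Longrightarrow> X \<subseteq> T \<Longrightarrow> \<exists>n. card X = p ^ n"
proof -
  assume X: "subgroup X G" "X \<subseteq> T"
  have "card X dvd card T"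
    using group.lagrange[OF subgroup_imp_group[OF T_sub] subgroup_incl[OF X(1) T_sub X(2)]]
    by (metis dvd_triv_right order_restrict)
  then show ?thesis using T_card prime_p p_power_dvd by metis
qed

lemma M_cong: "M X f \<Longrightarrow> (\<And>x. x \<in> X \<Longrightarrow> h x = f x) \<Longrightarrow> M X h"
  using M_res M_sub by blast

lemma M_id: "subgroup X G \<Longrightarrow> X \<subseteq> T \<Longrightarrow> M X (\<lambda>x. x)"
  using M_cong[OF M_conj[of X \<one>], of "\<lambda>x. x"] subgroup.one_closed[OF T_sub] T_carrier
  by (metis conj_by_one subset_eq)

lemma M_carrier: "M X f \<Longrightarrow> x \<in> X \<Longrightarrow> x \<in> carrier G" using M_sub subgroup.mem_carrier by metis

lemma M_val_carrier: "M X f \<Longrightarrow> x \<in> X \<Longrightarrow> f x \<in> carrier G" using M_img T_carrier by blast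

lemma M_img_sub: "M X f \<Longrightarrow> subgroup (f ` X) G" using M_inv M_sub by blast

lemma M_one: "M X f \<Longrightarrow> f \<one> = \<one>"
proof -
  assume M: "M X f"
  have o: "\<one> \<in> X" using M_sub[OF M] subgroup.one_closed by metis
  then have "f \<one> \<otimes> f \<one> = f \<one>" using M_mult[OF M o o] by simp
  then show ?thesis using M_val_carrier[OF M o] by (simp add: r_cancel_one')
qed

lemma M_inv_elt: "M X f \<Longrightarrow> x \<in> X \<Longrightarrow> f (inv x) = inv (f x)"
proof -
  assume M: "M X f" and x: "x \<in> X"
  have ix: "inv x \<in> X" using M_sub[OF M] x subgroup.m_inv_closed by metis
  have "f (inv x) \<otimes> f x = \<one>"
    using M_mult[OF M ix x] M_one[OF M] M_carrier[OF M x] by simp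
  then show ?thesis
    using M_val_carrier[OF M] x ix by (metis inv_equality)
qed

lemma M_conj_by: "M X f \<Longrightarrow> x \<in> X \<Longrightarrow> y \<in> X \<Longrightarrow> f (conj_by x y) = conj_by (f x) (f y)"
proof -
  assume M: "M X f" and x: "x \<in> X" "y \<in> X"
  have "inv x \<in> X" "x \<otimes> y \<in> X"
    using M_sub[OF M] x subgroup.m_inv_closed subgroup.m_closed by metis+
  then show ?thesis using x M by (simp add: conj_by_def M_mult M_inv_elt)
qed

lemma M_inv_f: "M X f \<Longrightarrow> x \<in> X \<Longrightarrow> inv_into X f (f x) = x" using M_inj by (simp add: inv_into_f_f)

lemma M_inv_cancel: "M X f \<Longrightarrow> Y \<subseteq> X \<Longrightarrow> inv_into X f ` f ` Y = Y"
  unfolding image_image using M_inv_f by (simp add: subset_eq)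

lemma M_inv_img: "M X f \<Longrightarrow> inv_into X f ` f ` X = X"
  by (rule M_inv_cancel) simp_all

lemma M_card: "M X f \<Longrightarrow> Y \<subseteq> X \<Longrightarrow> card (f ` Y) = card Y"
  using M_inj by (meson card_image inj_on_subset)

lemma M_sub_img: "M X f \<Longrightarrow> subgroup Y G \<Longrightarrow> Y \<subseteq> X \<Longrightarrow> subgroup (f ` Y) G"
  using M_img_sub M_res by blast

lemma M_norm: "M X f \<Longrightarrow> Y \<subseteq> X \<Longrightarrow> x \<in> X \<Longrightarrow> x \<in> norm_in T Y \<Longrightarrow> f x \<in> norm_in T (f ` Y)"
proof -
  assume M: "M X f" and Y: "Y \<subseteq> X" and x: "x \<in> X" "x \<in> norm_in T Y"
  have "conj_by (f x) ` f ` Y = f ` (conj_by x ` Y)"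
    using Y x M_conj_by[OF M] by (auto simp: image_image intro!: image_cong)
  then show ?thesis using x M_img[OF M] by (auto simp: norm_in_def)
qed

lemma M_set_mult_img:
  assumes "M (X <#> R) f" "subgroup X G" "subgroup R G"
  shows "f ` (X <#> R) = f ` X <#> f ` R"
proof -
  have "f (x \<otimes> r) = f x \<otimes> f r" if "x \<in> X" "r \<in> R" for x r
    using assms that set_mult_left set_mult_right by (intro M_mult) blast+
  then show ?thesis by (force simp: set_mult_def)
qed

lemma normalizer_grows_T:
  assumes "subgroup X G" "X \<subseteq> Y" "X \<noteq> Y" "subgroup Y G" "Y \<subseteq> T"
  shows "\<exists>g \<in> Y - X. g \<in> norm_in T X"
proof -
  let ?Y = "G\<lparr>carrier := Y\<rparr>"
  interpret Y: group ?Y by (rule subgroup_imp_group[OF assms(4)])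
  obtain n where "card Y = p ^ n" using sub_p_power assms by blast
  then obtain g where g: "g \<in> Y - X" "\<forall>x \<in> X. g \<otimes> x \<otimes> inv\<^bsub>?Y\<^esub> g \<in> X"
    using Y.normalizer_grows[OF prime_p, of n X] subgroup_incl[OF assms(1,4,2)] sub_finite assms by auto
  have "g \<otimes> x \<otimes> inv g \<in> X" if "x \<in> X" for x
    using g m_inv_consistent[OF assms(4)] that by auto
  then have "g \<in> norm_in T X"
    using assms g T_carrier sub_finite by (intro norm_inI) (auto simp: conj_by_def)
  then show ?thesis using g by blast
qed

lemma norm_in_sub: "X \<subseteq> T \<Longrightarrow> subgroup (norm_in T X) G"
  using norm_in_subgroup[OF T_sub] T_carrier by blast


subsection \<open>Automorphism groups and saturation\<close>

definition Aut :: "'a set \<Rightarrow> ('a \<Rightarrow> 'a) set" where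
  "Aut X = {f \<in> extensional X. M X f \<and> f ` X = X}"

definition AutG :: "'a set \<Rightarrow> ('a \<Rightarrow> 'a) monoid" where
  "AutG X = (BijGroup X)\<lparr>carrier := Aut X\<rparr>"

definition Aut_inner :: "'a set \<Rightarrow> ('a \<Rightarrow> 'a) set" where
  "Aut_inner X = {restrict (conj_by g) X |g. g \<in> norm_in T X}"

definition fully_aut :: "'a set \<Rightarrow> bool" where
  "fully_aut X \<longleftrightarrow> sylow_subgroup p (Aut_inner X) (AutG X)"

text \<open>This is \<open>N\<^sub>\<phi>\<close> for \<phi> the isomorphism that \<open>f\<close>
  induces from \<open>Y\<close> to its image. The element \<open>t\<close> realizes the conjugate of
  \<open>c\<^sub>g\<close> by \<open>f\<close>, and the equation is stated on \<open>Y\<close> in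
  order to avoid the inverse of \<open>f\<close>.\<close>

definition N_of :: "'a set \<Rightarrow> ('a \<Rightarrow> 'a) \<Rightarrow> 'a set" where
  "N_of Y f = {g \<in> norm_in T Y. \<exists>t \<in> norm_in T (f ` Y). \<forall>y \<in> Y. f (conj_by g y) = conj_by t (f y)}"

definition recept :: "'a set \<Rightarrow> bool" where
  "recept X \<longleftrightarrow> (\<forall>Y f. M Y f \<and> f ` Y = X \<longrightarrow> (\<exists>h. M (N_of Y f) h \<and> (\<forall>y \<in> Y. h y = f y)))"

definition saturated_M :: bool where
  "saturated_M \<longleftrightarrow> (\<forall>X. subgroup X G \<and> X \<subseteq> T \<longrightarrow> (\<exists>f. M X f \<and> fully_aut (f ` X) \<and> recept (f ` X)))"

lemma M_restrict: "M X f \<Longrightarrow> M X (restrict f X)"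
  by (rule M_cong) auto

lemma Aut_restrict: "M X f \<Longrightarrow> f ` X = X \<Longrightarrow> restrict f X \<in> Aut X"
  using M_restrict by (simp add: Aut_def)

lemma AutD: "f \<in> Aut X \<Longrightarrow> M X f" "f \<in> Aut X \<Longrightarrow> f ` X = X" "f \<in> Aut X \<Longrightarrow> x \<in> X \<Longrightarrow> f x \<in> X"
  by (auto simp: Aut_def)

lemma Aut_ext: "f \<in> Aut X \<Longrightarrow> h \<in> Aut X \<Longrightarrow> (\<And>x. x \<in> X \<Longrightarrow> f x = h x) \<Longrightarrow> f = h"
  unfolding Aut_def by (auto intro: extensionalityI)

lemma Aut_Bij: "Aut X \<subseteq> Bij X"
  using M_inj by (auto simp: Aut_def Bij_def bij_betw_def)

lemma carrier_AutG [simp]: "carrier (AutG X) = Aut X" by (simp add: AutG_def)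

lemma Aut_subgroup:
  assumes "subgroup X G" "X \<subseteq> T" shows "subgroup (Aut X) (BijGroup X)"
proof (rule group.subgroupI[OF group_BijGroup])
  show "Aut X \<subseteq> carrier (BijGroup X)" using Aut_Bij by (simp add: BijGroup_def)
  show "Aut X \<noteq> {}" using Aut_restrict[OF M_id[OF assms]] by auto
  show "inv\<^bsub>BijGroup X\<^esub> f \<in> Aut X" if "f \<in> Aut X" for f
  proof -
    have "M (f ` X) (inv_into X f)" using that M_inv AutD by blast
    then have "M X (inv_into X f)" using that AutD by metis
    moreover have "inv_into X f ` X = X" using that M_inv_img AutD by metis
    ultimately have "restrict (inv_into X f) X \<in> Aut X" by (rule Aut_restrict)
    moreover have "inv\<^bsub>BijGroup X\<^esub> f = restrict (inv_into X f) X"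
      using that Aut_Bij[of X] inv_BijGroup[of f X] by auto
    ultimately show ?thesis by simp
  qed
  show "f \<otimes>\<^bsub>BijGroup X\<^esub> h \<in> Aut X" if "f \<in> Aut X" "h \<in> Aut X" for f h
  proof -
    have "M X (f \<circ> h)" using M_comp[OF AutD(1)[OF that(2)] AutD(1)[OF that(1)]] AutD(2)[OF that(2)] by simp
    moreover have "(f \<circ> h) ` X = X" using that AutD by (metis image_comp)
    ultimately have "restrict (f \<circ> h) X \<in> Aut X" by (rule Aut_restrict)
    moreover have "f \<otimes>\<^bsub>BijGroup X\<^esub> h = restrict (f \<circ> h) X"
      using that Aut_Bij by (auto simp: BijGroup_def compose_def o_def)
    ultimately show ?thesis by simp
  qed
qed

lemma AutG_group: "subgroup X G \<Longrightarrow> X \<subseteq> T \<Longrightarrow> group (AutG X)"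
  unfolding AutG_def using group.subgroup_imp_group[OF group_BijGroup Aut_subgroup] by blast

lemma AutG_mult: "f \<in> Aut X \<Longrightarrow> h \<in> Aut X \<Longrightarrow> x \<in> X \<Longrightarrow> (f \<otimes>\<^bsub>AutG X\<^esub> h) x = f (h x)"
  using Aut_Bij by (auto simp: AutG_def BijGroup_def compose_def)

lemma AutG_one: "x \<in> X \<Longrightarrow> \<one>\<^bsub>AutG X\<^esub> x = x"
  by (simp add: AutG_def BijGroup_def)

lemma AutG_inv:
  assumes "subgroup X G" "X \<subseteq> T" "f \<in> Aut X" "x \<in> X"
  shows "(inv\<^bsub>AutG X\<^esub> f) x \<in> X" "(inv\<^bsub>AutG X\<^esub> f) (f x) = x" "f ((inv\<^bsub>AutG X\<^esub> f) x) = x"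
proof -
  interpret A: group "AutG X" by (rule AutG_group[OF assms(1,2)])
  have i: "inv\<^bsub>AutG X\<^esub> f \<in> Aut X" using assms(3) A.inv_closed by simp
  show "(inv\<^bsub>AutG X\<^esub> f) x \<in> X" using AutD(3)[OF i assms(4)] .
  show "(inv\<^bsub>AutG X\<^esub> f) (f x) = x"
    using A.l_inv[of f] AutG_mult[OF i assms(3,4)] AutG_one[OF assms(4)] assms(3) by simp
  show "f ((inv\<^bsub>AutG X\<^esub> f) x) = x"
    using A.r_inv[of f] AutG_mult[OF assms(3) i assms(4)] AutG_one[OF assms(4)] assms(3) by simp
qed

lemma Aut_finite: "X \<subseteq> T \<Longrightarrow> finite (Aut X)"
proof -
  assume "X \<subseteq> T"
  then have "finite (X \<rightarrow>\<^sub>E X)" using sub_finite by (simp add: finite_PiE)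
  moreover have "Aut X \<subseteq> X \<rightarrow>\<^sub>E X" by (auto simp: Aut_def PiE_def)
  ultimately show ?thesis using finite_subset by blast
qed

text \<open>Sylow conjugacy in \<open>AutG X\<close> gives an \<open>a\<close> that conjugates
  \<open>J\<close> into \<open>Aut_inner X\<close>. The resulting equation is evaluated at points
  \<open>a x\<close>, which removes the inverse of \<open>a\<close>.\<close>

lemma fully_aut_conj:
  assumes X: "subgroup X G" "X \<subseteq> T" and "fully_aut X" "subgroup J (AutG X)" "card J = p ^ n"
  shows "\<exists>a \<in> Aut X. \<forall>j \<in> J. \<exists>t \<in> norm_in T X. \<forall>x \<in> X. a (j x) = conj_by t (a x)"
proof -
  interpret A: group "AutG X" by (rule AutG_group[OF X])
  obtain a where a: "a \<in> Aut X" "\<forall>j \<in> J. a \<otimes>\<^bsub>AutG X\<^esub> j \<otimes>\<^bsub>AutG X\<^esub> inv\<^bsub>AutG X\<^esub> a \<in> Aut_inner X"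
    using A.sylow_conjugate[OF prime_p _ assms(3)[unfolded fully_aut_def] assms(4,5)] Aut_finite[OF X(2)]
    by auto
  have "\<exists>t \<in> norm_in T X. \<forall>x \<in> X. a (j x) = conj_by t (a x)" if j: "j \<in> J" for j
  proof -
    have jA: "j \<in> Aut X" using subgroup.subset[OF assms(4)] j by auto
    obtain t where t: "t \<in> norm_in T X" "a \<otimes>\<^bsub>AutG X\<^esub> j \<otimes>\<^bsub>AutG X\<^esub> inv\<^bsub>AutG X\<^esub> a = restrict (conj_by t) X"
      using a(2) j by (auto simp: Aut_inner_def)
    have "a (j x) = conj_by t (a x)" if x: "x \<in> X" for x
    proof -
      have "(a \<otimes>\<^bsub>AutG X\<^esub> j \<otimes>\<^bsub>AutG X\<^esub> inv\<^bsub>AutG X\<^esub> a) (a x) = a (j x)"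
        using a jA x A.m_closed[of a j] A.inv_closed[of a]
        by (simp add: AutG_mult AutG_inv[OF X] AutD)
      then show ?thesis using t x AutD(3)[OF a(1) x] by simp
    qed
    then show ?thesis using t by blast
  qed
  then show ?thesis using a by blast
qed

text \<open>A normal p-subgroup lies in every Sylow p-subgroup, and full automization makes
  \<open>Aut_inner X\<close> one of these.\<close>

lemma Aut_inner_normal:
  assumes X: "subgroup X G" "X \<subseteq> T" and "fully_aut X" and K: "K \<lhd> AutG X" and "card K = p ^ n" and "k \<in> K"
  shows "\<exists>t \<in> norm_in T X. \<forall>x \<in> X. k x = conj_by t x"
proof -
  interpret A: group "AutG X" by (rule AutG_group[OF X])
  have KA: "K \<subseteq> Aut X" using K normal_imp_subgroup subgroup.subset by fastforce
  obtain a where a: "a \<in> Aut X" "\<forall>j \<in> K. \<exists>t \<in> norm_in T X. \<forall>x \<in> X. a (j x) = conj_by t (a x)"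
    using fully_aut_conj[OF X assms(3) normal_imp_subgroup[OF K] assms(5)] by blast
  \<comment> \<open>Normality of \<open>K\<close> enters here: the conjugation by \<open>a\<close>
    is undone by applying it to this conjugate of \<open>k\<close> instead of to
    \<open>k\<close>.\<close>
  let ?j = "inv\<^bsub>AutG X\<^esub> a \<otimes>\<^bsub>AutG X\<^esub> k \<otimes>\<^bsub>AutG X\<^esub> a"
  have "?j \<in> K" using normal.inv_op_closed1[OF K, of a k] a assms(6) by simp
  then obtain t where t: "t \<in> norm_in T X" "\<forall>x \<in> X. a (?j x) = conj_by t (a x)" using a by blast
  have kA: "k \<in> Aut X" using assms(6) KA by blast
  have "k x = conj_by t x" if x: "x \<in> X" for x
  proof -
    let ?y = "(inv\<^bsub>AutG X\<^esub> a) x"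
    have y: "?y \<in> X" "a ?y = x" using AutG_inv[OF X a(1) x] by auto
    have "?j ?y = (inv\<^bsub>AutG X\<^esub> a) (k x)"
      using x y a kA A.m_closed[of "inv\<^bsub>AutG X\<^esub> a" k] A.inv_closed[of a]
      by (simp add: AutG_mult AutD)
    then have "a (?j ?y) = k x" using AutG_inv[OF X a(1)] AutD(3)[OF kA x] by simp
    then show ?thesis using t y by metis
  qed
  then show ?thesis using t by blast
qed

text \<open>Source of the p-subgroups of \<open>AutG X\<close> to which Sylow conjugacy is applied:
  images of subgroups of \<open>T\<close> under homomorphisms.\<close>

lemma p_image_in_Aut:
  assumes X: "subgroup X G" "X \<subseteq> T" and H: "subgroup H G" "H \<subseteq> T"
    and r: "\<And>g. g \<in> H \<Longrightarrow> r g \<in> Aut X"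
    and m: "\<And>g h x. g \<in> H \<Longrightarrow> h \<in> H \<Longrightarrow> x \<in> X \<Longrightarrow> r (g \<otimes> h) x = r g (r h x)"
  shows "subgroup (r ` H) (AutG X)" "\<exists>n. card (r ` H) = p ^ n"
proof -
  interpret A: group "AutG X" by (rule AutG_group[OF X])
  have "r \<in> hom (G\<lparr>carrier := H\<rparr>) (AutG X)"
  proof (rule homI)
    fix g h assume gh: "g \<in> carrier (G\<lparr>carrier := H\<rparr>)" "h \<in> carrier (G\<lparr>carrier := H\<rparr>)"
    then show "r g \<in> carrier (AutG X)" using r by simp
    have "g \<otimes> h \<in> H" using gh H subgroup.m_closed by force
    moreover have "r g \<otimes>\<^bsub>AutG X\<^esub> r h \<in> Aut X" using A.m_closed[of "r g" "r h"] r gh by simp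
    ultimately have "r (g \<otimes> h) = r g \<otimes>\<^bsub>AutG X\<^esub> r h"
      using r gh m by (intro Aut_ext) (auto simp: AutG_mult)
    then show "r (g \<otimes>\<^bsub>G\<lparr>carrier := H\<rparr>\<^esub> h) = r g \<otimes>\<^bsub>AutG X\<^esub> r h" by simp
  qed
  then have gh: "group_hom (G\<lparr>carrier := H\<rparr>) (AutG X) r"
    using subgroup_imp_group[OF H(1)] A.is_group by (simp add: group_hom_def group_hom_axioms_def)
  obtain n where "card H = p ^ n" using sub_p_power H by blast
  then show "subgroup (r ` H) (AutG X)" "\<exists>n. card (r ` H) = p ^ n"
    using p_power_image[OF prime_p gh, of n] by auto
qed

lemma norm_in_restrict_Aut:
  assumes X: "subgroup X G" "X \<subseteq> T" and g: "g \<in> norm_in T X"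
  shows "restrict (conj_by g) X \<in> Aut X"
  using g M_conj[OF X] by (intro Aut_restrict) (auto simp: norm_in_def)

text \<open>Carried over by \<open>f\<close>, the conjugations by \<open>N\<^sub>T(Y)\<close> form a
  p-subgroup of \<open>AutG X\<close>. As \<open>X\<close> is fully automized, some automorphism
  \<open>a\<close> conjugates it into \<open>Aut_inner X\<close>; then
  \<open>N_of Y (a \<circ> f)\<close> is all of \<open>N\<^sub>T(Y)\<close>, and receptivity
  applies. The map \<open>h\<close> extends \<open>a \<circ> f\<close> and not necessarily
  \<open>f\<close>.\<close>

lemma extend_to_normalizer:
  assumes X: "fully_aut X" "recept X" and f: "M Y f" "f ` Y = X"
  shows "\<exists>h. M (norm_in T Y) h \<and> h ` Y = X"
proof -
  note Y = M_sub[OF f(1)] M_dom[OF f(1)]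
  have X': "subgroup X G" "X \<subseteq> T" using M_img_sub[OF f(1)] M_img[OF f(1)] f(2) by auto
  let ?f' = "inv_into Y f"
  let ?r = "\<lambda>g. restrict (f \<circ> (conj_by g \<circ> ?f')) X"
  have f'X: "M X ?f'" "?f' ` X = Y" using M_inv[OF f(1)] M_inv_img[OF f(1)] f(2) by auto
  have f'in: "?f' x \<in> Y" "f (?f' x) = x" if "x \<in> X" for x
    using f(2) that by (auto simp: inv_into_into f_inv_into_f)
  have r_in: "?r g \<in> Aut X" if g: "g \<in> norm_in T Y" for g
  proof -
    have gY: "conj_by g ` Y = Y" and gT: "g \<in> T" using g by (auto simp: norm_in_def)
    have "M X (conj_by g \<circ> ?f')" using M_comp[OF f'X(1) M_conj[OF Y gT]] f'X(2) by simp
    moreover have im: "(conj_by g \<circ> ?f') ` X = Y" using f'X(2) gY by (metis image_comp)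
    ultimately have "M X (f \<circ> (conj_by g \<circ> ?f'))" using M_comp f(1) by blast
    moreover have "(f \<circ> (conj_by g \<circ> ?f')) ` X = X" using im f(2) by (metis image_comp)
    ultimately show ?thesis by (rule Aut_restrict)
  qed
  have NY: "subgroup (norm_in T Y) G" "norm_in T Y \<subseteq> T" using norm_in_sub Y norm_in_subset by blast+
  have rm: "?r (g \<otimes> h) x = ?r g (?r h x)" if gh: "g \<in> norm_in T Y" "h \<in> norm_in T Y" and x: "x \<in> X" for g h x
  proof -
    have c: "conj_by h (?f' x) \<in> Y" using norm_inD[OF gh(2)] f'in(1)[OF x] .
    have car: "g \<in> carrier G" "h \<in> carrier G" "?f' x \<in> carrier G"
      using gh NY(1) f'in(1)[OF x] Y(1) subgroup.mem_carrier by metis+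
    have "f (conj_by h (?f' x)) \<in> X" using c f(2) by blast
    then show ?thesis using x M_inv_f[OF f(1) c] car by (simp add: conj_by_comp)
  qed
  obtain n where "subgroup (?r ` norm_in T Y) (AutG X)" "card (?r ` norm_in T Y) = p ^ n"
    using p_image_in_Aut[OF X' NY r_in rm] by blast
  then obtain a where a: "a \<in> Aut X"
    "\<forall>j \<in> ?r ` norm_in T Y. \<exists>t \<in> norm_in T X. \<forall>x \<in> X. a (j x) = conj_by t (a x)"
    using fully_aut_conj[OF X' X(1)] by blast
  have Maf: "M Y (a \<circ> f)" using M_comp[OF f(1) AutD(1)[OF a(1)]] f(2) by simp
  have img: "(a \<circ> f) ` Y = X" using f(2) AutD(2)[OF a(1)] by (metis image_comp)
  have "N_of Y (a \<circ> f) = norm_in T Y"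
  proof (intro equalityI subsetI)
    fix g assume g: "g \<in> norm_in T Y"
    then obtain t where t: "t \<in> norm_in T X" "\<forall>x \<in> X. a (?r g x) = conj_by t (a x)" using a by blast
    have "(a \<circ> f) (conj_by g y) = conj_by t ((a \<circ> f) y)" if y: "y \<in> Y" for y
    proof -
      have "f y \<in> X" using y f(2) by blast
      then have "a (?r g (f y)) = conj_by t (a (f y))" using t by blast
      then show ?thesis using \<open>f y \<in> X\<close> M_inv_f[OF f(1) y] by simp
    qed
    then show "g \<in> N_of Y (a \<circ> f)" using g t img unfolding N_of_def by blast
  qed (simp add: N_of_def)
  then obtain h where h: "M (norm_in T Y) h" "\<forall>y \<in> Y. h y = (a \<circ> f) y"
    using X(2) Maf img unfolding recept_def by metis
  then have "h ` Y = X" using img by (metis image_cong)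
  then show ?thesis using h(1) by blast
qed


subsection \<open>Alperin induction\<close>

text \<open>Downward induction on the order of \<open>X\<close>, with a property \<open>Good\<close>
  in place of a decomposition into a chain of automorphisms. In \<open>aut\<close> the claim is
  available on all larger members of the family \<open>C\<close>. The premise \<open>img\<close> may
  use \<open>Good X f\<close>: when \<open>C\<close> consists of the overgroups of \<open>Q\<close>,
  it is the goodness of \<open>f\<close>, namely that it fixes \<open>Q\<close>, that keeps the
  image in the family.\<close>

lemma alperin_induct:
  assumes sat: saturated_M
    and restr: "\<And>X Y f h. \<lbrakk>Good Y f; X \<in> C; X \<subseteq> Y; M Y f; M X h; \<And>x. x \<in> X \<Longrightarrow> h x = f x\<rbrakk> \<Longrightarrow> Good X h"
    and comp: "\<And>X f h. \<lbrakk>X \<in> C; M X f; M (f ` X) h; Good X f; Good (f ` X) h\<rbrakk> \<Longrightarrow> Good X (h \<circ> f)"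
    and img: "\<And>X f. \<lbrakk>X \<in> C; M X f; Good X f\<rbrakk> \<Longrightarrow> f ` X \<in> C"
    and up: "\<And>X Y. \<lbrakk>X \<in> C; X \<subseteq> Y; subgroup Y G; Y \<subseteq> T\<rbrakk> \<Longrightarrow> Y \<in> C"
    and aut: "\<And>X a. \<lbrakk>X \<in> C; fully_aut X; recept X; M X a; a ` X = X;
        \<And>Y f. \<lbrakk>Y \<in> C; X \<subset> Y; M Y f\<rbrakk> \<Longrightarrow> Good Y f\<rbrakk> \<Longrightarrow> Good X a"
    and X: "X \<in> C" "M X f"
  shows "Good X f"
  using X
proof (induction "card T - card X" arbitrary: X f rule: less_induct)
  case less
  note XM = M_sub[OF less.prems(2)] M_dom[OF less.prems(2)]
  have big: "Good Y h" if "Y \<in> C" "card X < card Y" "M Y h" for Y h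
  proof -
    have "card Y \<le> card T" using M_dom[OF that(3)] finite_T card_mono by blast
    then show ?thesis using less.hyps[of Y h] that by simp
  qed
  obtain f1 where f1: "M X f1" "fully_aut (f1 ` X)" "recept (f1 ` X)"
    using sat XM unfolding saturated_M_def by blast
  define X' where "X' = f1 ` X"
  have cX': "card X' = card X" using M_card[OF f1(1)] by (simp add: X'_def)
  have X'T: "X' \<subseteq> T" using M_img[OF f1(1)] by (simp add: X'_def)
  have autX': "Good X' a" if "X' \<in> C" "M X' a" "a ` X' = X'" for a
  proof (rule aut[OF that(1) _ _ that(2,3)])
    show "fully_aut X'" "recept X'" using f1 by (simp_all add: X'_def)
    show "Good Y h" if "Y \<in> C" "X' \<subset> Y" "M Y h" for Y h
    proof -
      have "card X' < card Y" using that M_dom[OF that(3)] sub_finite by (meson psubset_card_mono)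
      then show ?thesis using big that cX' by simp
    qed
  qed
  show ?case
  proof (cases "X = T")
    case True
    \<comment> \<open>There is no group larger than \<open>T\<close> to extend to, but here
      \<open>f\<close> is itself an automorphism of \<open>T\<close>.\<close>
    have "X' = X" using cX' X'T True finite_T card_subset_eq by blast
    moreover have "f ` X = X"
      using True M_img[OF less.prems(2)] M_card[OF less.prems(2)] finite_T card_subset_eq by blast
    ultimately show ?thesis using autX'[of f] less.prems by simp
  next
    case False
    have grow: "card Z < card (norm_in T Z)" "Z \<subseteq> norm_in T Z" if Z: "subgroup Z G" "Z \<subseteq> T" "Z \<noteq> T" for Z
    proof -
      show "Z \<subseteq> norm_in T Z" using subgroup_in_norm_in Z by blast
      moreover obtain g where "g \<in> T - Z" "g \<in> norm_in T Z"
        using normalizer_grows_T[OF Z T_sub] by blast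
      ultimately show "card Z < card (norm_in T Z)"
        using sub_finite[OF norm_in_subset] by (intro psubset_card_mono) auto
    qed
    obtain h1 where h1: "M (norm_in T X) h1" "h1 ` X = X'"
      using extend_to_normalizer[OF f1(2,3,1)] X'_def by blast
    have NX: "X \<subseteq> norm_in T X" "subgroup (norm_in T X) G" "norm_in T X \<in> C"
      using grow(2)[OF XM False] norm_in_sub[OF XM(2)] up[OF less.prems(1)] norm_in_subset by blast+
    have Mh1: "M X h1" using M_res[OF h1(1) XM(1) NX(1)] by simp
    have Gh1: "Good X h1"
      using restr[OF big[OF NX(3) grow(1)[OF XM False] h1(1)] less.prems(1) NX(1) h1(1) Mh1] by simp
    have X'C: "X' \<in> C" using img[OF less.prems(1) Mh1 Gh1] h1(2) by simp
    define Y where "Y = f ` X"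
    have Y: "subgroup Y G" "Y \<subseteq> T" "card Y = card X"
      using M_img_sub M_img M_card less.prems(2) by (auto simp: Y_def)
    have YT: "Y \<noteq> T" using False Y(3) XM(2) finite_T card_subset_eq by metis
    have "M Y (f1 \<circ> inv_into X f)"
      using M_comp[OF M_inv[OF less.prems(2)] f1(1)] M_inv_img[OF less.prems(2)] by (simp add: Y_def)
    moreover have "(f1 \<circ> inv_into X f) ` Y = X'"
      using M_inv_img[OF less.prems(2)] by (metis X'_def Y_def image_comp)
    ultimately obtain h2 where h2: "M (norm_in T Y) h2" "h2 ` Y = X'"
      using extend_to_normalizer[OF f1(2,3)[folded X'_def], of Y "f1 \<circ> inv_into X f"] by blast
    define Z where "Z = h2 ` norm_in T Y"
    define k where "k = inv_into (norm_in T Y) h2"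
    have Z: "X' \<subseteq> Z" "subgroup Z G" "Z \<subseteq> T" "card Z = card (norm_in T Y)"
      using h2 grow(2)[OF Y(1,2) YT] M_img_sub[OF h2(1)] M_img[OF h2(1)] M_card[OF h2(1)]
      by (auto simp: Z_def)
    have Mk: "M Z k" using M_inv[OF h2(1)] by (simp add: Z_def k_def)
    have X'sub: "subgroup X' G" using M_img_sub[OF f1(1)] by (simp add: X'_def)
    have MkX: "M X' k" using M_res[OF Mk X'sub Z(1)] by simp
    have "Good Z k"
      using big[OF up[OF X'C Z(1-3)] _ Mk] grow(1)[OF Y(1,2) YT] Z(4) Y(3) by simp
    then have Gk: "Good X' k" using restr[OF _ X'C Z(1) Mk MkX] by simp
    \<comment> \<open>On \<open>X\<close> the morphism \<open>f\<close> is
      \<open>k \<circ> a \<circ> h1\<close>. The outer factors are restrictions of morphisms on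
      \<open>N\<^sub>T(X)\<close> and on \<open>Z\<close>, a copy of \<open>N\<^sub>T(Y)\<close>,
      both of larger order than \<open>X\<close>; the middle factor is an automorphism of the fully
      automized and receptive group \<open>X'\<close>.\<close>
    define a where "a = h2 \<circ> (f \<circ> inv_into X h1)"
    have "M X' (f \<circ> inv_into X h1)"
      using M_comp[OF M_inv[OF Mh1] less.prems(2)] M_inv_img[OF Mh1] h1(2) by simp
    moreover have imgY: "(f \<circ> inv_into X h1) ` X' = Y"
      using M_inv_img[OF Mh1] h1(2) by (metis Y_def image_comp)
    moreover have "M Y h2" using M_res[OF h2(1) Y(1) grow(2)[OF Y(1,2) YT]] by simp
    ultimately have Ma: "M X' a" unfolding a_def using M_comp by blast
    have aX: "a ` X' = X'" unfolding a_def using imgY h2(2) by (metis image_comp)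
    have "Good X' (k \<circ> a)" using comp[OF X'C Ma _ autX'[OF X'C Ma aX]] aX MkX Gk by simp
    moreover have "M X' (k \<circ> a)" using M_comp[OF Ma MkX] aX by simp
    ultimately have G1: "Good X ((k \<circ> a) \<circ> h1)" and M1: "M X ((k \<circ> a) \<circ> h1)"
      using comp[OF less.prems(1) Mh1 _ Gh1] M_comp[OF Mh1] h1(2) by auto
    have "f x = ((k \<circ> a) \<circ> h1) x" if "x \<in> X" for x
    proof -
      have "f x \<in> norm_in T Y" using grow(2)[OF Y(1,2) YT] that by (auto simp: Y_def)
      then show ?thesis using M_inv_f[OF Mh1 that] M_inv_f[OF h2(1)] by (simp add: a_def k_def)
    qed
    then show ?thesis using restr[OF G1 less.prems(1) _ M1 less.prems(2)] by simp
  qed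
qed

subsection \<open>Subgroups of automorphism groups\<close>

lemma N_of_subset: "N_of Y f \<subseteq> norm_in T Y"
  by (auto simp: N_of_def)

lemma N_of_contains:
  assumes "M Y f" shows "Y \<subseteq> N_of Y f"
proof
  fix y assume y: "y \<in> Y"
  note Y = M_sub[OF assms] M_dom[OF assms]
  have "y \<in> norm_in T Y" using subgroup_in_norm_in[OF Y] y by blast
  moreover have "f y \<in> norm_in T (f ` Y)"
    using subgroup_in_norm_in[OF M_img_sub[OF assms] M_img[OF assms]] y by blast
  ultimately show "y \<in> N_of Y f" using M_conj_by[OF assms y] unfolding N_of_def by blast
qed

lemma N_of_subgroup:
  assumes "M Y f" shows "subgroup (N_of Y f) G"
proof (rule subgroupI)
  note Y = M_sub[OF assms] M_dom[OF assms]
  have NY: "subgroup (norm_in T Y) G" and NfY: "subgroup (norm_in T (f ` Y)) G"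
    using norm_in_sub[OF Y(2)] norm_in_sub[OF M_img[OF assms]] by auto
  note car = subgroup.mem_carrier[OF NY] subgroup.mem_carrier[OF NfY]
    M_carrier[OF assms] M_val_carrier[OF assms]
  show "N_of Y f \<subseteq> carrier G" using N_of_subset car by blast
  show "N_of Y f \<noteq> {}" using N_of_contains[OF assms] subgroup.one_closed[OF Y(1)] by blast
  fix g assume g: "g \<in> N_of Y f"
  then obtain t where t: "g \<in> norm_in T Y" "t \<in> norm_in T (f ` Y)"
    "\<And>y. y \<in> Y \<Longrightarrow> f (conj_by g y) = conj_by t (f y)" by (auto simp: N_of_def)
  have "f (conj_by (inv g) y) = conj_by (inv t) (f y)" if y: "y \<in> Y" for y
  proof -
    have y': "conj_by (inv g) y \<in> Y"
      using norm_inD[OF subgroup.m_inv_closed[OF NY t(1)] y] .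
    have "f y = conj_by t (f (conj_by (inv g) y))" using t(3)[OF y'] t(1) car y by simp
    then show ?thesis using t(2) car y' by simp
  qed
  then show "inv g \<in> N_of Y f"
    using subgroup.m_inv_closed[OF NY t(1)] subgroup.m_inv_closed[OF NfY t(2)]
    unfolding N_of_def by blast
  fix g' assume "g' \<in> N_of Y f"
  then obtain t' where t': "g' \<in> norm_in T Y" "t' \<in> norm_in T (f ` Y)"
    "\<And>y. y \<in> Y \<Longrightarrow> f (conj_by g' y) = conj_by t' (f y)" by (auto simp: N_of_def)
  have "f (conj_by (g \<otimes> g') y) = conj_by (t \<otimes> t') (f y)" if y: "y \<in> Y" for y
    using t t' car y norm_inD[OF t'(1) y] by (simp add: conj_by_comp)
  then show "g \<otimes> g' \<in> N_of Y f"
    using subgroup.m_closed[OF NY t(1) t'(1)] subgroup.m_closed[OF NfY t(2) t'(2)]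
    unfolding N_of_def by blast
qed

lemma AutG_subgroupI:
  assumes X: "subgroup X G" "X \<subseteq> T" and "B \<subseteq> Aut X" "restrict (\<lambda>x. x) X \<in> B"
    and "\<And>f. f \<in> B \<Longrightarrow> inv\<^bsub>AutG X\<^esub> f \<in> B"
    and "\<And>f h. f \<in> B \<Longrightarrow> h \<in> B \<Longrightarrow> f \<otimes>\<^bsub>AutG X\<^esub> h \<in> B"
  shows "subgroup B (AutG X)"
  using assms by (intro group.subgroupI[OF AutG_group[OF X]]) auto

lemma AutG_inv_img:
  assumes X: "subgroup X G" "X \<subseteq> T" and f: "f \<in> Aut X" "f ` A = A" and A: "A \<subseteq> X"
  shows "(inv\<^bsub>AutG X\<^esub> f) ` A = A"
proof -
  have "(inv\<^bsub>AutG X\<^esub> f) ` f ` A = A"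
    unfolding image_image using AutG_inv(2)[OF X f(1)] A by (simp add: subset_eq)
  then show ?thesis using f(2) by simp
qed

lemma AutG_inv_closed:
  assumes "subgroup X G" "X \<subseteq> T" "f \<in> Aut X" shows "inv\<^bsub>AutG X\<^esub> f \<in> Aut X"
  using group.inv_closed[OF AutG_group[OF assms(1,2)]] assms(3) by simp

lemma AutG_m_closed:
  assumes "subgroup X G" "X \<subseteq> T" "f \<in> Aut X" "h \<in> Aut X" shows "f \<otimes>\<^bsub>AutG X\<^esub> h \<in> Aut X"
  using monoid.m_closed[OF group.is_monoid[OF AutG_group[OF assms(1,2)]]] assms(3,4) by simp

lemma AutG_mult_img:
  assumes f: "f \<in> Aut X" "f ` A = A" and h: "h \<in> Aut X" "h ` A = A" and A: "A \<subseteq> X"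
  shows "(f \<otimes>\<^bsub>AutG X\<^esub> h) ` A = A"
proof -
  have "(f \<otimes>\<^bsub>AutG X\<^esub> h) ` A = f ` h ` A"
    unfolding image_image using AutG_mult[OF f(1) h(1)] A by (intro image_cong) auto
  then show ?thesis using f h by simp
qed

lemma Aut_stabilizer_subgroup:
  assumes X: "subgroup X G" "X \<subseteq> T" and A: "A \<subseteq> X" "B \<subseteq> X"
  shows "subgroup {f \<in> Aut X. f ` A = A \<and> f ` B = B} (AutG X)"
proof (rule AutG_subgroupI[OF X])
  have "restrict (\<lambda>x. x) X \<in> Aut X" using Aut_restrict[OF M_id[OF X]] by simp
  moreover have "restrict (\<lambda>x. x) X ` Z = Z" if "Z \<subseteq> X" for Z using that by force
  ultimately show "restrict (\<lambda>x. x) X \<in> {f \<in> Aut X. f ` A = A \<and> f ` B = B}" using A by blast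
qed (use AutG_inv_img[OF X _ _ A(1)] AutG_inv_img[OF X _ _ A(2)] AutG_mult_img[OF _ _ _ _ A(1)]
    AutG_mult_img[OF _ _ _ _ A(2)] AutG_inv_closed[OF X] AutG_m_closed[OF X] in auto)

lemma transport_Aut:
  assumes t: "M Y t" and f: "f \<in> Aut Y"
  shows "restrict (t \<circ> (f \<circ> inv_into Y t)) (t ` Y) \<in> Aut (t ` Y)"
    and "y \<in> Y \<Longrightarrow> restrict (t \<circ> (f \<circ> inv_into Y t)) (t ` Y) (t y) = t (f y)"
proof -
  have ft: "M (t ` Y) (f \<circ> inv_into Y t)"
    using M_comp[OF M_inv[OF t] AutD(1)[OF f]] M_inv_img[OF t] by simp
  have im: "(f \<circ> inv_into Y t) ` t ` Y = Y"
    using M_inv_img[OF t] AutD(2)[OF f] by (metis image_comp)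
  then have "M (t ` Y) (t \<circ> (f \<circ> inv_into Y t))" using M_comp[OF ft t] by simp
  moreover have "(t \<circ> (f \<circ> inv_into Y t)) ` t ` Y = t ` Y" using im by (metis image_comp)
  ultimately show "restrict (t \<circ> (f \<circ> inv_into Y t)) (t ` Y) \<in> Aut (t ` Y)"
    by (rule Aut_restrict)
  show "y \<in> Y \<Longrightarrow> restrict (t \<circ> (f \<circ> inv_into Y t)) (t ` Y) (t y) = t (f y)"
    using M_inv_f[OF t] by simp
qed

text \<open>Conjugation by \<open>t\<close> matches the two stabilizers. Equality of their orders is
  what later identifies a Sylow subgroup after transport.\<close>

lemma card_transport_Aut:
  assumes t: "M Y t" and A: "A \<subseteq> Y" "B \<subseteq> Y"
  shows "card {f \<in> Aut (t ` Y). f ` t ` A = t ` A \<and> f ` t ` B = t ` B}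
       = card {f \<in> Aut Y. f ` A = A \<and> f ` B = B}"
proof -
  define c where "c = (\<lambda>f. restrict (t \<circ> (f \<circ> inv_into Y t)) (t ` Y))"
  define t' where "t' = inv_into Y t"
  define d where "d = (\<lambda>f. restrict (t' \<circ> (f \<circ> t)) Y)"
  have t': "M (t ` Y) t'" using M_inv[OF t] by (simp add: t'_def)
  have t't: "t' (t y) = y" if "y \<in> Y" for y using M_inv_f[OF t that] by (simp add: t'_def)
  have cval: "c f (t y) = t (f y)" if "f \<in> Aut Y" "y \<in> Y" for f y
    using transport_Aut(2)[OF t that] by (simp add: c_def)
  have cAut: "c f \<in> Aut (t ` Y)" if "f \<in> Aut Y" for f
    using transport_Aut(1)[OF t that] by (simp add: c_def)
  have dval: "d f y = t' (f (t y))" if "y \<in> Y" for f y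
    using that by (simp add: d_def)
  have dAut: "d f \<in> Aut Y" if f: "f \<in> Aut (t ` Y)" for f
  proof -
    have ft: "M Y (f \<circ> t)" using M_comp[OF t AutD(1)[OF f]] by simp
    have im: "(f \<circ> t) ` Y = t ` Y" using AutD(2)[OF f] by (metis image_comp)
    then have "M Y (t' \<circ> (f \<circ> t))" using M_comp[OF ft t'] by simp
    moreover have "(t' \<circ> (f \<circ> t)) ` Y = Y" using im M_inv_img[OF t] by (metis image_comp t'_def)
    ultimately show ?thesis unfolding d_def by (rule Aut_restrict)
  qed
  have cimg: "c f ` t ` Z = t ` Z" if "f \<in> Aut Y" "f ` Z = Z" "Z \<subseteq> Y" for f Z
  proof -
    have "c f ` t ` Z = t ` f ` Z"
      unfolding image_image using cval[OF that(1)] that(3) by (intro image_cong) auto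
    then show ?thesis using that by simp
  qed
  have dimg: "d f ` Z = Z" if "f ` t ` Z = t ` Z" "Z \<subseteq> Y" for f Z
  proof -
    have "d f ` Z = t' ` f ` t ` Z"
      unfolding image_image using dval that(2) by (intro image_cong) auto
    also have "\<dots> = Z" using that(1) M_inv_cancel[OF t that(2)] by (simp add: t'_def)
    finally show ?thesis .
  qed
  have dc: "d (c f) = f" if f: "f \<in> Aut Y" for f
  proof (rule Aut_ext[OF dAut[OF cAut[OF f]] f])
    show "d (c f) y = f y" if "y \<in> Y" for y
      using dval[OF that] cval[OF f that] t't AutD(3)[OF f that] by simp
  qed
  have cd: "c (d f) = f" if f: "f \<in> Aut (t ` Y)" for f
  proof (rule Aut_ext[OF cAut[OF dAut[OF f]] f])
    fix x assume "x \<in> t ` Y"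
    then obtain y where y: "y \<in> Y" "x = t y" by blast
    have "f x \<in> t ` Y" using AutD(3)[OF f] y by blast
    then have "t (t' (f x)) = f x" unfolding t'_def by (rule f_inv_into_f)
    then show "c (d f) x = f x" using cval[OF dAut[OF f] y(1)] dval[OF y(1)] y(2) by simp
  qed
  have "bij_betw c {f \<in> Aut Y. f ` A = A \<and> f ` B = B}
      {f \<in> Aut (t ` Y). f ` t ` A = t ` A \<and> f ` t ` B = t ` B}"
  proof (rule bij_betw_byWitness[where f' = d])
    show "c ` {f \<in> Aut Y. f ` A = A \<and> f ` B = B}
        \<subseteq> {f \<in> Aut (t ` Y). f ` t ` A = t ` A \<and> f ` t ` B = t ` B}"
      using cAut cimg A by (intro image_subsetI) simp
    show "d ` {f \<in> Aut (t ` Y). f ` t ` A = t ` A \<and> f ` t ` B = t ` B}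
        \<subseteq> {f \<in> Aut Y. f ` A = A \<and> f ` B = B}"
      using dAut dimg A by (intro image_subsetI) simp
  qed (use dc cd in auto)
  then show ?thesis by (simp add: bij_betw_same_card)
qed

text \<open>Conjugations by \<open>H\<close> on \<open>Y\<close>, carried over by \<open>f\<close>,
  are in general no longer conjugations by elements of \<open>T\<close>, but they still form a
  p-group, so Sylow conjugacy can repair this.\<close>

lemma transport_conj_group:
  assumes f: "M Y f" and H: "subgroup H G" "H \<subseteq> norm_in T Y"
  defines "r \<equiv> \<lambda>g. restrict (f \<circ> (restrict (conj_by g) Y \<circ> inv_into Y f)) (f ` Y)"
  shows "subgroup (r ` H) (AutG (f ` Y))" "\<exists>n. card (r ` H) = p ^ n"
    "\<And>g y. g \<in> H \<Longrightarrow> y \<in> Y \<Longrightarrow> r g (f y) = f (conj_by g y)"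
    "\<And>g. g \<in> H \<Longrightarrow> r g \<in> Aut (f ` Y)"
proof -
  note Y = M_sub[OF f] M_dom[OF f]
  have cA: "restrict (conj_by g) Y \<in> Aut Y" if "g \<in> H" for g
    using norm_in_restrict_Aut[OF Y] H(2) that by blast
  show rA: "r g \<in> Aut (f ` Y)" if "g \<in> H" for g
    using transport_Aut(1)[OF f cA[OF that]] by (simp add: r_def)
  show rv: "r g (f y) = f (conj_by g y)" if "g \<in> H" "y \<in> Y" for g y
    using transport_Aut(2)[OF f cA[OF that(1)] that(2)] that by (simp add: r_def)
  have rm: "r (g \<otimes> h) x = r g (r h x)" if gh: "g \<in> H" "h \<in> H" and x: "x \<in> f ` Y" for g h x
  proof -
    obtain y where y: "y \<in> Y" "x = f y" using x by blast
    have "conj_by h y \<in> Y" using norm_inD H(2) gh(2) y(1) by blast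
    moreover have "g \<otimes> h \<in> H" using subgroup.m_closed[OF H(1)] gh by blast
    ultimately show ?thesis
      using rv gh y subgroup.mem_carrier[OF H(1)] M_carrier[OF f] by (simp add: conj_by_comp)
  qed
  have HT: "H \<subseteq> T" using H(2) norm_in_subset by blast
  show "subgroup (r ` H) (AutG (f ` Y))" "\<exists>n. card (r ` H) = p ^ n"
    using p_image_in_Aut[OF M_img_sub[OF f] M_img[OF f] H(1) HT rA rm] by auto
qed


subsection \<open>Normalizers of subgroups\<close>

text \<open>The normalizer of \<open>P\<close> as a fusion system over \<open>N\<^sub>T(P)\<close>.
  Since \<open>M\<close> records no codomain, only the extension to the product of \<open>X\<close>
  and \<open>P\<close> has to be asked for.\<close>

definition nfus :: "'a set \<Rightarrow> 'a set \<Rightarrow> ('a \<Rightarrow> 'a) \<Rightarrow> bool" where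
  "nfus P X f \<longleftrightarrow> subgroup X G \<and> X \<subseteq> norm_in T P \<and>
     (\<exists>h. M (X <#> P) h \<and> (\<forall>x \<in> X. h x = f x) \<and> h ` P = P)"

lemma norm_prod:
  assumes P: "subgroup P G" "P \<subseteq> T" and X: "subgroup X G" "X \<subseteq> norm_in T P"
  shows "subgroup (X <#> P) G" "X <#> P \<subseteq> norm_in T P" "X <#> P \<subseteq> T"
    "X \<subseteq> X <#> P" "P \<subseteq> X <#> P"
proof -
  show "subgroup (X <#> P) G" using set_mult_subgroup[OF X(1) P(1) X(2)] .
  show "X <#> P \<subseteq> norm_in T P"
    using set_mult_least[OF norm_in_sub[OF P(2)] X(2) subgroup_in_norm_in[OF P]] .
  then show "X <#> P \<subseteq> T" using norm_in_subset by blast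
  show "X \<subseteq> X <#> P" "P \<subseteq> X <#> P" using set_mult_left set_mult_right X(1) P(1) by blast+
qed

lemma nfusI:
  assumes P: "subgroup P G" "P \<subseteq> T" and X: "subgroup X G" "X \<subseteq> norm_in T P"
    and h: "M Z h" "X \<subseteq> Z" "P \<subseteq> Z" "h ` P = P" "\<And>x. x \<in> X \<Longrightarrow> h x = f x"
  shows "nfus P X f"
proof -
  have "M (X <#> P) h"
    using M_res[OF h(1) norm_prod(1)[OF P X] set_mult_least[OF M_sub[OF h(1)] h(2,3)]] by simp
  then show ?thesis using X h(4,5) unfolding nfus_def by blast
qed

lemma nfus_M: "subgroup P G \<Longrightarrow> nfus P X f \<Longrightarrow> M X f"
proof -
  assume P: "subgroup P G" and nf: "nfus P X f"
  then obtain h where h: "M (X <#> P) h" "\<And>x. x \<in> X \<Longrightarrow> h x = f x" and X: "subgroup X G"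
    by (auto simp: nfus_def)
  show "M X f" using M_res[OF h(1) X set_mult_left[OF X P]] h(2) by simp
qed

text \<open>An extension to the product of \<open>X\<close> and \<open>P\<close> that fixes
  \<open>P\<close> has as image the product of the image of \<open>X\<close> and \<open>P\<close>.
  So these extensions can be composed and inverted along with the morphisms.\<close>

lemma nfus_fus:
  assumes P: "subgroup P G" "P \<subseteq> T"
  shows "fus p G (norm_in T P) (nfus P)"
proof (rule fus.intro[OF is_group fus_axioms.intro])
  show "prime p" by (rule prime_p)
  show N: "subgroup (norm_in T P) G" using norm_in_sub[OF P(2)] .
  show "\<exists>n. card (norm_in T P) = p ^ n" using sub_p_power[OF N norm_in_subset] .
  fix X f assume nf: "nfus P X f"
  then obtain h where h: "M (X <#> P) h" "\<And>x. x \<in> X \<Longrightarrow> h x = f x" "h ` P = P"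
    and X: "subgroup X G" "X \<subseteq> norm_in T P" by (auto simp: nfus_def)
  note XP = norm_prod[OF P X]
  note Mf = nfus_M[OF P(1) nf]
  show "subgroup X G" "X \<subseteq> norm_in T P" by fact+
  have "h x \<in> norm_in T P" if "x \<in> X <#> P" for x
    using M_norm[OF h(1) XP(5) that] XP(2) that h(3) by auto
  then show fimg: "f ` X \<subseteq> norm_in T P" using h(2) XP(4) by force
  show "inj_on f X" using M_inj[OF Mf] .
  show "f (x \<otimes> y) = f x \<otimes> f y" if "x \<in> X" "y \<in> X" for x y using M_mult[OF Mf that] .
  show "nfus P Y k" if "subgroup Y G" "Y \<subseteq> X" "\<And>y. y \<in> Y \<Longrightarrow> k y = f y" for Y k
    using that X(2) XP(4,5) h by (intro nfusI[OF P _ _ h(1)]) (auto simp: subset_eq)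
  have him: "h ` (X <#> P) = f ` X <#> P"
    using M_set_mult_img[OF h(1) X(1) P(1)] h by (metis image_cong)
  show "nfus P X (k \<circ> f)" if kY: "nfus P Y k" and fXY: "f ` X \<subseteq> Y" for Y k
  proof -
    obtain h' where h': "M (Y <#> P) h'" "\<And>x. x \<in> Y \<Longrightarrow> h' x = k x" "h' ` P = P"
      and Y: "subgroup Y G" "Y \<subseteq> norm_in T P" using kY by (auto simp: nfus_def)
    have "h ` (X <#> P) \<subseteq> Y <#> P"
      unfolding him using set_mult_least[OF norm_prod(1)[OF P Y]] norm_prod(4,5)[OF P Y] fXY by blast
    then have "M (X <#> P) (h' \<circ> h)" using M_comp[OF h(1) h'(1)] by blast
    moreover have "(h' \<circ> h) ` P = P" using h(3) h'(3) by (metis image_comp)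
    ultimately show ?thesis
      using h h' fXY X(2) XP(4,5) by (intro nfusI[OF P X, of "X <#> P" "h' \<circ> h"]) auto
  qed
  show "nfus P (f ` X) (inv_into X f)"
  proof (rule nfusI[OF P M_img_sub[OF Mf] fimg M_inv[OF h(1)]])
    show "f ` X \<subseteq> h ` (X <#> P)" "P \<subseteq> h ` (X <#> P)"
      using h XP(4,5) by (force simp: image_iff subset_eq)+
    show "inv_into (X <#> P) h ` P = P" using M_inv_cancel[OF h(1) XP(5)] h(3) by simp
    show "inv_into (X <#> P) h x = inv_into X f x" if fx: "x \<in> f ` X" for x
    proof -
      obtain y where y: "y \<in> X" "x = f y" using fx by blast
      then have "y \<in> X <#> P" "x = h y" using XP(4) h(2) by auto
      then show ?thesis using y M_inv_f[OF h(1), of y] M_inv_f[OF Mf, of y] by metis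
    qed
  qed
next
  fix X g assume X: "subgroup X G" "X \<subseteq> norm_in T P" and g: "g \<in> norm_in T P"
  have "g \<in> T" using g norm_in_subset by blast
  then show "nfus P X (conj_by g)"
    using g by (intro nfusI[OF P X M_conj[OF norm_prod(1,3)[OF P X]] norm_prod(4,5)[OF P X]])
      (auto simp: norm_in_def)
qed

subsection \<open>Saturation of normalizers\<close>

text \<open>Fix a subgroup \<open>X\<close> of \<open>N\<^sub>T(P)\<close> and pass to \<open>XP\<close>. The proof moves \<open>(XP, X, P)\<close> to a triple
  \<open>(W\<^sub>0, X\<^sub>0, P)\<close> for which the conjugations by elements of \<open>N\<^sub>T(P) \<inter> N\<^sub>T(X\<^sub>0)\<close> form a Sylow
  \<open>p\<close>-subgroup \<open>H\<^sub>1\<close> of the stabilizer \<open>B\<^sub>1\<close> of \<open>P\<close> and \<open>X\<^sub>0\<close> in \<open>Aut W\<^sub>0\<close>; then \<open>X\<^sub>0\<close> is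
  fully automized and receptive in the normalizer of \<open>P\<close>.\<close>

theorem nfus_saturated:
  assumes sat: saturated_M and P: "subgroup P G" "P \<subseteq> T"
    and FN: "\<And>f. M P f \<Longrightarrow> \<exists>h. M (norm_in T (f ` P)) h \<and> h ` f ` P = P"
  shows "fus.saturated_M p G (norm_in T P) (nfus P)"
proof -
  define N where "N = norm_in T P"
  interpret E: fus p G N "nfus P" unfolding N_def by (rule nfus_fus[OF P])
  have NT: "N \<subseteq> T" by (simp add: N_def norm_in_subset)
  have NN: "subgroup N G" by (rule E.T_sub)
  have PN: "P \<subseteq> N" unfolding N_def by (rule subgroup_in_norm_in[OF P])
  have normNT: "g \<in> norm_in N Z \<longleftrightarrow> g \<in> N \<and> g \<in> norm_in T Z" for g Z
    using NT by (auto simp: norm_in_def)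
  have "\<exists>f. nfus P X f \<and> E.fully_aut (f ` X) \<and> E.recept (f ` X)" if X: "subgroup X G" "X \<subseteq> N" for X
  proof -
    note XN = X(2)[unfolded N_def]
    define W where "W = X <#> P"
    note Wp = norm_prod[OF P X(1) XN, folded W_def]
    obtain \<omega> where \<omega>: "M W \<omega>" "fully_aut (\<omega> ` W)" "recept (\<omega> ` W)"
      using sat Wp(1,3) unfolding saturated_M_def by blast
    define W' where "W' = \<omega> ` W"
    have W': "subgroup W' G" "W' \<subseteq> T" using M_img_sub[OF \<omega>(1)] M_img[OF \<omega>(1)] by (auto simp: W'_def)
    have P1: "\<omega> ` P \<subseteq> W'" and X1: "\<omega> ` X \<subseteq> W'" using Wp(4,5) by (auto simp: W'_def)
    \<comment> \<open>Transported to \<open>W0\<close>, this stabilizer becomes \<open>B1\<close>,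
      which restricts onto the automorphism group of \<open>X0\<close> in the normalizer of
      \<open>P\<close>.\<close>
    define B0 where "B0 = {f \<in> Aut W'. f ` \<omega> ` P = \<omega> ` P \<and> f ` \<omega> ` X = \<omega> ` X}"
    have B0: "subgroup B0 (AutG W')" unfolding B0_def by (rule Aut_stabilizer_subgroup[OF W' P1 X1])
    have B0A: "B0 \<subseteq> Aut W'" by (auto simp: B0_def)
    interpret AW': group "AutG W'" by (rule AutG_group[OF W'])
    have finB0: "finite B0" using B0A Aut_finite[OF W'(2)] finite_subset by blast
    obtain H0 where H0: "sylow_subgroup p H0 (AutG W'\<lparr>carrier := B0\<rparr>)"
      using group.sylow_exists[OF AW'.subgroup_imp_group[OF B0] prime_p] finB0 by auto
    have H0s: "subgroup H0 (AutG W')" "H0 \<subseteq> B0" "card H0 = p ^ multiplicity p (card B0)"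
      using H0 AW'.incl_subgroup[OF B0] subgroup.subset by (fastforce simp: sylow_subgroup_def)+
    \<comment> \<open>Since \<open>W'\<close> is fully automized, the Sylow subgroup
      \<open>H0\<close> can be conjugated into the conjugations by elements of
      \<open>T\<close>.\<close>
    obtain a where a: "a \<in> Aut W'"
      "\<And>j. j \<in> H0 \<Longrightarrow> \<exists>t \<in> norm_in T W'. \<forall>x \<in> W'. a (j x) = conj_by t (a x)"
      using fully_aut_conj[OF W' \<omega>(2)[folded W'_def] H0s(1,3)] by blast
    define P2 where "P2 = a ` \<omega> ` P"
    have M1: "M W (a \<circ> \<omega>)" using M_comp[OF \<omega>(1) AutD(1)[OF a(1)]] by (simp add: W'_def)
    have img1: "(a \<circ> \<omega>) ` W = W'" using AutD(2)[OF a(1)] by (metis W'_def image_comp)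
    have P2eq: "(a \<circ> \<omega>) ` P = P2" by (simp add: P2_def image_comp)
    have MP: "M P (a \<circ> \<omega>)" using M_res[OF M1 P(1) Wp(5)] by simp
    \<comment> \<open>The image \<open>P2\<close> of \<open>P\<close> need not be \<open>P\<close>;
      \<open>FN\<close> takes it back. The domain \<open>N\<^sub>T(P2)\<close> contains
      \<open>W'\<close> and also the elements whose conjugations realize \<open>H0\<close>, so
      \<open>\<chi>\<close> can be applied to both.\<close>
    obtain \<chi> where \<chi>: "M (norm_in T P2) \<chi>" "\<chi> ` P2 = P" using FN[OF MP] P2eq by auto
    have P2: "subgroup P2 G" "P2 \<subseteq> T" "P2 \<subseteq> W'"
      using M_img_sub[OF MP] M_img[OF MP] P2eq img1 Wp(5) by auto
    have W'N: "W' \<subseteq> norm_in T P2"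
      using M_norm[OF M1 Wp(5)] Wp(2) P2eq img1 by fastforce
    have M\<chi>: "M W' \<chi>" using M_res[OF \<chi>(1) W'(1) W'N] by simp
    define \<tau> where "\<tau> = \<chi> \<circ> a"
    have M\<tau>: "M W' \<tau>" unfolding \<tau>_def using M_comp[OF AutD(1)[OF a(1)] M\<chi>] AutD(2)[OF a(1)] by simp
    define W0 where "W0 = \<tau> ` W'"
    define X0 where "X0 = \<tau> ` \<omega> ` X"
    define \<phi> where "\<phi> = \<tau> \<circ> \<omega>"
    have W0\<chi>: "W0 = \<chi> ` W'" unfolding W0_def \<tau>_def using AutD(2)[OF a(1)] by (metis image_comp)
    have X0\<chi>: "X0 = \<chi> ` a ` \<omega> ` X" by (simp add: X0_def \<tau>_def image_comp)
    have M\<phi>: "M W \<phi>" unfolding \<phi>_def using M_comp[OF \<omega>(1) M\<tau>] by (simp add: W'_def)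
    have \<phi>P: "\<phi> ` P = P" using \<chi>(2) by (simp add: \<phi>_def \<tau>_def P2_def image_comp)
    have \<tau>P: "\<tau> ` \<omega> ` P = P" using \<phi>P by (simp add: \<phi>_def image_comp)
    have \<phi>X: "\<phi> ` X = X0" by (simp add: \<phi>_def X0_def image_comp)
    have n\<phi>: "nfus P X \<phi>" using nfusI[OF P X(1) XN M\<phi> Wp(4,5) \<phi>P] by simp
    have X0: "subgroup X0 G" "X0 \<subseteq> N" using E.M_img_sub[OF n\<phi>] E.M_img[OF n\<phi>] \<phi>X by auto
    note X0N = X0(2)[unfolded N_def]
    have W0eq: "W0 = X0 <#> P"
      using M_set_mult_img[OF M\<phi>[unfolded W_def] X(1) P(1)] \<phi>X \<phi>P
      by (metis W0_def W'_def W_def \<phi>_def image_comp)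
    note W0p = norm_prod[OF P X0(1) X0N, folded W0eq]
    have W0NN: "W0 \<subseteq> N" using W0p(2) by (simp add: N_def)
    define NX where "NX = norm_in N X0"
    have NX: "subgroup NX G" "NX \<subseteq> N" "NX \<subseteq> T"
      using E.norm_in_sub[OF X0(2)] norm_in_subset[of N X0] NT by (auto simp: NX_def)
    have NXW0: "t \<in> norm_in T W0" if t: "t \<in> NX" for t
    proof (rule norm_inI[OF sub_finite[OF W0p(3)]])
      show "W0 \<subseteq> carrier G" "T \<subseteq> carrier G" "t \<in> T"
        using W0p(3) T_carrier t NX(3) by blast+
      fix x assume "x \<in> W0"
      then obtain y z where x: "y \<in> X0" "z \<in> P" "x = y \<otimes> z"
        by (auto simp: W0eq set_mult_def)
      have tn: "t \<in> norm_in N X0" "t \<in> norm_in T P" using t NX(2) by (auto simp: NX_def N_def)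
      have "conj_by t x = conj_by t y \<otimes> conj_by t z"
        using x t NX(3) T_carrier X0(1) P(1) subgroup.mem_carrier by (metis conj_by_mult subsetD)
      then show "conj_by t x \<in> W0"
        using norm_inD[OF tn(1) x(1)] norm_inD[OF tn(2) x(2)] by (simp add: W0eq set_mult_memI)
    qed
    define B1 where "B1 = {f \<in> Aut W0. f ` P = P \<and> f ` X0 = X0}"
    have B1: "subgroup B1 (AutG W0)"
      unfolding B1_def by (rule Aut_stabilizer_subgroup[OF W0p(1,3,5,4)])
    have B1A: "B1 \<subseteq> Aut W0" by (auto simp: B1_def)
    have finB1: "finite B1" using B1A Aut_finite[OF W0p(3)] finite_subset by blast
    interpret AW0: group "AutG W0" by (rule AutG_group[OF W0p(1,3)])
    interpret GB1: group "AutG W0\<lparr>carrier := B1\<rparr>" by (rule AW0.subgroup_imp_group[OF B1])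
    have cardB: "card B1 = card B0"
      using card_transport_Aut[OF M\<tau> P1 X1] \<tau>P by (simp add: B0_def B1_def W0_def X0_def)
    let ?r = "\<lambda>t. restrict (conj_by t) W0"
    define H1 where "H1 = ?r ` NX"
    have rA: "?r t \<in> Aut W0" if "t \<in> NX" for t
      using norm_in_restrict_Aut[OF W0p(1,3) NXW0[OF that]] .
    have rm: "?r (g \<otimes> h) x = ?r g (?r h x)" if "g \<in> NX" "h \<in> NX" "x \<in> W0" for g h x
      using that NX(3) T_carrier W0p(3) norm_inD[OF NXW0[OF that(2)] that(3)]
      by (simp add: conj_by_comp subset_eq)
    have H1: "subgroup H1 (AutG W0)" "\<exists>n. card H1 = p ^ n"
      unfolding H1_def by (rule p_image_in_Aut[OF W0p(1,3) NX(1,3) rA rm], assumption+)+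
    have rB1: "?r t \<in> B1" if t: "t \<in> NX" for t
    proof -
      have "conj_by t ` X0 = X0" "conj_by t ` P = P" using t by (auto simp: NX_def N_def norm_in_def)
      moreover have "?r t ` X0 = conj_by t ` X0" "?r t ` P = conj_by t ` P"
        using W0p(4,5) by (auto intro!: image_cong)
      ultimately show ?thesis using rA[OF t] by (simp add: B1_def)
    qed
    have H1B1: "H1 \<subseteq> B1" using rB1 by (auto simp: H1_def)
    define c where "c = (\<lambda>f. restrict (\<tau> \<circ> (f \<circ> inv_into W' \<tau>)) W0)"
    have cval: "c f (\<tau> x) = \<tau> (f x)" if "f \<in> Aut W'" "x \<in> W'" for f x
      using transport_Aut(2)[OF M\<tau> that] by (simp add: c_def W0_def)
    have cAut: "c f \<in> Aut W0" if "f \<in> Aut W'" for f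
      using transport_Aut(1)[OF M\<tau> that] by (simp add: c_def W0_def)
    \<comment> \<open>The conjugate of \<open>h\<close> by \<open>a\<close> is conjugation by some
      \<open>s\<close>. As \<open>h\<close> stabilizes the images of \<open>P\<close> and
      \<open>X\<close>, this \<open>s\<close> normalizes \<open>P2\<close> and the corresponding
      image of \<open>X\<close>, and \<open>\<chi>\<close> carries it into
      \<open>NX\<close>.\<close>
    have cH: "\<exists>s \<in> norm_in T W'. \<exists>t \<in> NX. c h = ?r t \<and> (\<forall>x \<in> W'. conj_by t (\<chi> x) = \<chi> (conj_by s x))"
      if h: "h \<in> H0" for h
    proof -
      have hB: "h \<in> B0" and hA: "h \<in> Aut W'" using h H0s(2) B0A by auto
      obtain s where s: "s \<in> norm_in T W'" "\<And>x. x \<in> W' \<Longrightarrow> a (h x) = conj_by s (a x)"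
        using a(2)[OF h] by blast
      have sT: "s \<in> T" using s(1) by (simp add: norm_in_def)
      have sZ: "conj_by s ` a ` Z = a ` Z" if "h ` Z = Z" "Z \<subseteq> W'" for Z
      proof -
        have "conj_by s ` a ` Z = a ` h ` Z"
          unfolding image_image using s(2) that(2) by (intro image_cong) auto
        then show ?thesis using that by simp
      qed
      have sP: "s \<in> norm_in T P2"
        using sZ[of "\<omega> ` P"] hB P1 sT by (simp add: norm_in_def P2_def B0_def)
      have sX: "s \<in> norm_in T (a ` \<omega> ` X)"
        using sZ[of "\<omega> ` X"] hB X1 sT by (simp add: norm_in_def B0_def)
      have aX: "a ` \<omega> ` X \<subseteq> norm_in T P2" using X1 AutD(3)[OF a(1)] W'N by blast
      have P2N: "P2 \<subseteq> norm_in T P2" by (rule subgroup_in_norm_in[OF P2(1,2)])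
      have "\<chi> s \<in> norm_in T P" using M_norm[OF \<chi>(1) P2N sP sP] \<chi>(2) by simp
      moreover have "\<chi> s \<in> norm_in T X0" using M_norm[OF \<chi>(1) aX sP sX] X0\<chi> by simp
      ultimately have t: "\<chi> s \<in> NX" unfolding NX_def normNT by (simp add: N_def)
      have cnj: "conj_by (\<chi> s) (\<chi> x) = \<chi> (conj_by s x)" if "x \<in> W'" for x
        using M_conj_by[OF \<chi>(1) sP] W'N that by auto
      have "c h = ?r (\<chi> s)"
      proof (rule Aut_ext[OF cAut[OF hA] rA[OF t]])
        fix w assume w: "w \<in> W0"
        then obtain x where x: "x \<in> W'" "w = \<tau> x" by (auto simp: W0_def)
        have "c h w = \<chi> (conj_by s (a x))" using cval[OF hA x(1)] x s(2) by (simp add: \<tau>_def)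
        also have "\<dots> = conj_by (\<chi> s) w" using cnj[OF AutD(3)[OF a(1) x(1)]] x(2) by (simp add: \<tau>_def)
        finally show "c h w = ?r (\<chi> s) w" using w by simp
      qed
      then show ?thesis using s(1) t cnj by blast
    qed
    have cinj: "inj_on c H0"
    proof (rule inj_onI)
      fix f h assume fh: "f \<in> H0" "h \<in> H0" "c f = c h"
      then have A: "f \<in> Aut W'" "h \<in> Aut W'" using H0s(2) B0A by auto
      show "f = h"
      proof (rule Aut_ext[OF A])
        fix x assume x: "x \<in> W'"
        have "\<tau> (f x) = \<tau> (h x)" using cval[OF A(1) x] cval[OF A(2) x] fh(3) by simp
        then show "f x = h x"
          using M_inj[OF M\<tau>] AutD(3)[OF A(1) x] AutD(3)[OF A(2) x] by (simp add: inj_on_def)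
      qed
    qed
    have cHH: "c ` H0 \<subseteq> H1" using cH unfolding H1_def by blast
    have finH1: "finite H1" using finB1 H1B1 finite_subset by blast
    have H1sub: "subgroup H1 (AutG W0\<lparr>carrier := B1\<rparr>)" using AW0.subgroup_incl[OF H1(1) B1 H1B1] .
    \<comment> \<open>Orders decide: \<open>H1\<close> is a p-subgroup of \<open>B1\<close>
      containing an injective copy of \<open>H0\<close>, and that copy already has the Sylow order
      because \<open>B0\<close> and \<open>B1\<close> are equally large.\<close>
    have "card H1 \<le> p ^ multiplicity p (card B1)"
      using GB1.p_subgroup_card_le[OF prime_p _ H1sub] H1(2) finB1 by auto
    also have "\<dots> = card (c ` H0)" using cardB H0s(3) card_image[OF cinj] by simp
    finally have H1eq: "c ` H0 = H1" using cHH finH1 card_seteq by blast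
    then have "card H1 = p ^ multiplicity p (card B1)" using cardB H0s(3) card_image[OF cinj] by simp
    then have H1syl: "sylow_subgroup p H1 (AutG W0\<lparr>carrier := B1\<rparr>)"
      using H1sub by (simp add: sylow_subgroup_def)
    \<comment> \<open>Receptivity is available for \<open>W'\<close>, not for \<open>W0\<close>.
      Since \<open>H1\<close> is exactly the transport of \<open>H0\<close>, each conjugation by
      \<open>NX\<close> on \<open>W0\<close> comes through \<open>\<chi>\<close> from a conjugation
      on \<open>W'\<close>; this lets the receptivity of \<open>W'\<close> be used for
      \<open>X0\<close>.\<close>
    have pullback: "\<exists>s \<in> norm_in T W'. \<forall>x \<in> W'. conj_by t (\<chi> x) = \<chi> (conj_by s x)" if t: "t \<in> NX" for t
    proof -
      obtain h where h: "h \<in> H0" "?r t = c h" using t H1eq by (auto simp: H1_def)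
      obtain s t' where s: "s \<in> norm_in T W'" "?r t = ?r t'"
        "\<forall>x \<in> W'. conj_by t' (\<chi> x) = \<chi> (conj_by s x)" using cH[OF h(1)] h(2) by auto
      have "conj_by t (\<chi> x) = conj_by t' (\<chi> x)" if "x \<in> W'" for x
        using fun_cong[OF s(2), of "\<chi> x"] that by (simp add: W0\<chi>)
      then show ?thesis using s by auto
    qed
    have autX0: "E.fully_aut X0"
    proof -
      \<comment> \<open>Restriction to \<open>X0\<close> maps \<open>B1\<close> onto
        \<open>E.Aut X0\<close> and \<open>H1\<close> onto \<open>E.Aut_inner X0\<close>, and
        surjections preserve Sylow subgroups.\<close>
      let ?f = "\<lambda>f. restrict f X0"
      have fin: "?f f \<in> E.Aut X0" if f: "f \<in> B1" for f
      proof (rule E.Aut_restrict)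
        have "M W0 f" "f ` P = P" "f ` X0 = X0" using f AutD(1) by (auto simp: B1_def)
        then show "nfus P X0 f" "f ` X0 = X0"
          using nfusI[OF P X0(1) X0N _ W0p(4,5)] by auto
      qed
      have surj: "?f ` B1 = E.Aut X0"
      proof
        show "?f ` B1 \<subseteq> E.Aut X0" using fin by blast
        show "E.Aut X0 \<subseteq> ?f ` B1"
        proof
          fix g assume g: "g \<in> E.Aut X0"
          then obtain h where h: "M W0 h" "\<forall>x \<in> X0. h x = g x" "h ` P = P"
            using E.AutD(1)[OF g] by (auto simp: nfus_def W0eq)
          have hX: "h ` X0 = X0" using h(2) E.AutD(2)[OF g] by (metis image_cong)
          have "h ` W0 = W0"
            using M_set_mult_img[OF h(1)[unfolded W0eq] X0(1) P(1)] hX h(3) by (simp add: W0eq)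
          then have "restrict h W0 \<in> Aut W0" by (rule Aut_restrict[OF h(1)])
          moreover have "restrict h W0 ` Z = h ` Z" if "Z \<subseteq> W0" for Z
            using that by (intro image_cong) auto
          then have "restrict h W0 ` P = P" "restrict h W0 ` X0 = X0"
            using h(3) hX W0p(4,5) by simp_all
          ultimately have B: "restrict h W0 \<in> B1" by (simp add: B1_def)
          have "g = ?f (restrict h W0)"
            using h(2) W0p(4) by (intro E.Aut_ext[OF g fin[OF B]]) auto
          then show "g \<in> ?f ` B1" using B by blast
        qed
      qed
      have "?f \<in> hom (AutG W0\<lparr>carrier := B1\<rparr>) (E.AutG X0)"
      proof (rule homI)
        fix f g assume "f \<in> carrier (AutG W0\<lparr>carrier := B1\<rparr>)" "g \<in> carrier (AutG W0\<lparr>carrier := B1\<rparr>)"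
        then have fg: "f \<in> B1" "g \<in> B1" by simp_all
        show "?f f \<in> carrier (E.AutG X0)" using fin[OF fg(1)] by simp
        have A: "f \<in> Aut W0" "g \<in> Aut W0" using fg B1A by auto
        have m: "f \<otimes>\<^bsub>AutG W0\<^esub> g \<in> B1" using subgroup.m_closed[OF B1 fg] .
        have "?f (f \<otimes>\<^bsub>AutG W0\<^esub> g) = ?f f \<otimes>\<^bsub>E.AutG X0\<^esub> ?f g"
        proof (rule E.Aut_ext[OF fin[OF m] E.AutG_m_closed[OF X0 fin[OF fg(1)] fin[OF fg(2)]]])
          fix x assume x: "x \<in> X0"
          have "g x \<in> X0" using fg(2) x by (auto simp: B1_def)
          then show "?f (f \<otimes>\<^bsub>AutG W0\<^esub> g) x = (?f f \<otimes>\<^bsub>E.AutG X0\<^esub> ?f g) x"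
            using x W0p(4) AutG_mult[OF A] E.AutG_mult[OF fin[OF fg(1)] fin[OF fg(2)] x] by auto
        qed
        then show "?f (f \<otimes>\<^bsub>AutG W0\<lparr>carrier := B1\<rparr>\<^esub> g) = ?f f \<otimes>\<^bsub>E.AutG X0\<^esub> ?f g" by simp
      qed
      then interpret gh: group_hom "AutG W0\<lparr>carrier := B1\<rparr>" "E.AutG X0" ?f
        using GB1.is_group E.AutG_group[OF X0] by (simp add: group_hom_def group_hom_axioms_def)
      have "sylow_subgroup p (?f ` H1) (E.AutG X0)"
        using gh.sylow_image[OF prime_p _ _ H1syl] finB1 surj by simp
      moreover have "?f ` H1 = E.Aut_inner X0"
      proof -
        have "?f (?r t) = restrict (conj_by t) X0" for t using W0p(4) by (auto simp: fun_eq_iff)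
        then show ?thesis unfolding H1_def E.Aut_inner_def NX_def by (auto simp: image_image)
      qed
      ultimately show ?thesis by (simp add: E.fully_aut_def)
    qed
    moreover have "E.recept X0"
      unfolding E.recept_def
    proof (intro allI impI)
      fix Y \<theta> assume "nfus P Y \<theta> \<and> \<theta> ` Y = X0"
      then have n\<theta>: "nfus P Y \<theta>" and \<theta>Y: "\<theta> ` Y = X0" by auto
      obtain \<theta>1 where \<theta>1: "M (Y <#> P) \<theta>1" "\<And>y. y \<in> Y \<Longrightarrow> \<theta>1 y = \<theta> y" "\<theta>1 ` P = P"
        and Y: "subgroup Y G" "Y \<subseteq> norm_in T P" using n\<theta> by (auto simp: nfus_def)
      define V where "V = Y <#> P"
      note Vp = norm_prod[OF P Y, folded V_def]
      have M\<theta>1: "M V \<theta>1" using \<theta>1(1) by (simp add: V_def)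
      have \<theta>1Y: "\<theta>1 ` Y = X0" using \<theta>1(2) \<theta>Y by (metis image_cong)
      have \<theta>1V: "\<theta>1 ` V = W0"
        using M_set_mult_img[OF \<theta>1(1) Y(1) P(1)] \<theta>1(3) \<theta>1Y by (simp add: V_def W0eq)
      define D where "D = E.N_of Y \<theta>"
      have D: "subgroup D G" unfolding D_def by (rule E.N_of_subgroup[OF n\<theta>])
      have DN: "D \<subseteq> N" unfolding D_def using E.N_of_subset norm_in_subset by blast
      have DN': "D \<subseteq> norm_in T P" using DN by (simp add: N_def)
      have DY: "g \<in> norm_in N Y" if "g \<in> D" for g using that E.N_of_subset by (auto simp: D_def)
      have DV: "D \<subseteq> norm_in T V"
      proof
        fix g assume g: "g \<in> D"
        show "g \<in> norm_in T V"
        proof (rule norm_inI[OF sub_finite[OF Vp(3)]])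
          show "V \<subseteq> carrier G" "T \<subseteq> carrier G" "g \<in> T"
            using Vp(3) T_carrier g DN NT by blast+
          fix x assume "x \<in> V"
          then obtain y z where x: "y \<in> Y" "z \<in> P" "x = y \<otimes> z"
            by (auto simp: V_def set_mult_def)
          have gP: "g \<in> norm_in T P" using g DN' by blast
          have "conj_by g x = conj_by g y \<otimes> conj_by g z"
            using x subgroup.mem_carrier[OF D g] subgroup.mem_carrier[OF Y(1)]
              subgroup.mem_carrier[OF P(1)] by (simp add: conj_by_mult)
          then show "conj_by g x \<in> V"
            using norm_inD[OF DY[OF g] x(1)] norm_inD[OF gP x(2)] by (simp add: V_def set_mult_memI)
        qed
      qed
      define q where "q = (\<lambda>g. restrict (\<theta>1 \<circ> (restrict (conj_by g) V \<circ> inv_into V \<theta>1)) W0)"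
      define J where "J = q ` D"
      note tr = transport_conj_group[OF M\<theta>1 D DV]
      have J: "subgroup J (AutG W0)" "\<exists>n. card J = p ^ n"
        unfolding J_def q_def \<theta>1V[symmetric] by (rule tr(1), rule tr(2))
      have qval: "q g (\<theta>1 v) = \<theta>1 (conj_by g v)" if "g \<in> D" "v \<in> V" for g v
        unfolding q_def \<theta>1V[symmetric] by (rule tr(3)[OF that])
      have qA: "q g \<in> Aut W0" if "g \<in> D" for g
        unfolding q_def \<theta>1V[symmetric] by (rule tr(4)[OF that])
      have qimg: "q g ` Z' = Z'" if g: "g \<in> D" and Z: "Z \<subseteq> V" "conj_by g ` Z = Z" "\<theta>1 ` Z = Z'" for g Z Z'
      proof -
        have "q g ` Z' = \<theta>1 ` conj_by g ` Z"
          unfolding Z(3)[symmetric] image_image using qval[OF g] Z(1) by (intro image_cong) auto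
        then show ?thesis using Z by simp
      qed
      have qB1: "q g \<in> B1" if g: "g \<in> D" for g
      proof -
        have "conj_by g ` P = P" "conj_by g ` Y = Y" using DN' DY[OF g] g by (auto simp: norm_in_def)
        then show ?thesis
          using qA[OF g] qimg[OF g Vp(5) _ \<theta>1(3)] qimg[OF g Vp(4) _ \<theta>1Y] by (simp add: B1_def)
      qed
      \<comment> \<open>The transported action of \<open>D\<close> agrees on \<open>X0\<close> with
        conjugations by \<open>NX\<close>, but perhaps not on \<open>W0\<close>. Inside
        \<open>L\<close>, which contains both \<open>J\<close> and the Sylow subgroup
        \<open>H1\<close>, it can be conjugated into \<open>H1\<close> by an element that itself
        acts on \<open>X0\<close> as a conjugation by \<open>NX\<close>.\<close>
      define L where "L = {f \<in> B1. \<exists>t \<in> NX. \<forall>x \<in> X0. f x = conj_by t x}"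
      have X0car: "x \<in> carrier G" if "x \<in> X0" for x using subgroup.mem_carrier[OF X0(1) that] .
      have NXcar: "t \<in> carrier G" if "t \<in> NX" for t using subgroup.mem_carrier[OF NX(1) that] .
      have NXX0: "conj_by t x \<in> X0" if "t \<in> NX" "x \<in> X0" for t x
        using norm_inD[of t N X0 x] that by (simp add: NX_def)
      have L: "subgroup L (AutG W0)"
      proof (rule AutG_subgroupI[OF W0p(1,3)])
        show "L \<subseteq> Aut W0" using B1A by (auto simp: L_def)
        have "restrict (\<lambda>x. x) W0 = \<one>\<^bsub>AutG W0\<^esub>" by (simp add: AutG_def BijGroup_def)
        then have "restrict (\<lambda>x. x) W0 \<in> B1" using subgroup.one_closed[OF B1] by simp
        moreover have "\<forall>x \<in> X0. restrict (\<lambda>x. x) W0 x = conj_by \<one> x" using W0p(4) X0car by auto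
        ultimately show "restrict (\<lambda>x. x) W0 \<in> L"
          using subgroup.one_closed[OF NX(1)] by (auto simp: L_def)
      next
        fix f assume "f \<in> L"
        then obtain t where f: "f \<in> B1" "t \<in> NX" "\<And>x. x \<in> X0 \<Longrightarrow> f x = conj_by t x" by (auto simp: L_def)
        have fA: "f \<in> Aut W0" using f(1) B1A by blast
        have ti: "inv t \<in> NX" using subgroup.m_inv_closed[OF NX(1) f(2)] .
        have "(inv\<^bsub>AutG W0\<^esub> f) x = conj_by (inv t) x" if x: "x \<in> X0" for x
        proof -
          have y: "conj_by (inv t) x \<in> X0" using NXX0[OF ti x] .
          have "f (conj_by (inv t) x) = x" using f(3)[OF y] NXcar[OF f(2)] X0car[OF x] by simp
          then show ?thesis using AutG_inv(2)[OF W0p(1,3) fA, of "conj_by (inv t) x"] y W0p(4) by auto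
        qed
        then show "inv\<^bsub>AutG W0\<^esub> f \<in> L"
          using subgroup.m_inv_closed[OF B1 f(1)] ti by (auto simp: L_def)
      next
        fix f h assume "f \<in> L" "h \<in> L"
        then obtain t u where fh: "f \<in> B1" "t \<in> NX" "\<And>x. x \<in> X0 \<Longrightarrow> f x = conj_by t x"
          "h \<in> B1" "u \<in> NX" "\<And>x. x \<in> X0 \<Longrightarrow> h x = conj_by u x" by (auto simp: L_def)
        have A: "f \<in> Aut W0" "h \<in> Aut W0" using fh B1A by auto
        have "(f \<otimes>\<^bsub>AutG W0\<^esub> h) x = conj_by (t \<otimes> u) x" if x: "x \<in> X0" for x
          using AutG_mult[OF A, of x] x W0p(4) fh NXX0[OF fh(5) x] NXcar X0car
          by (auto simp: conj_by_comp)
        then show "f \<otimes>\<^bsub>AutG W0\<^esub> h \<in> L"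
          using subgroup.m_closed[OF B1 fh(1,4)] subgroup.m_closed[OF NX(1) fh(2,5)] by (auto simp: L_def)
      qed
      have LB1: "L \<subseteq> B1" by (auto simp: L_def)
      have "?r t x = conj_by t x" if "x \<in> X0" for t x using W0p(4) that by auto
      then have H1L: "H1 \<subseteq> L" unfolding H1_def L_def using rB1 by blast
      have JL: "J \<subseteq> L"
      proof
        fix j assume "j \<in> J"
        then obtain g where g: "g \<in> D" "j = q g" by (auto simp: J_def)
        then obtain t where t: "t \<in> norm_in N X0" "\<And>y. y \<in> Y \<Longrightarrow> \<theta> (conj_by g y) = conj_by t (\<theta> y)"
          by (auto simp: D_def E.N_of_def \<theta>Y)
        have "q g x = conj_by t x" if x: "x \<in> X0" for x
        proof -
          obtain y where y: "y \<in> Y" "x = \<theta> y" using x \<theta>Y by blast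
          have "conj_by g y \<in> Y" using norm_inD[OF DY[OF g(1)] y(1)] .
          then show ?thesis using qval[OF g(1), of y] y Vp(4) \<theta>1(2) t(2) by auto
        qed
        then show "j \<in> L" using g qB1[OF g(1)] t(1) by (auto simp: L_def NX_def)
      qed
      have finL: "finite L" using LB1 finB1 finite_subset by blast
      have "sylow_subgroup p H1 (AutG W0\<lparr>carrier := L\<rparr>)"
        using GB1.sylow_in_subgroup[OF prime_p _ H1syl, of L] AW0.subgroup_incl[OF L B1 LB1] finB1 H1L
        by simp
      note syl = group.sylow_conjugate[OF AW0.subgroup_imp_group[OF L] prime_p _ this
          AW0.subgroup_incl[OF J(1) L JL]]
      obtain n where "card J = p ^ n" using J(2) by blast
      then have "\<exists>l \<in> L. \<forall>j \<in> J. l \<otimes>\<^bsub>AutG W0\<^esub> j \<otimes>\<^bsub>AutG W0\<^esub> inv\<^bsub>AutG W0\<^esub> l \<in> H1"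
        using syl[of n] finL AW0.m_inv_consistent[OF L] by simp
      then obtain l where l: "l \<in> L"
        "\<And>j. j \<in> J \<Longrightarrow> l \<otimes>\<^bsub>AutG W0\<^esub> j \<otimes>\<^bsub>AutG W0\<^esub> inv\<^bsub>AutG W0\<^esub> l \<in> H1"
        by blast
      have lA: "l \<in> Aut W0" using l(1) LB1 B1A by blast
      have lP: "l ` P = P" using l(1) LB1 by (auto simp: B1_def)
      obtain t where t: "t \<in> NX" "\<And>x. x \<in> X0 \<Longrightarrow> l x = conj_by t x" using l(1) by (auto simp: L_def)
      have ti: "inv t \<in> NX" using subgroup.m_inv_closed[OF NX(1) t(1)] .
      \<comment> \<open>On \<open>X0\<close> the correction \<open>l\<close> is conjugation by
        \<open>t\<close>. Cancelling this conjugation makes \<open>\<eta>\<close> agree with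
        \<open>\<theta>\<close> on \<open>Y\<close> again, and it keeps the transported action of
        \<open>D\<close> among the conjugations by \<open>NX\<close>.\<close>
      define \<eta> where "\<eta> = (conj_by (inv t) \<circ> l) \<circ> \<theta>1"
      have Mc: "M W0 (conj_by (inv t))" using M_conj[OF W0p(1,3)] ti NX(3) by blast
      have Mcl: "M W0 (conj_by (inv t) \<circ> l)" using M_comp[OF AutD(1)[OF lA] Mc] AutD(2)[OF lA] by simp
      have M\<eta>: "M V \<eta>" unfolding \<eta>_def using M_comp[OF M\<theta>1 Mcl] \<theta>1V by simp
      have clW: "(conj_by (inv t) \<circ> l) ` W0 = W0"
        using AutD(2)[OF lA] NXW0[OF ti] by (simp only: image_comp[symmetric] norm_in_def mem_Collect_eq)
      have \<eta>V: "\<eta> ` V = W0" unfolding \<eta>_def using \<theta>1V clW by (simp only: image_comp[symmetric])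
      have "conj_by (inv t) ` P = P" using ti NX(2) by (auto simp: N_def norm_in_def)
      then have \<eta>P: "\<eta> ` P = P" unfolding \<eta>_def using \<theta>1(3) lP by (simp only: image_comp[symmetric])
      have \<eta>Y: "\<eta> y = \<theta> y" if y: "y \<in> Y" for y
      proof -
        have "\<theta> y \<in> X0" using y \<theta>Y by blast
        then show ?thesis
          using \<theta>1(2)[OF y] t NXcar[OF t(1)] X0car by (simp add: \<eta>_def)
      qed
      have \<eta>conj: "\<exists>u \<in> NX. \<forall>v \<in> V. \<eta> (conj_by g v) = conj_by u (\<eta> v)" if g: "g \<in> D" for g
      proof -
        have "q g \<in> J" using g by (simp add: J_def)
        then obtain s where s: "s \<in> NX"
          "l \<otimes>\<^bsub>AutG W0\<^esub> q g \<otimes>\<^bsub>AutG W0\<^esub> inv\<^bsub>AutG W0\<^esub> l = ?r s" using l(2) by (auto simp: H1_def)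
        have lq: "l (q g w) = conj_by s (l w)" if w: "w \<in> W0" for w
        proof -
          have "(l \<otimes>\<^bsub>AutG W0\<^esub> q g \<otimes>\<^bsub>AutG W0\<^esub> inv\<^bsub>AutG W0\<^esub> l) (l w) = l (q g w)"
            using AutG_mult[OF AutG_m_closed[OF W0p(1,3) lA qA[OF g]] AutG_inv_closed[OF W0p(1,3) lA] AutD(3)[OF lA w]]
              AutG_inv(2)[OF W0p(1,3) lA w] AutG_mult[OF lA qA[OF g] w] by simp
          then show ?thesis using s(2) AutD(3)[OF lA w] by simp
        qed
        have "\<eta> (conj_by g v) = conj_by (inv t \<otimes> s \<otimes> t) (\<eta> v)" if v: "v \<in> V" for v
        proof -
          have w: "\<theta>1 v \<in> W0" using v \<theta>1V by blast
          have lw: "l (\<theta>1 v) \<in> carrier G"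
            using AutD(3)[OF lA w] W0p(1) subgroup.mem_carrier by metis
          have "\<eta> (conj_by g v) = conj_by (inv t) (conj_by s (l (\<theta>1 v)))"
            using qval[OF g v] lq[OF w] by (simp add: \<eta>_def)
          also have "\<dots> = conj_by (inv t \<otimes> s \<otimes> t) (\<eta> v)"
            using NXcar[OF t(1)] NXcar[OF s(1)] lw by (simp add: conj_by_comp \<eta>_def)
          finally show ?thesis .
        qed
        moreover have "inv t \<otimes> s \<otimes> t \<in> NX"
          using subgroup.m_closed[OF NX(1)] ti s(1) t(1) by blast
        ultimately show ?thesis by blast
      qed
      let ?\<chi>' = "inv_into W' \<chi>"
      \<comment> \<open>The target is moved back to \<open>W'\<close>, which is receptive; by
        \<open>pullback\<close>, \<open>D\<close> lies in \<open>N_of V \<mu>\<close>. The extension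
        obtained there is brought forward again with \<open>\<chi>\<close>.\<close>
      define \<mu> where "\<mu> = ?\<chi>' \<circ> \<eta>"
      have M\<mu>: "M V \<mu>" unfolding \<mu>_def using M_comp[OF M\<eta> M_inv[OF M\<chi>]] \<eta>V W0\<chi> by simp
      have \<mu>V: "\<mu> ` V = W'"
        unfolding \<mu>_def using \<eta>V W0\<chi> M_inv_img[OF M\<chi>] by (simp only: image_comp[symmetric])
      have "?\<chi>' ` \<chi> ` P2 = P2" by (rule M_inv_cancel[OF M\<chi> P2(3)])
      then have \<mu>P: "\<mu> ` P = P2"
        unfolding \<mu>_def using \<eta>P \<chi>(2) by (simp only: image_comp[symmetric])
      have \<chi>\<mu>: "\<chi> (\<mu> v) = \<eta> v" if "v \<in> V" for v
        using that \<eta>V W0\<chi> by (auto simp: \<mu>_def intro!: f_inv_into_f)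
      have DN\<mu>: "D \<subseteq> N_of V \<mu>"
      proof
        fix g assume g: "g \<in> D"
        obtain u where u: "u \<in> NX" "\<And>v. v \<in> V \<Longrightarrow> \<eta> (conj_by g v) = conj_by u (\<eta> v)"
          using \<eta>conj[OF g] by blast
        obtain s where s: "s \<in> norm_in T W'" "\<And>x. x \<in> W' \<Longrightarrow> conj_by u (\<chi> x) = \<chi> (conj_by s x)"
          using pullback[OF u(1)] by blast
        have "\<mu> (conj_by g v) = conj_by s (\<mu> v)" if v: "v \<in> V" for v
        proof -
          have gv: "conj_by g v \<in> V" using DV g v norm_inD by blast
          have \<mu>v: "\<mu> v \<in> W'" "\<mu> (conj_by g v) \<in> W'" using \<mu>V v gv by blast+
          have "\<chi> (\<mu> (conj_by g v)) = \<chi> (conj_by s (\<mu> v))"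
            using \<chi>\<mu>[OF gv] \<chi>\<mu>[OF v] u(2)[OF v] s(2)[OF \<mu>v(1)] by simp
          then show ?thesis
            using M_inj[OF M\<chi>] \<mu>v norm_inD[OF s(1) \<mu>v(1)] by (simp add: inj_on_def)
        qed
        then show "g \<in> N_of V \<mu>" using DV g s(1) \<mu>V unfolding N_of_def by blast
      qed
      obtain h where h: "M (N_of V \<mu>) h" "\<And>v. v \<in> V \<Longrightarrow> h v = \<mu> v"
        using \<omega>(3)[folded W'_def] M\<mu> \<mu>V unfolding recept_def by blast
      note Dp = norm_prod[OF P D DN']
      have DPsub: "D <#> P \<subseteq> N_of V \<mu>"
        using set_mult_least[OF N_of_subgroup[OF M\<mu>] DN\<mu>] N_of_contains[OF M\<mu>] Vp(5) by blast
      have MDh: "M (D <#> P) h" using M_res[OF h(1) Dp(1) DPsub] by simp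
      have hP: "h ` P = P2" using h(2) Vp(5) \<mu>P by (metis (no_types, lifting) image_cong subsetD)
      have "h ` (D <#> P) \<subseteq> norm_in T P2"
        using M_norm[OF MDh Dp(5)] Dp(2) hP by auto
      then have M\<chi>h: "M (D <#> P) (\<chi> \<circ> h)" using M_comp[OF MDh \<chi>(1)] by blast
      have "(\<chi> \<circ> h) ` P = P" using hP \<chi>(2) by (simp only: image_comp[symmetric])
      then have "nfus P D (\<chi> \<circ> h)" using nfusI[OF P D DN' M\<chi>h Dp(4,5)] by simp
      moreover have "(\<chi> \<circ> h) y = \<theta> y" if y: "y \<in> Y" for y
        using h(2) \<chi>\<mu> \<eta>Y[OF y] Vp(4) y by auto
      ultimately show "\<exists>h. nfus P (E.N_of Y \<theta>) h \<and> (\<forall>y \<in> Y. h y = \<theta> y)"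
        unfolding D_def by blast
    qed
    ultimately show ?thesis using n\<phi> \<phi>X by blast
  qed
  then have "E.saturated_M" unfolding E.saturated_M_def by blast
  then show ?thesis by (simp add: N_def)
qed

end

section \<open>Normal subgroups of fusion systems\<close>

context group
begin

text \<open>\<open>H\<close> is an arbitrary predicate, so that the notion applies to the
  centralizer system \<open>cfus\<close> as well as to instances of the locale \<open>fus\<close>.
  The condition on \<open>norm_in\<close> says that \<open>R\<close> is a normal subgroup of
  \<open>D\<close>.\<close>

definition normal_in :: "'a set \<Rightarrow> ('a set \<Rightarrow> ('a \<Rightarrow> 'a) \<Rightarrow> bool) \<Rightarrow> 'a set \<Rightarrow> bool" where
  "normal_in D H R \<longleftrightarrow> subgroup R G \<and> R \<subseteq> D \<and> norm_in D R = D \<and>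
     (\<forall>X f. H X f \<longrightarrow> (\<exists>h. H (X <#> R) h \<and> (\<forall>x \<in> X. h x = f x) \<and> h ` R = R))"

lemma normal_in_subgroup: "normal_in D H R \<Longrightarrow> subgroup R G"
  and normal_in_subset: "normal_in D H R \<Longrightarrow> R \<subseteq> D"
  and normal_in_norm: "normal_in D H R \<Longrightarrow> norm_in D R = D"
  by (simp_all add: normal_in_def)

lemma normal_in_conj: "normal_in D H R \<Longrightarrow> d \<in> D \<Longrightarrow> r \<in> R \<Longrightarrow> conj_by d r \<in> R"
  using norm_inD normal_in_norm by metis

lemma normal_in_extend:
  assumes "normal_in D H R" "H X f"
  obtains h where "H (X <#> R) h" "\<And>x. x \<in> X \<Longrightarrow> h x = f x" "h ` R = R"
  using assms unfolding normal_in_def by meson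

lemma normal_in_stable:
  assumes "normal_in D H R" "H X f" "R \<subseteq> X" "subgroup X G"
  shows "f ` R = R"
proof -
  obtain h where h: "H (X <#> R) h" "\<And>x. x \<in> X \<Longrightarrow> h x = f x" "h ` R = R"
    using normal_in_extend[OF assms(1,2)] by metis
  then show ?thesis using assms(3) by (metis (no_types, lifting) image_cong subsetD)
qed

lemma normal_in_one:
  assumes "subgroup D G" and H: "\<And>X f. H X f \<Longrightarrow> subgroup X G \<and> f \<one> = \<one>"
  shows "normal_in D H {\<one>}"
proof -
  have D: "D \<subseteq> carrier G" using assms(1) subgroup.subset by metis
  have "\<one> \<in> D" using assms(1) subgroup.one_closed by metis
  moreover have "norm_in D {\<one>} = D" using D by (auto simp: norm_in_def conj_by_def)
  moreover have "X <#> {\<one>} = X" if "subgroup X G" for X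
    using set_mult_absorb[OF that triv_subgroup] subgroup.one_closed[OF that] by simp
  ultimately show ?thesis using H triv_subgroup unfolding normal_in_def by (metis empty_subsetI image_empty image_insert insert_subset)
qed

text \<open>A morphism is extended over \<open>A\<close> and the result over \<open>B\<close>. The
  second extension agrees with the first on the product of \<open>X\<close> and \<open>A\<close>, so
  it still maps \<open>A\<close> to itself.\<close>

lemma normal_in_prod:
  assumes D: "subgroup D G"
    and H: "\<And>X f x y. H X f \<Longrightarrow> x \<in> X \<Longrightarrow> y \<in> X \<Longrightarrow> f (x \<otimes> y) = f x \<otimes> f y"
    and HX: "\<And>X f. H X f \<Longrightarrow> subgroup X G \<and> X \<subseteq> D"
    and A: "normal_in D H A" and B: "normal_in D H B"
  shows "normal_in D H (A <#> B)"
proof -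
  note As = normal_in_subgroup[OF A] and Bs = normal_in_subgroup[OF B]
  note AD = normal_in_subset[OF A] and BD = normal_in_subset[OF B]
  have AB: "subgroup (A <#> B) G" using set_mult_subgroup[OF As Bs, of D] normal_in_norm[OF B] AD by simp
  have ABD: "A <#> B \<subseteq> D" using set_mult_least[OF D AD BD] .
  have DG: "d \<in> carrier G" if "d \<in> D" for d using subgroup.mem_carrier[OF D that] .
  have nrm: "conj_by d ` (A <#> B) = A <#> B" if d: "d \<in> D" for d
  proof -
    have "conj_by d ` (A <#> B) = conj_by d ` A <#> conj_by d ` B"
    proof -
      have "conj_by d (x \<otimes> y) = conj_by d x \<otimes> conj_by d y" if "x \<in> A" "y \<in> B" for x y
        using that AD BD DG d by (intro conj_by_mult) auto
      then show ?thesis by (force simp: set_mult_def)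
    qed
    also have "\<dots> = A <#> B"
    proof -
      have "d \<in> norm_in D A" "d \<in> norm_in D B" using d normal_in_norm[OF A] normal_in_norm[OF B] by auto
      then show ?thesis by (simp add: norm_in_def)
    qed
    finally show ?thesis .
  qed
  then have "norm_in D (A <#> B) = D" by (auto simp: norm_in_def)
  moreover have "\<exists>h. H (X <#> (A <#> B)) h \<and> (\<forall>x \<in> X. h x = f x) \<and> h ` (A <#> B) = A <#> B"
    if Xf: "H X f" for X f
  proof -
    have X: "subgroup X G" "X \<subseteq> D" using HX[OF Xf] by auto
    obtain h1 where h1: "H (X <#> A) h1" "\<And>x. x \<in> X \<Longrightarrow> h1 x = f x" "h1 ` A = A"
      using normal_in_extend[OF A Xf] by metis
    obtain h2 where h2: "H (X <#> A <#> B) h2" "\<And>x. x \<in> X <#> A \<Longrightarrow> h2 x = h1 x" "h2 ` B = B"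
      using normal_in_extend[OF B h1(1)] by metis
    have XA: "subgroup (X <#> A) G" using HX[OF h1(1)] by simp
    have inX: "X \<subseteq> X <#> A" "A \<subseteq> X <#> A" "X <#> A \<subseteq> X <#> A <#> B" "B \<subseteq> X <#> A <#> B"
      using set_mult_left set_mult_right X(1) As XA Bs by blast+
    have "h2 ` A = A" using h2(2) h1(3) inX(2) by (metis (no_types, lifting) image_cong subsetD)
    moreover have "h2 (x \<otimes> y) = h2 x \<otimes> h2 y" if "x \<in> A" "y \<in> B" for x y
      using that inX by (intro H[OF h2(1)]) blast+
    then have "h2 ` (A <#> B) = h2 ` A <#> h2 ` B" by (force simp: set_mult_def)
    moreover have "X <#> (A <#> B) = X <#> A <#> B"
      using X AD BD DG by (intro set_mult_assoc[symmetric]) auto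
    ultimately show ?thesis using h2 h1(2) inX(1) by (intro exI[of _ h2]) auto
  qed
  ultimately show ?thesis using AB ABD by (simp add: normal_in_def)
qed

text \<open>A normal subgroup of greatest order absorbs every other one, because their product is
  again normal.\<close>

lemma normal_in_greatest:
  assumes D: "subgroup D G" "finite D"
    and H: "\<And>X f x y. H X f \<Longrightarrow> x \<in> X \<Longrightarrow> y \<in> X \<Longrightarrow> f (x \<otimes> y) = f x \<otimes> f y"
    and HX: "\<And>X f. H X f \<Longrightarrow> subgroup X G \<and> X \<subseteq> D"
    and H1: "\<And>X f. H X f \<Longrightarrow> f \<one> = \<one>"
  shows "\<exists>W. normal_in D H W \<and> (\<forall>R. normal_in D H R \<longrightarrow> R \<subseteq> W)"
proof -
  have "normal_in D H {\<one>}" using normal_in_one[OF D(1)] HX H1 by blast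
  moreover have "\<forall>R. normal_in D H R \<longrightarrow> card R < Suc (card D)"
    using card_mono[OF D(2) normal_in_subset] by (simp add: less_Suc_eq_le)
  ultimately have "\<exists>W. normal_in D H W \<and> (\<forall>R. normal_in D H R \<longrightarrow> card R \<le> card W)"
    by (rule ex_has_greatest_nat)
  then obtain W where W: "normal_in D H W" "\<And>R. normal_in D H R \<Longrightarrow> card R \<le> card W" by blast
  have "R \<subseteq> W" if R: "normal_in D H R" for R
  proof -
    have WR: "normal_in D H (W <#> R)" by (rule normal_in_prod[OF D(1) H HX W(1) R])
    have sub: "W \<subseteq> W <#> R" "R \<subseteq> W <#> R"
      using set_mult_left set_mult_right normal_in_subgroup[OF W(1)] normal_in_subgroup[OF R] by blast+
    have "finite (W <#> R)" using normal_in_subset[OF WR] D(2) finite_subset by blast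
    then have "W = W <#> R" using card_seteq sub(1) W(2)[OF WR] by blast
    then show ?thesis using sub(2) by simp
  qed
  then show ?thesis using W(1) by blast
qed

end

section \<open>Automorphisms of p-power order and a criterion for normality\<close>

context fus
begin

lemma M_pow: "M X f \<Longrightarrow> c \<in> X \<Longrightarrow> f (c [^] (n::nat)) = f c [^] n"
proof (induction n)
  case (Suc n)
  have "c [^] n \<in> X"
    using M_sub[OF Suc.prems(1)] Suc.prems(2) by (metis subgroup_int_pow_closed int_pow_int)
  then show ?case using Suc M_mult[OF Suc.prems(1)] by simp
qed (simp add: M_one)

text \<open>If \<open>f\<close> multiplies \<open>x\<close> by a fixed point \<open>c\<close>, its
  iterates multiply \<open>x\<close> by powers of \<open>c\<close>, and a suitable p-power iterate
  fixes \<open>x\<close>. This is the source of all bounds on the order of an automorphism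
  below.\<close>

lemma M_shift:
  assumes f: "M X f" "f ` X \<subseteq> X" and x: "x \<in> X" "c \<in> X" "f x = x \<otimes> c" "f c = c"
  shows "(f ^^ n) x = x \<otimes> c [^] (n::nat)"
proof (induction n)
  case 0
  then show ?case using M_carrier[OF f(1) x(1)] by simp
next
  case (Suc n)
  have cn: "c [^] n \<in> X" using M_sub[OF f(1)] x(2) by (metis subgroup_int_pow_closed int_pow_int)
  have "(f ^^ Suc n) x = f x \<otimes> f c [^] n" using Suc M_mult[OF f(1) x(1) cn] M_pow[OF f(1) x(2)] by simp
  also have "\<dots> = x \<otimes> c [^] Suc n"
    using x M_carrier[OF f(1)] nat_pow_Suc2[of c n] by (simp add: m_assoc)
  finally show ?case .
qed

lemma T_exponent: "\<exists>m. \<forall>c \<in> T. c [^] (p ^ m :: nat) = \<one>"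
proof -
  obtain m where m: "card T = p ^ m" using T_card by blast
  interpret T: group "G\<lparr>carrier := T\<rparr>" by (rule subgroup_imp_group[OF T_sub])
  have "c [^] (p ^ m) = \<one>" if "c \<in> T" for c
    using T.pow_order_eq_1[of c] that m by (simp add: nat_pow_consistent[symmetric])
  then show ?thesis by blast
qed

lemma M_funpow: "M X f \<Longrightarrow> f ` X = X \<Longrightarrow> M X (f ^^ n) \<and> (f ^^ n) ` X = X"
proof (induction n)
  case 0
  then show ?case using M_id[OF M_sub[OF 0(1)] M_dom[OF 0(1)]] by (simp add: id_def)
next
  case (Suc n)
  then have IH: "M X (f ^^ n)" "(f ^^ n) ` X = X" by auto
  have "M X (f \<circ> f ^^ n)" using M_comp[OF IH(1) Suc.prems(1)] IH(2) by simp
  moreover have "(f \<circ> f ^^ n) ` X = X" using IH(2) Suc.prems(2) by (metis image_comp)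
  ultimately show ?case by (simp add: o_def)
qed

text \<open>A finite group whose elements all have p-power order is a p-group. The order of
  \<open>k\<close> is tested by iterating \<open>k\<close> on points of \<open>X\<close>.\<close>

lemma Aut_p_normal:
  assumes X: "subgroup X G" "X \<subseteq> T" and K: "K \<subseteq> Aut X" "restrict (\<lambda>x. x) X \<in> K"
    and i: "\<And>k. k \<in> K \<Longrightarrow> inv\<^bsub>AutG X\<^esub> k \<in> K"
    and m: "\<And>k l. k \<in> K \<Longrightarrow> l \<in> K \<Longrightarrow> k \<otimes>\<^bsub>AutG X\<^esub> l \<in> K"
    and c: "\<And>a k. a \<in> Aut X \<Longrightarrow> k \<in> K \<Longrightarrow> a \<otimes>\<^bsub>AutG X\<^esub> k \<otimes>\<^bsub>AutG X\<^esub> inv\<^bsub>AutG X\<^esub> a \<in> K"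
    and pe: "\<And>k. k \<in> K \<Longrightarrow> \<exists>n. \<forall>x \<in> X. (k ^^ (p ^ n)) x = x"
  shows "K \<lhd> AutG X \<and> (\<exists>n. card K = p ^ n)"
proof
  interpret A: group "AutG X" by (rule AutG_group[OF X])
  have Ks: "subgroup K (AutG X)" by (rule AutG_subgroupI[OF X K i m])
  show "K \<lhd> AutG X" using Ks c by (simp add: A.normal_inv_iff)
  interpret KG: group "AutG X\<lparr>carrier := K\<rparr>" by (rule A.subgroup_imp_group[OF Ks])
  have pow: "(k [^]\<^bsub>AutG X\<^esub> n) x = (k ^^ n) x" if k: "k \<in> Aut X" and "x \<in> X" for k x and n :: nat
    using that(2)
  proof (induction n arbitrary: x)
    case 0
    then show ?case by (simp add: AutG_one)
  next
    case (Suc n)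
    have "k [^]\<^bsub>AutG X\<^esub> n \<in> Aut X" using A.nat_pow_closed[of k n] k by simp
    then have "(k [^]\<^bsub>AutG X\<^esub> Suc n) x = (k [^]\<^bsub>AutG X\<^esub> n) (k x)"
      using AutG_mult[OF _ k Suc.prems] by simp
    then show ?case using Suc.IH[OF AutD(3)[OF k Suc.prems]] by (simp add: funpow_swap1)
  qed
  have "\<exists>n. order (AutG X\<lparr>carrier := K\<rparr>) = p ^ n"
  proof (rule KG.p_group_of_p_elements[OF prime_p])
    show "finite (carrier (AutG X\<lparr>carrier := K\<rparr>))" using Aut_finite[OF X(2)] K(1) finite_subset by auto
    fix k assume "k \<in> carrier (AutG X\<lparr>carrier := K\<rparr>)"
    then have k: "k \<in> K" "k \<in> Aut X" using K(1) by auto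
    obtain n where n: "\<forall>x \<in> X. (k ^^ (p ^ n)) x = x" using pe[OF k(1)] by blast
    have "k [^]\<^bsub>AutG X\<^esub> (p ^ n) = \<one>\<^bsub>AutG X\<^esub>"
    proof (rule Aut_ext)
      show "k [^]\<^bsub>AutG X\<^esub> (p ^ n) \<in> Aut X" "\<one>\<^bsub>AutG X\<^esub> \<in> Aut X"
        using A.nat_pow_closed[of k] A.one_closed k(2) by simp_all
    qed (use pow k(2) n AutG_one in auto)
    then show "\<exists>n. k [^]\<^bsub>AutG X\<lparr>carrier := K\<rparr>\<^esub> (p ^ n) = \<one>\<^bsub>AutG X\<lparr>carrier := K\<rparr>\<^esub>"
      by (auto simp: A.nat_pow_consistent[symmetric])
  qed
  then show "\<exists>n. card K = p ^ n" by simp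
qed

lemma Aut_conj_apply:
  assumes X: "subgroup X G" "X \<subseteq> T" and "a \<in> Aut X" "k \<in> Aut X" "x \<in> X"
  shows "(a \<otimes>\<^bsub>AutG X\<^esub> k \<otimes>\<^bsub>AutG X\<^esub> inv\<^bsub>AutG X\<^esub> a) x = a (k ((inv\<^bsub>AutG X\<^esub> a) x))"
  using assms AutG_mult AutG_m_closed[OF X] AutG_inv_closed[OF X] AutG_inv(1)[OF X] by simp

text \<open>Alperin induction over the groups containing \<open>W\<close>, where a morphism is good
  if it extends over \<open>B\<close> and fixes \<open>B\<close>. For an automorphism
  \<open>a\<close> of a fully automized and receptive \<open>X\<close> not containing
  \<open>B\<close>, the normal p-subgroup \<open>K\<close> forces the normalizer of \<open>X\<close>
  in \<open>B\<close> into \<open>N_of X a\<close>. So \<open>a\<close> extends to a strictly larger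
  group, where the induction hypothesis holds.\<close>

lemma normal_criterion:
  assumes sat: saturated_M and W: "normal_in T M W"
    and B: "subgroup B G" "B \<subseteq> T" "norm_in T B = T" and wc: "\<And>f. M B f \<Longrightarrow> f ` B = B"
    and K: "\<And>X. subgroup X G \<Longrightarrow> X \<subseteq> T \<Longrightarrow> W \<subseteq> X \<Longrightarrow>
      \<exists>K n. K \<lhd> AutG X \<and> card K = p ^ n \<and> (\<forall>b \<in> B. b \<in> norm_in T X \<longrightarrow> restrict (conj_by b) X \<in> K)"
  shows "normal_in T M B"
proof -
  define C where "C = {X. subgroup X G \<and> X \<subseteq> T \<and> W \<subseteq> X}"
  define Good where "Good = (\<lambda>X f. \<exists>h. M (X <#> B) h \<and> (\<forall>x \<in> X. h x = f x) \<and> h ` B = B)"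
  note Ws = normal_in_subgroup[OF W]
  have XB: "subgroup (X <#> B) G" "X \<subseteq> X <#> B" "B \<subseteq> X <#> B" if "subgroup X G" "X \<subseteq> T" for X
    using that set_mult_subgroup[OF that(1) B(1), of T] B(3) set_mult_left set_mult_right B(1) by auto
  have Good: "Good X f" if "X \<in> C" "M X f" for X f
  proof (rule alperin_induct[OF sat _ _ _ _ _ that])
    fix X Y f h
    assume *: "Good Y f" "X \<in> C" "X \<subseteq> Y" "M Y f" "M X h" "\<And>x. x \<in> X \<Longrightarrow> h x = f x"
    obtain k where k: "M (Y <#> B) k" "\<forall>x \<in> Y. k x = f x" "k ` B = B" using *(1) by (auto simp: Good_def)
    have X: "subgroup X G" "X \<subseteq> T" and Y: "subgroup Y G" "Y \<subseteq> T"
      using M_sub M_dom *(4,5) by auto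
    have "X <#> B \<subseteq> Y <#> B" using *(3) by (auto simp: set_mult_def)
    then have "M (X <#> B) k" using M_res[OF k(1) XB(1)[OF X]] by simp
    then show "Good X h" unfolding Good_def using k(2,3) *(3,6) by (intro exI[of _ k]) auto
  next
    fix X f h assume *: "X \<in> C" "M X f" "M (f ` X) h" "Good X f" "Good (f ` X) h"
    obtain k where k: "M (X <#> B) k" "\<forall>x \<in> X. k x = f x" "k ` B = B" using *(4) by (auto simp: Good_def)
    obtain l where l: "M (f ` X <#> B) l" "\<forall>x \<in> f ` X. l x = h x" "l ` B = B"
      using *(5) by (auto simp: Good_def)
    have "k ` (X <#> B) = f ` X <#> B"
      using M_set_mult_img[OF k(1) M_sub[OF *(2)] B(1)] k by (metis image_cong)
    then have "M (X <#> B) (l \<circ> k)" using M_comp[OF k(1) l(1)] by simp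
    moreover have "(l \<circ> k) ` B = B" using k l by (metis image_comp)
    ultimately show "Good X (h \<circ> f)" unfolding Good_def using k l by (intro exI[of _ "l \<circ> k"]) auto
  next
    fix X f assume *: "X \<in> C" "M X f"
    have "f ` W = W" using normal_in_stable[OF W *(2)] *(1) by (auto simp: C_def)
    moreover have "f ` W \<subseteq> f ` X" using *(1) by (auto simp: C_def)
    ultimately have "W \<subseteq> f ` X" by simp
    then show "f ` X \<in> C" using M_img_sub[OF *(2)] M_img[OF *(2)] *(1) by (auto simp: C_def)
  next
    fix X Y assume "X \<in> C" "X \<subseteq> Y" "subgroup Y G" "Y \<subseteq> T"
    then show "Y \<in> C" by (auto simp: C_def)
  next
    fix X a
    assume *: "X \<in> C" "fully_aut X" "recept X" "M X a" "a ` X = X"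
      and IH: "\<And>Y f. Y \<in> C \<Longrightarrow> X \<subset> Y \<Longrightarrow> M Y f \<Longrightarrow> Good Y f"
    have X: "subgroup X G" "X \<subseteq> T" "W \<subseteq> X" using *(1) by (auto simp: C_def)
    note XB = XB[OF X(1,2)]
    show "Good X a"
    proof (cases "B \<subseteq> X")
      case True
      have "X <#> B = X" using set_mult_absorb[OF X(1) B(1) True] .
      moreover have "a ` B = B" using wc M_res[OF *(4) B(1) True] by simp
      ultimately show ?thesis unfolding Good_def using *(4) by auto
    next
      case False
      obtain K n where K': "K \<lhd> AutG X" "card K = p ^ n"
        "\<And>b. b \<in> B \<Longrightarrow> b \<in> norm_in T X \<Longrightarrow> restrict (conj_by b) X \<in> K" using K[OF X] by blast
      interpret A: group "AutG X" by (rule AutG_group[OF X(1,2)])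
      define a' where "a' = restrict a X"
      have a': "a' \<in> Aut X" unfolding a'_def by (rule Aut_restrict[OF *(4,5)])
      have KA: "K \<subseteq> Aut X" using normal_imp_subgroup[OF K'(1)] subgroup.subset by fastforce
      \<comment> \<open>Conjugating by \<open>a'\<close> keeps the conjugation by \<open>b\<close>
        inside \<open>K\<close>, and \<open>K\<close> consists of conjugations by elements of
        \<open>T\<close> because \<open>X\<close> is fully automized.\<close>
      have BN: "b \<in> N_of X a" if b: "b \<in> B" "b \<in> norm_in T X" for b
      proof -
        let ?k = "restrict (conj_by b) X"
        let ?l = "a' \<otimes>\<^bsub>AutG X\<^esub> ?k \<otimes>\<^bsub>AutG X\<^esub> inv\<^bsub>AutG X\<^esub> a'"
        have kK: "?k \<in> K" using K'(3)[OF b] .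
        then have "?l \<in> K" using normal.inv_op_closed2[OF K'(1)] a' by simp
        then obtain t where t: "t \<in> norm_in T X" "\<And>x. x \<in> X \<Longrightarrow> ?l x = conj_by t x"
          using Aut_inner_normal[OF X(1,2) *(2) K'(1,2)] by blast
        have "a (conj_by b x) = conj_by t (a x)" if x: "x \<in> X" for x
        proof -
          have ax: "a x \<in> X" "a' x = a x" using *(5) x by (auto simp: a'_def)
          have bx: "conj_by b x \<in> X" using norm_inD[OF b(2) x] .
          have "?l (a x) = a' (?k ((inv\<^bsub>AutG X\<^esub> a') (a' x)))"
            using Aut_conj_apply[OF X(1,2) a' _ ax(1), of ?k] kK KA ax(2) by auto
          also have "\<dots> = a' (conj_by b x)" using AutG_inv(2)[OF X(1,2) a' x] x by simp
          finally show ?thesis using t(2)[OF ax(1)] bx by (simp add: a'_def)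
        qed
        then show ?thesis using b(2) t(1) *(5) unfolding N_of_def by auto
      qed
      \<comment> \<open>The normalizer of \<open>X\<close> grows inside the product of
        \<open>X\<close> and \<open>B\<close>. Removing the factor in \<open>X\<close> from a new
        element leaves an element of \<open>B\<close> that normalizes \<open>X\<close> and lies
        outside it.\<close>
      have "X \<noteq> X <#> B" using False XB(3) by auto
      moreover have "X <#> B \<subseteq> T" using set_mult_least[OF T_sub X(2) B(2)] .
      ultimately obtain g where g: "g \<in> (X <#> B) - X" "g \<in> norm_in T X"
        using normalizer_grows_T[OF X(1) XB(2) _ XB(1)] by blast
      then obtain x b where xb: "x \<in> X" "b \<in> B" "g = x \<otimes> b" by (auto simp: set_mult_def)
      have "b = inv x \<otimes> g"
        using xb X(1) B(1) subgroup.mem_carrier by (metis inv_solve_left m_closed)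
      moreover have "inv x \<in> norm_in T X"
        using subgroup_in_norm_in[OF X(1,2)] subgroup.m_inv_closed[OF X(1) xb(1)] by blast
      ultimately have bn: "b \<in> norm_in T X" using subgroup.m_closed[OF norm_in_sub[OF X(2)]] g(2) by simp
      have bX: "b \<notin> X" using g(1) xb subgroup.m_closed[OF X(1)] by blast
      obtain h where h: "M (N_of X a) h" "\<And>x. x \<in> X \<Longrightarrow> h x = a x"
        using *(3,4,5) unfolding recept_def by blast
      have XN: "X \<subset> N_of X a" using N_of_contains[OF *(4)] BN[OF xb(2) bn] bX by blast
      have NC: "N_of X a \<in> C"
        using N_of_subgroup[OF *(4)] N_of_subset norm_in_subset XN X(3) unfolding C_def by blast
      obtain k where k: "M (N_of X a <#> B) k" "\<forall>x \<in> N_of X a. k x = h x" "k ` B = B"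
        using IH[OF NC XN h(1)] by (auto simp: Good_def)
      have "X <#> B \<subseteq> N_of X a <#> B" using XN by (auto simp: set_mult_def)
      then have "M (X <#> B) k" using M_res[OF k(1) XB(1)] by simp
      moreover have "k x = a x" if "x \<in> X" for x using k(2) h(2)[OF that] XN that by auto
      ultimately show ?thesis using k(3) unfolding Good_def by blast
    qed
  qed
  \<comment> \<open>A general domain need not contain \<open>W\<close>, so \<open>f\<close> is
    extended over the normal subgroup \<open>W\<close> before the induction applies.\<close>
  have "\<exists>h. M (X <#> B) h \<and> (\<forall>x \<in> X. h x = f x) \<and> h ` B = B" if f: "M X f" for X f
  proof -
    obtain h where h: "M (X <#> W) h" "\<And>x. x \<in> X \<Longrightarrow> h x = f x" "h ` W = W"
      using normal_in_extend[OF W f] by metis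
    have XW: "X \<subseteq> X <#> W" "W \<subseteq> X <#> W"
      using set_mult_left set_mult_right M_sub[OF f] Ws by blast+
    have "X <#> W \<in> C" using M_sub[OF h(1)] M_dom[OF h(1)] XW by (simp add: C_def)
    then obtain k where k: "M (X <#> W <#> B) k" "\<forall>x \<in> X <#> W. k x = h x" "k ` B = B"
      using Good[OF _ h(1)] unfolding Good_def by blast
    have "X <#> B \<subseteq> X <#> W <#> B" using XW(1) by (rule mono_set_mult) simp
    then have "M (X <#> B) k" using M_res[OF k(1) XB(1)[OF M_sub[OF f] M_dom[OF f]]] by simp
    then show ?thesis using k h(2) XW(1) by (intro exI[of _ k]) auto
  qed
  then show ?thesis using B by (simp add: normal_in_def)
qed

end

section \<open>The normalizer in the presence of a large subgroup\<close>

context fus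
begin

definition cent_in :: "'a set \<Rightarrow> 'a set" where
  "cent_in P = {t \<in> T. \<forall>x \<in> P. conj_by t x = x}"

lemma cent_in_subset: "cent_in P \<subseteq> T"
  by (auto simp: cent_in_def)

lemma cent_in_antimono: "P \<subseteq> W \<Longrightarrow> cent_in W \<subseteq> cent_in P"
  by (auto simp: cent_in_def)

lemma cent_in_subgroup:
  assumes "P \<subseteq> carrier G" shows "subgroup (cent_in P) G"
proof (rule subgroupI)
  have TG: "t \<in> carrier G" if "t \<in> T" for t using that T_carrier by blast
  show "cent_in P \<subseteq> carrier G" using TG by (auto simp: cent_in_def)
  have "\<one> \<in> cent_in P" using assms subgroup.one_closed[OF T_sub] by (auto simp: cent_in_def)
  then show "cent_in P \<noteq> {}" by blast
  show "inv g \<in> cent_in P" if g: "g \<in> cent_in P" for g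
  proof -
    have gT: "g \<in> T" using g by (simp add: cent_in_def)
    have "conj_by (inv g) x = x" if x: "x \<in> P" for x
    proof -
      have "conj_by g x = x" using g x by (simp add: cent_in_def)
      then show ?thesis using conj_by_inv1[OF TG[OF gT], of x] x assms by auto
    qed
    then show ?thesis using subgroup.m_inv_closed[OF T_sub gT] by (simp add: cent_in_def)
  qed
  show "g \<otimes> h \<in> cent_in P" if "g \<in> cent_in P" "h \<in> cent_in P" for g h
    using that subgroup.m_closed[OF T_sub] assms TG by (auto simp: cent_in_def conj_by_comp subset_eq)
qed

lemma cent_in_swap: "P \<subseteq> carrier G \<Longrightarrow> c \<in> cent_in P \<Longrightarrow> x \<in> P \<Longrightarrow> conj_by x c = c"
  using T_carrier conj_by_commute[of c x] conj_by_commute[of x c] by (auto simp: cent_in_def)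

lemma cent_in_norm: "c \<in> cent_in P \<Longrightarrow> c \<in> norm_in T P"
  by (simp add: cent_in_def norm_in_def)

lemma norm_in_cent:
  assumes P: "P \<subseteq> T" "norm_in T P = T" shows "norm_in T (cent_in P) = T"
proof -
  have "t \<in> norm_in T (cent_in P)" if t: "t \<in> T" for t
  proof (rule norm_inI[OF sub_finite[OF cent_in_subset] _ T_carrier t])
    have PG: "P \<subseteq> carrier G" using P T_carrier by blast
    show "cent_in P \<subseteq> carrier G" using cent_in_subset T_carrier by blast
    fix c assume c: "c \<in> cent_in P"
    have cT: "c \<in> T" using c by (simp add: cent_in_def)
    have car: "t \<in> carrier G" "c \<in> carrier G" using t cT T_carrier by auto
    have "conj_by (conj_by t c) x = x" if x: "x \<in> P" for x
    proof -
      have "inv t \<in> norm_in T P" using P(2) subgroup.m_inv_closed[OF T_sub t] by simp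
      then have y: "conj_by (inv t) x \<in> P" using norm_inD x by blast
      then have cy: "conj_by c (conj_by (inv t) x) = conj_by (inv t) x" using c by (simp add: cent_in_def)
      have xG: "x \<in> carrier G" using x PG by blast
      have "conj_by (conj_by t c) x = conj_by t (conj_by c (conj_by (inv t) x))"
        using car xG by (simp add: conj_by_comp[symmetric], simp add: conj_by_def m_assoc)
      then show ?thesis using cy car xG by simp
    qed
    then show "conj_by t c \<in> cent_in P"
      using conj_by_in_subgroup[OF T_sub t cT] by (simp add: cent_in_def)
  qed
  then show ?thesis using norm_in_subset by blast
qed

lemma M_cent:
  assumes f: "M Z f" and "P \<subseteq> Z" "x \<in> Z" "x \<in> cent_in P" shows "f x \<in> cent_in (f ` P)"
proof -
  have "conj_by (f x) (f y) = f y" if "y \<in> P" for y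
    using that M_conj_by[OF f assms(3), of y] assms(2,4) by (auto simp: cent_in_def)
  then show ?thesis using M_img[OF f] assms(3) by (auto simp: cent_in_def)
qed

text \<open>The centralizer of \<open>P\<close> as a fusion system over \<open>C\<^sub>T(P)\<close>:
  morphisms with an extension that is the identity on \<open>P\<close>.\<close>

definition cfus :: "'a set \<Rightarrow> 'a set \<Rightarrow> ('a \<Rightarrow> 'a) \<Rightarrow> bool" where
  "cfus P X f \<longleftrightarrow> subgroup X G \<and> X \<subseteq> cent_in P \<and>
     (\<exists>h. M (X <#> P) h \<and> (\<forall>x \<in> X. h x = f x) \<and> (\<forall>x \<in> P. h x = x))"

end

text \<open>This describes \<open>E = N\<^sub>F(P)\<close> seen from inside: \<open>T\<close> plays
  the role of the normalizer of \<open>P\<close>, and \<open>P\<close> is normal in the whole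
  system.\<close>

locale fus_normal = fus p G T M
  for p :: nat and G :: "('a, 'b) monoid_scheme" (structure) and T M +
  fixes P :: "'a set"
  assumes sat: saturated_M and PN: "normal_in T M P"
begin

lemma P_sub: "subgroup P G" and P_T: "P \<subseteq> T" and P_norm: "norm_in T P = T"
  using PN normal_in_subgroup normal_in_subset normal_in_norm by blast+

lemma P_car: "P \<subseteq> carrier G" using P_T T_carrier by blast

lemma prod_P:
  assumes "subgroup X G" "X \<subseteq> T"
  shows "subgroup (X <#> P) G" "X \<subseteq> X <#> P" "P \<subseteq> X <#> P" "X <#> P \<subseteq> T"
  using assms set_mult_subgroup[OF assms(1) P_sub, of T] set_mult_left set_mult_right P_sub P_norm
    set_mult_least[OF T_sub assms(2) P_T] by auto

abbreviation "C \<equiv> cent_in P"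

lemma C_sub: "subgroup C G" and C_T: "C \<subseteq> T"
  using cent_in_subgroup[OF P_car] cent_in_subset by auto

lemma cfusD:
  assumes "cfus P X f"
  shows "subgroup X G" "X \<subseteq> C" "M X f" "f ` X \<subseteq> C"
proof -
  obtain h where X: "subgroup X G" "X \<subseteq> C" and h: "M (X <#> P) h" "\<forall>x \<in> X. h x = f x" "\<forall>x \<in> P. h x = x"
    using assms by (auto simp: cfus_def)
  show "subgroup X G" "X \<subseteq> C" by fact+
  note XP = prod_P[OF X(1) subset_trans[OF X(2) C_T]]
  show "M X f" using M_res[OF h(1) X(1) XP(2)] h(2) by simp
  have "h ` P = P" using h(3) by simp
  then have "h x \<in> C" if "x \<in> X" for x using M_cent[OF h(1) XP(3), of x] that X(2) XP(2) by auto
  then show "f ` X \<subseteq> C" using h(2) by auto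
qed

lemma cfusI:
  assumes "subgroup X G" "X \<subseteq> C" "M Z h" "X \<subseteq> Z" "P \<subseteq> Z" "\<And>x. x \<in> X \<Longrightarrow> h x = f x" "\<And>x. x \<in> P \<Longrightarrow> h x = x"
  shows "cfus P X f"
proof -
  have X: "subgroup (X <#> P) G" using prod_P[OF assms(1)] assms(2) C_T by blast
  have "M (X <#> P) h"
    using M_res[OF assms(3) X set_mult_least[OF M_sub[OF assms(3)] assms(4,5)]] by simp
  then show ?thesis using assms by (auto simp: cfus_def)
qed

lemma cent_prod: "subgroup (C <#> P) G" "C \<subseteq> C <#> P" "P \<subseteq> C <#> P" "C <#> P \<subseteq> T"
  using prod_P[OF C_sub C_T] .

lemma CP_image:
  assumes a: "M (C <#> P) a" "a ` P = P"
  shows "a ` C = C" "a ` (C <#> P) = C <#> P"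
proof -
  have aC: "a ` C \<subseteq> C" using M_cent[OF a(1) cent_prod(3)] cent_prod(2) a(2) by auto
  show "a ` C = C" using card_subset_eq[OF sub_finite[OF C_T] aC] M_card[OF a(1) cent_prod(2)] by simp
  then show "a ` (C <#> P) = C <#> P" using M_set_mult_img[OF a(1) C_sub P_sub] a(2) by simp
qed

text \<open>A morphism \<open>a\<close> on the product of \<open>C\<close> and \<open>P\<close> that
  fixes \<open>P\<close> induces an automorphism of the centralizer system, so it permutes the
  normal subgroups of that system.\<close>

lemma normal_cfus_image:
  assumes B: "normal_in C (cfus P) B" and a: "M (C <#> P) a" "a ` P = P"
  shows "normal_in C (cfus P) (a ` B)"
proof -
  define b where "b = inv_into (C <#> P) a"
  have Bs: "subgroup B G" "B \<subseteq> C" using normal_in_subgroup[OF B] normal_in_subset[OF B] .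
  note aC = CP_image(1)[OF a] and aCP = CP_image(2)[OF a]
  have b: "M (C <#> P) b" using M_inv[OF a(1)] aCP by (simp add: b_def)
  have ba: "b (a x) = x" if "x \<in> C <#> P" for x using M_inv_f[OF a(1) that] by (simp add: b_def)
  have bimg: "b ` a ` Z = Z" if "Z \<subseteq> C <#> P" for Z using M_inv_cancel[OF a(1) that] by (simp add: b_def)
  have ab: "a (b x) = x" if "x \<in> C <#> P" for x
    using that aCP by (auto simp: b_def intro!: f_inv_into_f)
  have abimg: "a ` b ` Z = Z" if "Z \<subseteq> C <#> P" for Z
    unfolding image_image using ab that by (simp add: subset_eq)
  have bP: "b ` P = P" using bimg[OF cent_prod(3)] a(2) by simp
  have bC: "b ` C = C" using bimg[OF cent_prod(2)] aC by simp
  have BCP: "B \<subseteq> C <#> P" using Bs(2) cent_prod(2) by blast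
  have aB: "subgroup (a ` B) G" "a ` B \<subseteq> C" using M_sub_img[OF a(1) Bs(1) BCP] Bs(2) aC by auto
  have "norm_in C (a ` B) = C"
  proof -
    have "c \<in> norm_in C (a ` B)" if c: "c \<in> C" for c
    proof (rule norm_inI[OF sub_finite _ _ c])
      show "a ` B \<subseteq> T" "a ` B \<subseteq> carrier G" "C \<subseteq> carrier G" using aB(2) C_T T_carrier by blast+
      fix x assume "x \<in> a ` B"
      then obtain y where y: "y \<in> B" "x = a y" by blast
      obtain d where d: "d \<in> C" "c = a d" using c aC by blast
      have "d \<in> C <#> P" "y \<in> C <#> P" using d(1) y(1) Bs(2) cent_prod(2) by blast+
      then have "conj_by c x = a (conj_by d y)" using M_conj_by[OF a(1)] y(2) d(2) by simp
      then show "conj_by c x \<in> a ` B" using normal_in_conj[OF B d(1) y(1)] by simp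
    qed
    then show ?thesis using norm_in_subset by blast
  qed
  moreover have "\<exists>h. cfus P (X <#> a ` B) h \<and> (\<forall>x \<in> X. h x = f x) \<and> h ` a ` B = a ` B"
    if f: "cfus P X f" for X f
  proof -
    note X = cfusD[OF f]
    have XT: "X \<subseteq> T" using X(2) C_T by blast
    note XP' = prod_P[OF X(1) XT]
    obtain h where h: "M (X <#> P) h" "\<And>x. x \<in> X \<Longrightarrow> h x = f x" "\<And>x. x \<in> P \<Longrightarrow> h x = x"
      using f by (auto simp: cfus_def)
    have XCP: "X <#> P \<subseteq> C <#> P" using X(2) by (auto simp: set_mult_def)
    have hXP: "h ` (X <#> P) \<subseteq> C <#> P"
    proof -
      have "h ` X \<subseteq> C" "h ` P = P" using h(2,3) X(4) by auto
      then show ?thesis using M_set_mult_img[OF h(1) X(1) P_sub] by (auto simp: set_mult_def)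
    qed
    define Y where "Y = b ` X"
    have XCP': "X \<subseteq> C <#> P" using XCP XP'(2) by blast
    have Y: "subgroup Y G" "Y \<subseteq> C" "a ` Y = X"
      using M_sub_img[OF b X(1) XCP'] bC X(2) abimg[OF XCP'] by (auto simp: Y_def)
    \<comment> \<open>\<open>f\<close> is transported back along \<open>a\<close>, extended there
      over \<open>B\<close>, and the extension is transported forward as
      \<open>a \<circ> (k \<circ> b)\<close>.\<close>
    define f' where "f' = b \<circ> (h \<circ> a)"
    have YT: "Y \<subseteq> T" using Y(2) C_T by blast
    have YCP: "Y <#> P \<subseteq> C <#> P" using Y(2) by (auto simp: set_mult_def)
    have Ma: "M (Y <#> P) a" using M_res[OF a(1) prod_P(1)[OF Y(1) YT] YCP] by simp
    have aYP: "a ` (Y <#> P) = X <#> P" using M_set_mult_img[OF Ma Y(1) P_sub] Y(3) a(2) by simp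
    have Mha: "M (Y <#> P) (h \<circ> a)" using M_comp[OF Ma h(1)] aYP by simp
    have "(h \<circ> a) ` (Y <#> P) \<subseteq> C <#> P" using aYP hXP by (metis image_comp)
    then have Mf': "M (Y <#> P) f'" unfolding f'_def using M_comp[OF Mha b] by blast
    have f'P: "f' x = x" if "x \<in> P" for x
    proof -
      have "a x \<in> P" using that a(2) by blast
      then show ?thesis using h(3) ba that cent_prod(3) by (auto simp: f'_def)
    qed
    have "cfus P Y f'" using cfusI[OF Y(1,2) Mf' prod_P(2,3)[OF Y(1) YT]] f'P by simp
    then obtain h' where h': "cfus P (Y <#> B) h'" "\<And>y. y \<in> Y \<Longrightarrow> h' y = f' y" "h' ` B = B"
      using normal_in_extend[OF B] by metis
    note YB = cfusD[OF h'(1)]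
    obtain k where k: "M (Y <#> B <#> P) k" "\<And>x. x \<in> Y <#> B \<Longrightarrow> k x = h' x" "\<And>x. x \<in> P \<Longrightarrow> k x = x"
      using h'(1) by (auto simp: cfus_def)
    define Z where "Z = Y <#> B <#> P"
    have YBs: "Y \<subseteq> Y <#> B" "B \<subseteq> Y <#> B" using set_mult_left[OF Y(1) Bs(1)] set_mult_right[OF Y(1) Bs(1)] .
    note ZP = prod_P[OF YB(1) subset_trans[OF YB(2) C_T], folded Z_def]
    have kZ: "k ` Z \<subseteq> C <#> P"
    proof -
      have "k ` (Y <#> B) \<subseteq> C" using k(2) YB(4) by auto
      moreover have "k ` P = P" using k(3) by simp
      ultimately show ?thesis
        unfolding Z_def M_set_mult_img[OF k(1) YB(1) P_sub] by (intro mono_set_mult) simp_all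
    qed
    have ZCP: "Z \<subseteq> C <#> P" using YB(2) by (auto simp: Z_def set_mult_def)
    have MaZ: "M Z a" using M_res[OF a(1) ZP(1) ZCP] by simp
    have bZ: "b ` a ` Z = Z" using bimg[OF ZCP] .
    have Mb: "M (a ` Z) b" using M_res[OF b M_img_sub[OF MaZ]] aCP ZCP by blast
    have "M (a ` Z) (k \<circ> b)" using M_comp[OF Mb k(1)] bZ by (simp add: Z_def)
    moreover have "(k \<circ> b) ` a ` Z \<subseteq> C <#> P" using bZ kZ by (metis image_comp)
    ultimately have Mk': "M (a ` Z) (a \<circ> (k \<circ> b))" using M_comp a(1) by blast
    have XaB: "X <#> a ` B = a ` (Y <#> B)"
    proof -
      have "M (Y <#> B) a" using M_res[OF MaZ YB(1) ZP(2)] by simp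
      then show ?thesis using M_set_mult_img[OF _ Y(1) Bs(1)] Y(3) by metis
    qed
    have sgXaB: "subgroup (X <#> a ` B) G" "X <#> a ` B \<subseteq> C"
      unfolding XaB using M_sub_img[OF MaZ YB(1) ZP(2)] YB(2) aC by auto
    have "cfus P (X <#> a ` B) (a \<circ> (k \<circ> b))"
    proof (rule cfusI[OF sgXaB Mk'])
      show "X <#> a ` B \<subseteq> a ` Z" unfolding XaB using ZP(2) by blast
      show "P \<subseteq> a ` Z" using a(2) ZP(3) by blast
      show "(a \<circ> (k \<circ> b)) x = x" if x: "x \<in> P" for x
      proof -
        have "b x \<in> P" using x bP by blast
        then show ?thesis using k(3) ab x cent_prod(3) by auto
      qed
    qed simp
    moreover have "(a \<circ> (k \<circ> b)) x = f x" if x: "x \<in> X" for x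
    proof -
      have bx: "b x \<in> Y" using x by (simp add: Y_def)
      have abx: "a (b x) = x" using ab x XCP' by blast
      have "k (b x) = b (h x)" using k(2) h'(2)[OF bx] bx YBs(1) abx by (auto simp: f'_def)
      moreover have "h x \<in> C <#> P" using hXP x XP'(2) by blast
      ultimately show ?thesis using ab h(2)[OF x] by simp
    qed
    moreover have "(a \<circ> (k \<circ> b)) ` a ` B = a ` B"
    proof -
      have "k ` B = B" using k(2) YBs(2) h'(3) by (metis (no_types, lifting) image_cong subsetD)
      then show ?thesis using bimg[OF BCP] by (simp only: image_comp[symmetric])
    qed
    ultimately show ?thesis by blast
  qed
  ultimately show ?thesis using aB by (simp add: normal_in_def)
qed

text \<open>Frattini argument. Extend \<open>f\<close> to \<open>g\<close>, fixing \<open>P\<close>,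
  and let \<open>a\<close>, defined on the product of \<open>C\<close> and \<open>P\<close>, agree
  with \<open>g\<close> on \<open>P\<close>. Then \<open>g\<close> followed by the inverse of
  \<open>a\<close> is trivial on \<open>P\<close>, hence a morphism of the centralizer system, and
  it extends over the normal subgroup \<open>B\<close>. Finally \<open>a\<close> fixes
  \<open>B\<close>, because \<open>B\<close> is the greatest normal subgroup.\<close>

lemma cfus_extend:
  assumes B: "normal_in C (cfus P) B" and gr: "\<And>R. normal_in C (cfus P) R \<Longrightarrow> R \<subseteq> B"
    and f: "M Y f" "Y \<subseteq> C"
  shows "\<exists>k. M (Y <#> B) k \<and> (\<forall>y \<in> Y. k y = f y) \<and> k ` B = B"
proof -
  have Y: "subgroup Y G" "Y \<subseteq> T" using M_sub[OF f(1)] M_dom[OF f(1)] .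
  have Bs: "subgroup B G" "B \<subseteq> C" using normal_in_subgroup[OF B] normal_in_subset[OF B] .
  note YP = prod_P[OF Y]
  obtain f0 where f0: "M P f0" "recept (f0 ` P)" using sat P_sub P_T unfolding saturated_M_def by blast
  then have rec: "recept P" using normal_in_stable[OF PN f0(1) _ P_sub] by simp
  obtain g where g: "M (Y <#> P) g" "\<And>y. y \<in> Y \<Longrightarrow> g y = f y" "g ` P = P"
    using normal_in_extend[OF PN f(1)] by metis
  have MgP: "M P g" using M_res[OF g(1) P_sub YP(3)] by simp
  \<comment> \<open>Elements of \<open>C\<close> act trivially on \<open>P\<close>, so the
    transported conjugation is trivial and \<one> realizes it.\<close>
  have "C \<subseteq> N_of P g"
  proof
    fix c assume c: "c \<in> C"
    have "\<one> \<in> norm_in T (g ` P)" using g(3) P_norm subgroup.one_closed[OF T_sub] by simp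
    moreover have "g (conj_by c y) = conj_by \<one> (g y)" if "y \<in> P" for y
      using c that M_val_carrier[OF MgP that] by (simp add: cent_in_def)
    ultimately show "c \<in> N_of P g" using cent_in_norm[OF c] unfolding N_of_def by blast
  qed
  then have CPN: "C <#> P \<subseteq> N_of P g"
    using set_mult_least[OF N_of_subgroup[OF MgP]] N_of_contains[OF MgP] by blast
  obtain a where a0: "M (N_of P g) a" "\<And>x. x \<in> P \<Longrightarrow> a x = g x"
    using rec MgP g(3) unfolding recept_def by blast
  have a: "M (C <#> P) a" using M_res[OF a0(1) cent_prod(1) CPN] by simp
  have aP: "a ` P = P" using a0(2) g(3) by simp
  have BCP: "B \<subseteq> C <#> P" using Bs(2) cent_prod(2) by blast
  have "a ` B \<subseteq> B" using gr[OF normal_cfus_image[OF B a aP]] .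
  then have aB: "a ` B = B"
    using card_subset_eq[OF sub_finite] M_card[OF a BCP] Bs(2) C_T by blast
  define b where "b = inv_into (C <#> P) a"
  have b: "M (C <#> P) b" using M_inv[OF a] CP_image(2)[OF a aP] by (simp add: b_def)
  have ba: "b (a x) = x" if "x \<in> C <#> P" for x using M_inv_f[OF a that] by (simp add: b_def)
  have ab: "a (b x) = x" if "x \<in> C <#> P" for x
    using that CP_image(2)[OF a aP] by (auto simp: b_def intro!: f_inv_into_f)
  have gY: "g ` Y \<subseteq> C" using M_cent[OF g(1) YP(3)] f(2) YP(2) g(3) by auto
  then have gYP: "g ` (Y <#> P) \<subseteq> C <#> P"
    using M_set_mult_img[OF g(1) Y(1) P_sub] g(3) by (auto simp: set_mult_def)
  have "M (Y <#> P) (b \<circ> g)" using M_comp[OF g(1) b gYP] .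
  moreover have "(b \<circ> g) x = x" if "x \<in> P" for x
    using that a0(2)[OF that] ba cent_prod(3) by (metis comp_apply subsetD)
  ultimately have "cfus P Y (b \<circ> g)" using cfusI[OF Y(1) f(2) _ YP(2,3)] by simp
  then obtain h where h: "cfus P (Y <#> B) h" "\<And>y. y \<in> Y \<Longrightarrow> h y = (b \<circ> g) y" "h ` B = B"
    using normal_in_extend[OF B] by metis
  have "M (Y <#> B) (a \<circ> h)" using M_comp[OF cfusD(3)[OF h(1)] a] cfusD(4)[OF h(1)] cent_prod(2) by blast
  moreover have "(a \<circ> h) ` B = B" using h(3) aB by (simp only: image_comp[symmetric])
  moreover have "(a \<circ> h) y = f y" if "y \<in> Y" for y
  proof -
    have "g y \<in> C <#> P" using gY cent_prod(2) that by blast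
    then show ?thesis using h(2)[OF that] g(2)[OF that] ab[of "g y"] by simp
  qed
  ultimately show ?thesis by blast
qed

text \<open>The greatest normal subgroup of the centralizer of \<open>P\<close> controls its own fusion. Hence, on
  \<open>X\<close>, the automorphisms that are trivial modulo \<open>B\<close> and act on \<open>X \<inter> B\<close> as conjugation by an
  element of \<open>B\<close> form a normal \<open>p\<close>-subgroup.\<close>

lemma normal_cfus_core:
  assumes A: "normal_in C (cfus P) A"
  shows "\<exists>B. normal_in T M B \<and> A \<subseteq> B"
proof -
  obtain B where B: "normal_in C (cfus P) B" and gr: "\<And>R. normal_in C (cfus P) R \<Longrightarrow> R \<subseteq> B"
  proof -
    have "\<exists>W. normal_in C (cfus P) W \<and> (\<forall>R. normal_in C (cfus P) R \<longrightarrow> R \<subseteq> W)"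
    proof (rule normal_in_greatest[OF C_sub sub_finite[OF C_T]])
      fix X f assume c: "cfus P X f"
      show "f (x \<otimes> y) = f x \<otimes> f y" if "x \<in> X" "y \<in> X" for x y using M_mult[OF cfusD(3)[OF c] that] .
      show "subgroup X G \<and> X \<subseteq> C" using cfusD[OF c] by simp
      show "f \<one> = \<one>" using M_one[OF cfusD(3)[OF c]] .
    qed
    then show ?thesis using that by blast
  qed
  have Bs: "subgroup B G" "B \<subseteq> C" using normal_in_subgroup[OF B] normal_in_subset[OF B] .
  have BT: "B \<subseteq> T" using Bs(2) C_T by blast
  have BG: "b \<in> carrier G" if "b \<in> B" for b using subgroup.mem_carrier[OF Bs(1) that] .
  have ext: "\<exists>k. M B k \<and> (\<forall>y \<in> Y. k y = f y) \<and> k ` B = B" if f: "M Y f" and YB: "Y \<subseteq> B" for Y f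
  proof -
    obtain k where k: "M (Y <#> B) k" "\<forall>y \<in> Y. k y = f y" "k ` B = B"
      using cfus_extend[OF B gr f] YB Bs(2) by blast
    have "M B k" using M_res[OF k(1) Bs(1) set_mult_right[OF M_sub[OF f] Bs(1)]] by simp
    then show ?thesis using k by blast
  qed
  \<comment> \<open>With \<open>Y = B\<close> the extension is \<open>f\<close> itself.\<close>
  have wc: "f ` B = B" if f: "M B f" for f
    using ext[OF f] by (metis image_cong subset_refl)
  have Bn: "norm_in T B = T"
    using wc[OF M_conj[OF Bs(1) BT]] by (auto simp: norm_in_def)
  \<comment> \<open>The criterion is applied with the trivial group as the known normal subgroup, so
    \<open>X\<close> below is an arbitrary subgroup of \<open>T\<close>.\<close>
  have "normal_in T M B"
  proof (rule normal_criterion[OF sat normal_in_one[OF T_sub] Bs(1) BT Bn wc])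
    show "subgroup X G \<and> f \<one> = \<one>" if "M X f" for X f using M_sub M_one that by blast
    fix X assume X: "subgroup X G" "X \<subseteq> T"
    have XG: "x \<in> carrier G" if "x \<in> X" for x using subgroup.mem_carrier[OF X(1) that] .
    have XB: "subgroup (X \<inter> B) G" using subgroups_Inter_pair[OF X(1) Bs(1)] .
    \<comment> \<open>On \<open>X \<inter> B\<close> the automorphism \<open>a\<close> is the
      restriction of a morphism that fixes \<open>B\<close>; therefore it preserves
      \<open>X \<inter> B\<close>.\<close>
    have ext': "\<exists>k. M B k \<and> (\<forall>y \<in> X \<inter> B. k y = a y) \<and> k ` B = B" if a: "a \<in> Aut X" for a
    proof (rule ext)
      show "M (X \<inter> B) a" using M_res[OF AutD(1)[OF a] XB] by simp
    qed simp
    have pres: "a y \<in> X \<inter> B" if a: "a \<in> Aut X" and y: "y \<in> X \<inter> B" for a y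
      using ext'[OF a] y AutD(3)[OF a] by (metis Int_iff imageI)
    define K where "K = {k \<in> Aut X. (\<forall>x \<in> X. inv x \<otimes> k x \<in> B) \<and> (\<exists>b \<in> B. \<forall>y \<in> X \<inter> B. k y = conj_by b y)}"
    have KA: "K \<subseteq> Aut X" by (auto simp: K_def)
    have conjK: "restrict (conj_by b) X \<in> K" if b: "b \<in> B" "b \<in> norm_in T X" for b
    proof -
      have "inv x \<otimes> conj_by b x \<in> B" if x: "x \<in> X" for x
      proof -
        have "inv x \<in> norm_in T B" using Bn subgroup.m_inv_closed[OF T_sub] x X(2) by blast
        then have "conj_by (inv x) b \<otimes> inv b \<in> B"
          using norm_inD b(1) subgroup.m_closed[OF Bs(1)] subgroup.m_inv_closed[OF Bs(1)] by blast
        moreover have "conj_by (inv x) b \<otimes> inv b = inv x \<otimes> conj_by b x"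
          using BG[OF b(1)] XG[OF x] by (simp add: conj_by_def m_assoc)
        ultimately show ?thesis by simp
      qed
      then show ?thesis using norm_in_restrict_Aut[OF X b(2)] b(1) by (auto simp: K_def)
    qed
    have "K \<lhd> AutG X \<and> (\<exists>n. card K = p ^ n)"
    proof (rule Aut_p_normal[OF X KA], goal_cases)
      case 1
      have "\<one> \<in> norm_in T X" using subgroup.one_closed[OF norm_in_sub[OF X(2)]] .
      then have "restrict (conj_by \<one>) X \<in> K" using conjK subgroup.one_closed[OF Bs(1)] by blast
      moreover have "restrict (conj_by \<one>) X = restrict (\<lambda>x. x) X" using XG by auto
      ultimately show ?case by simp
    next
      case (2 k)
      then obtain b where k: "k \<in> Aut X" "\<And>x. x \<in> X \<Longrightarrow> inv x \<otimes> k x \<in> B" "b \<in> B"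
        "\<And>y. y \<in> X \<inter> B \<Longrightarrow> k y = conj_by b y" by (auto simp: K_def)
      let ?i = "inv\<^bsub>AutG X\<^esub> k"
      have iA: "?i \<in> Aut X" using AutG_inv_closed[OF X k(1)] .
      have "inv x \<otimes> ?i x \<in> B" if x: "x \<in> X" for x
      proof -
        have ix: "?i x \<in> X" "k (?i x) = x" using AutG_inv[OF X k(1) x] by auto
        have "inv (inv (?i x) \<otimes> x) \<in> B"
          using k(2)[OF ix(1)] ix(2) subgroup.m_inv_closed[OF Bs(1)] by metis
        then show ?thesis using XG[OF x] XG[OF ix(1)] by (simp add: inv_mult_group)
      qed
      moreover have "?i y = conj_by (inv b) y" if y: "y \<in> X \<inter> B" for y
      proof -
        have "k (?i y) = conj_by b (?i y)" using k(4)[OF pres[OF iA y]] .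
        then have "y = conj_by b (?i y)" using AutG_inv(3)[OF X k(1)] y by simp
        then show ?thesis using BG[OF k(3)] XG pres[OF iA y] by (metis IntE conj_by_inv1)
      qed
      ultimately show ?case using iA subgroup.m_inv_closed[OF Bs(1) k(3)] by (auto simp: K_def)
    next
      case (3 k l)
      then obtain b c where k: "k \<in> Aut X" "\<And>x. x \<in> X \<Longrightarrow> inv x \<otimes> k x \<in> B" "b \<in> B"
        "\<And>y. y \<in> X \<inter> B \<Longrightarrow> k y = conj_by b y"
        and l: "l \<in> Aut X" "\<And>x. x \<in> X \<Longrightarrow> inv x \<otimes> l x \<in> B" "c \<in> B"
        "\<And>y. y \<in> X \<inter> B \<Longrightarrow> l y = conj_by c y" by (auto simp: K_def)
      have "inv x \<otimes> k (l x) \<in> B" if x: "x \<in> X" for x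
      proof -
        have lx: "l x \<in> X" "k (l x) \<in> X" using AutD(3) k(1) l(1) x by blast+
        have "(inv x \<otimes> l x) \<otimes> (inv (l x) \<otimes> k (l x)) = inv x \<otimes> k (l x)"
          using XG[OF x] XG[OF lx(1)] XG[OF lx(2)] by (simp add: inv_telescope)
        then show ?thesis using subgroup.m_closed[OF Bs(1) l(2)[OF x] k(2)[OF lx(1)]] by simp
      qed
      moreover have "k (l y) = conj_by (b \<otimes> c) y" if y: "y \<in> X \<inter> B" for y
        using k(4)[OF pres[OF l(1) y]] l(4)[OF y] BG k(3) l(3) y by (simp add: conj_by_comp)
      ultimately show ?case
        using AutG_m_closed[OF X k(1) l(1)] subgroup.m_closed[OF Bs(1) k(3) l(3)] AutG_mult[OF k(1) l(1)]
        by (auto simp: K_def)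
    next
      case (4 a k)
      then obtain b where a: "a \<in> Aut X" and k: "k \<in> Aut X" "\<And>x. x \<in> X \<Longrightarrow> inv x \<otimes> k x \<in> B" "b \<in> B"
        "\<And>y. y \<in> X \<inter> B \<Longrightarrow> k y = conj_by b y" by (auto simp: K_def)
      let ?i = "inv\<^bsub>AutG X\<^esub> a"
      have iA: "?i \<in> Aut X" using AutG_inv_closed[OF X a] .
      have app: "(a \<otimes>\<^bsub>AutG X\<^esub> k \<otimes>\<^bsub>AutG X\<^esub> ?i) x = a (k (?i x))" if "x \<in> X" for x
        using Aut_conj_apply[OF X a k(1) that] .
      have "inv x \<otimes> a (k (?i x)) \<in> B" if x: "x \<in> X" for x
      proof -
        have ix: "?i x \<in> X" "a (?i x) = x" using AutG_inv[OF X a x] by auto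
        have kx: "k (?i x) \<in> X" "inv (?i x) \<in> X" using AutD(3)[OF k(1) ix(1)] subgroup.m_inv_closed[OF X(1) ix(1)] .
        then have "inv (?i x) \<otimes> k (?i x) \<in> X \<inter> B" using k(2)[OF ix(1)] subgroup.m_closed[OF X(1)] by blast
        then have "a (inv (?i x) \<otimes> k (?i x)) \<in> B" using pres[OF a] by blast
        then show ?thesis
          using M_mult[OF AutD(1)[OF a] kx(2,1)] M_inv_elt[OF AutD(1)[OF a] ix(1)] ix(2) by simp
      qed
      \<comment> \<open>The element \<open>b\<close> may lie outside the domain \<open>X\<close> of
        \<open>a\<close>. The extension \<open>a'\<close> is defined on \<open>B\<close> and
        provides \<open>a' b\<close> as the new conjugating element.\<close>
      moreover obtain a' where a': "M B a'" "\<And>y. y \<in> X \<inter> B \<Longrightarrow> a' y = a y" "a' ` B = B"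
        using ext'[OF a] by blast
      have "a (k (?i y)) = conj_by (a' b) y" if y: "y \<in> X \<inter> B" for y
      proof -
        have iy: "?i y \<in> X \<inter> B" "a (?i y) = y" using pres[OF iA y] AutG_inv(3)[OF X a] y by auto
        have ky: "k (?i y) \<in> X \<inter> B" using pres[OF k(1) iy(1)] .
        have "a (k (?i y)) = a' (conj_by b (?i y))" using a'(2)[OF ky] k(4)[OF iy(1)] by simp
        also have "\<dots> = conj_by (a' b) (a' (?i y))" using M_conj_by[OF a'(1) k(3)] iy(1) by simp
        finally show ?thesis using a'(2)[OF iy(1)] iy(2) by simp
      qed
      moreover have "a' b \<in> B" using a'(3) k(3) by blast
      moreover have "a \<otimes>\<^bsub>AutG X\<^esub> k \<otimes>\<^bsub>AutG X\<^esub> ?i \<in> Aut X"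
        using AutG_m_closed[OF X AutG_m_closed[OF X a k(1)] iA] .
      ultimately show ?case using app by (auto simp: K_def)
    next
      case (5 k)
      then obtain b where k: "k \<in> Aut X" "\<And>x. x \<in> X \<Longrightarrow> inv x \<otimes> k x \<in> B" "b \<in> B"
        "\<And>y. y \<in> X \<inter> B \<Longrightarrow> k y = conj_by b y" by (auto simp: K_def)
      obtain m where m: "\<And>c. c \<in> T \<Longrightarrow> c [^] (p ^ m) = \<one>" using T_exponent by blast
      \<comment> \<open>The exponent is used twice. After \<open>p ^ m\<close> iterations the
        conjugating element has become \<one>, so \<open>?d\<close> is trivial on
        \<open>X \<inter> B\<close>. Then \<open>?d\<close> moves each \<open>x\<close> by an
        element of \<open>X \<inter> B\<close>, which it fixes, and another \<open>p ^ m\<close>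
        iterations of \<open>?d\<close> remove the displacement.\<close>
      let ?d = "k ^^ (p ^ m)"
      have d: "M X ?d" "?d ` X = X" using M_funpow[OF AutD(1,2)[OF k(1)]] by auto
      have it: "(k ^^ n) y = conj_by (b [^] n) y" if y: "y \<in> X \<inter> B" for n y
      proof (induction n)
        case (Suc n)
        have "(k ^^ n) y \<in> X \<inter> B"
          using pres[OF k(1)] y by (induction n) auto
        then have "(k ^^ Suc n) y = conj_by b (conj_by (b [^] n) y)" using k(4) Suc by simp
        also have "\<dots> = conj_by (b [^] Suc n) y"
          using BG[OF k(3)] XG y nat_pow_Suc2[of b n] by (simp add: conj_by_comp)
        finally show ?case .
      qed (use XG that in simp)
      have dB: "?d y = y" if "y \<in> X \<inter> B" for y
        using it[OF that] m[of b] k(3) BT XG that by auto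
      have inB: "inv x \<otimes> (k ^^ n) x \<in> B" if x: "x \<in> X" for n x
      proof (induction n)
        case 0
        then show ?case using XG[OF x] subgroup.one_closed[OF Bs(1)] by simp
      next
        case (Suc n)
        have "(k ^^ n) x \<in> X" using AutD(3)[OF k(1)] x by (induction n) auto
        then have y: "(k ^^ n) x \<in> X" "k ((k ^^ n) x) \<in> X" using AutD(3)[OF k(1)] by auto
        have "(inv x \<otimes> (k ^^ n) x) \<otimes> (inv ((k ^^ n) x) \<otimes> k ((k ^^ n) x)) = inv x \<otimes> (k ^^ Suc n) x"
          using XG[OF x] XG[OF y(1)] XG[OF y(2)] by (simp add: inv_telescope)
        then show ?case using subgroup.m_closed[OF Bs(1) Suc k(2)[OF y(1)]] by simp
      qed
      have "(k ^^ (p ^ (m + m))) x = x" if x: "x \<in> X" for x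
      proof -
        let ?c = "inv x \<otimes> ?d x"
        have dx: "?d x \<in> X" using d(2) x by blast
        have c: "?c \<in> X \<inter> B"
          using inB[OF x] subgroup.m_closed[OF X(1) subgroup.m_inv_closed[OF X(1) x] dx] by blast
        have "?d x = x \<otimes> ?c" using XG[OF x] XG[OF dx] by (simp add: m_assoc[symmetric])
        moreover have "?c \<in> X" "?c \<in> T" "?d ` X \<subseteq> X" using c BT d(2) by (blast, blast, simp)
        ultimately have "(?d ^^ (p ^ m)) x = x \<otimes> ?c [^] (p ^ m)"
          using M_shift[OF d(1) _ x _ _ dB[OF c]] by metis
        also have "\<dots> = x" unfolding m[OF \<open>?c \<in> T\<close>] using XG[OF x] by simp
        finally have "((k ^^ (p ^ m)) ^^ (p ^ m)) x = x" .
        then show ?thesis unfolding funpow_mult power_add .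
      qed
      then show ?case by blast
    qed
    then show "\<exists>K n. K \<lhd> AutG X \<and> card K = p ^ n \<and> (\<forall>b \<in> B. b \<in> norm_in T X \<longrightarrow> restrict (conj_by b) X \<in> K)"
      using conjK by blast
  qed
  then show ?thesis using gr[OF A] by blast
qed

text \<open>Let \<open>W\<close> be the greatest normal subgroup. On \<open>X \<ge> W\<close>, the automorphisms that are trivial
  on \<open>W\<close> form a normal \<open>p\<close>-subgroup: they extend to \<open>XQ\<close>, where they are trivial modulo
  \<open>C\<^sub>Q(W) \<le> W\<close> on \<open>Q\<close>, and, as \<open>C\<^sub>T(Q) \<le> Q\<close>, a power that is trivial on \<open>Q\<close> is trivial
  modulo \<open>Q\<close> on \<open>X\<close>. So \<open>C\<^sub>T(W)\<close> is normal.\<close>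

lemma self_centralizing_core:
  assumes Q: "subgroup Q G" "Q \<subseteq> T" "norm_in T Q = T" "cent_in Q \<subseteq> Q"
    and ext: "\<And>X f. \<lbrakk>M X f; P \<subseteq> X; \<And>x. x \<in> P \<Longrightarrow> f x = x\<rbrakk>
      \<Longrightarrow> \<exists>h. M (X <#> Q) h \<and> (\<forall>x \<in> X. h x = f x) \<and> h ` Q = Q"
  shows "\<exists>W. normal_in T M W \<and> P \<subseteq> W \<and> cent_in W \<subseteq> W"
proof -
  obtain W where W: "normal_in T M W" and gr: "\<And>R. normal_in T M R \<Longrightarrow> R \<subseteq> W"
    using normal_in_greatest[OF T_sub finite_T, of M] M_mult M_sub M_dom M_one by metis
  have PW: "P \<subseteq> W" using gr PN .
  have Ws: "subgroup W G" "W \<subseteq> T" using normal_in_subgroup[OF W] normal_in_subset[OF W] .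
  have WG: "W \<subseteq> carrier G" using Ws(2) T_carrier by blast
  have QG: "q \<in> carrier G" if "q \<in> Q" for q using subgroup.mem_carrier[OF Q(1) that] .
  have TG: "t \<in> carrier G" if "t \<in> T" for t using T_carrier that by blast
  have XQ: "subgroup (X <#> Q) G" "X \<subseteq> X <#> Q" "Q \<subseteq> X <#> Q" if "subgroup X G" "X \<subseteq> T" for X
    using set_mult_subgroup[OF that(1) Q(1), of T] set_mult_left set_mult_right that Q(1,3) by auto
  define A where "A = Q \<inter> C"
  have As: "subgroup A G" "A \<subseteq> C" "A \<subseteq> Q"
    using subgroups_Inter_pair[OF Q(1) C_sub] by (auto simp: A_def)
  have AT: "A \<subseteq> T" using As(2) C_T by blast
  have "normal_in C (cfus P) A"
  proof -
    have nA: "norm_in C A = C"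
    proof -
      have "c \<in> norm_in C A" if c: "c \<in> C" for c
      proof (rule norm_inI[OF sub_finite[OF AT] _ _ c])
        show "A \<subseteq> carrier G" "C \<subseteq> carrier G" using AT C_T T_carrier by blast+
        have cQ: "c \<in> norm_in T Q" using c C_T Q(3) by blast
        show "conj_by c x \<in> A" if "x \<in> A" for x
          using that norm_inD[OF cQ] conj_by_in_subgroup[OF C_sub c] by (simp add: A_def)
      qed
      then show ?thesis using norm_in_subset by blast
    qed
    have "\<exists>h. cfus P (X <#> A) h \<and> (\<forall>x \<in> X. h x = f x) \<and> h ` A = A" if f: "cfus P X f" for X f
    proof -
      note X = cfusD(1,2)[OF f]
      have XT: "X \<subseteq> T" using X(2) C_T by blast
      note XP = prod_P[OF X(1) XT]
      obtain h where h: "M (X <#> P) h" "\<And>x. x \<in> X \<Longrightarrow> h x = f x" "\<And>x. x \<in> P \<Longrightarrow> h x = x"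
        using f by (auto simp: cfus_def)
      obtain k where k: "M (X <#> P <#> Q) k" "\<And>x. x \<in> X <#> P \<Longrightarrow> k x = h x" "k ` Q = Q"
        using ext[OF h(1) XP(3) h(3)] by blast
      note XPQ = XQ[OF XP(1,4)]
      have kP: "k x = x" if "x \<in> P" for x using k(2) h(3) XP(3) that by auto
      have PXPQ: "P \<subseteq> X <#> P <#> Q" using XP(3) XPQ(2) by blast
      \<comment> \<open>\<open>k\<close> fixes \<open>Q\<close> by the choice of the extension, and
        it preserves \<open>C\<close> because it is trivial on \<open>P\<close>.\<close>
      have "k x \<in> A" if x: "x \<in> A" for x
      proof -
        have "k ` P = P" using kP by simp
        moreover have "x \<in> X <#> P <#> Q" "x \<in> C" using x As(2,3) XPQ(3) by blast+
        ultimately have "k x \<in> C" using M_cent[OF k(1) PXPQ, of x] by simp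
        moreover have "k x \<in> Q" using x As(3) k(3) by blast
        ultimately show ?thesis by (simp add: A_def)
      qed
      then have "k ` A \<subseteq> A" by blast
      moreover have "card (k ` A) = card A" using M_card[OF k(1)] As(3) XPQ(3) by blast
      ultimately have kA: "k ` A = A" using card_subset_eq sub_finite[OF AT] by blast
      have XA: "subgroup (X <#> A) G" using set_mult_subgroup[OF X(1) As(1), of C] nA X(2) by simp
      have XAC: "X <#> A \<subseteq> C" using set_mult_least[OF C_sub X(2) As(2)] .
      have "X <#> A \<subseteq> X <#> P <#> Q" using mono_set_mult XP(2) As(3) by blast
      then have "cfus P (X <#> A) k" using cfusI[OF XA XAC k(1) _ PXPQ] kP by simp
      moreover have "k x = f x" if "x \<in> X" for x using k(2) h(2) XP(2) that by auto
      ultimately show ?thesis using kA by blast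
    qed
    then show ?thesis using As nA by (simp add: normal_in_def)
  qed
  then obtain B where "normal_in T M B" "A \<subseteq> B" using normal_cfus_core by blast
  then have AW: "A \<subseteq> W" using gr by blast
  have CQW: "c \<in> W" if "c \<in> Q" "c \<in> cent_in W" for c
    using that AW cent_in_antimono[OF PW] by (auto simp: A_def)
  define D where "D = cent_in W"
  have D: "subgroup D G" "D \<subseteq> T" "norm_in T D = T"
    using cent_in_subgroup[OF WG] cent_in_subset norm_in_cent[OF Ws(2) normal_in_norm[OF W]]
    by (auto simp: D_def)
  have wc: "f ` D = D" if f: "M D f" for f
  proof -
    obtain h where h: "M (D <#> W) h" "\<And>x. x \<in> D \<Longrightarrow> h x = f x" "h ` W = W"
      using normal_in_extend[OF W f] by metis
    have DW: "D \<subseteq> D <#> W" "W \<subseteq> D <#> W" using set_mult_left set_mult_right D(1) Ws(1) by blast+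
    have "f x \<in> D" if "x \<in> D" for x
      using M_cent[OF h(1) DW(2), of x] h(2,3) DW(1) that by (auto simp: D_def)
    then have "f ` D \<subseteq> D" by blast
    then show ?thesis using card_subset_eq[OF sub_finite[OF D(2)]] M_card[OF f] by blast
  qed
  have "normal_in T M D"
  proof (rule normal_criterion[OF sat W D wc])
    fix X assume X: "subgroup X G" "X \<subseteq> T" "W \<subseteq> X"
    have XG: "x \<in> carrier G" if "x \<in> X" for x using subgroup.mem_carrier[OF X(1) that] .
    define K where "K = {k \<in> Aut X. \<forall>w \<in> W. k w = w}"
    have KA: "K \<subseteq> Aut X" by (auto simp: K_def)
    have "K \<lhd> AutG X \<and> (\<exists>n. card K = p ^ n)"
    proof (rule Aut_p_normal[OF X(1,2) KA], goal_cases)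
      case 1
      then show ?case using Aut_restrict[OF M_id[OF X(1,2)]] X(3) by (auto simp: K_def)
    next
      case (2 k)
      then have k: "k \<in> Aut X" "\<And>w. w \<in> W \<Longrightarrow> k w = w" by (auto simp: K_def)
      have "(inv\<^bsub>AutG X\<^esub> k) w = w" if "w \<in> W" for w
        using AutG_inv(2)[OF X(1,2) k(1), of w] k(2)[OF that] X(3) that by auto
      then show ?case using AutG_inv_closed[OF X(1,2) k(1)] by (simp add: K_def)
    next
      case (3 k l)
      then show ?case using AutG_m_closed[OF X(1,2)] AutG_mult[of k X l] X(3) by (auto simp: K_def)
    next
      case (4 a k)
      then have a: "a \<in> Aut X" and k: "k \<in> Aut X" "\<And>w. w \<in> W \<Longrightarrow> k w = w" by (auto simp: K_def)
      let ?i = "inv\<^bsub>AutG X\<^esub> a"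
      have iA: "?i \<in> Aut X" using AutG_inv_closed[OF X(1,2) a] .
      have iM: "M X ?i" using iA by (rule AutD(1))
      have iW: "?i ` W = W" by (rule normal_in_stable[where H = M, OF W iM X(3,1)])
      have "(a \<otimes>\<^bsub>AutG X\<^esub> k \<otimes>\<^bsub>AutG X\<^esub> ?i) w = w" if w: "w \<in> W" for w
      proof -
        have wX: "w \<in> X" using w X(3) by blast
        have "?i w \<in> ?i ` W" using w by (rule imageI)
        then have "?i w \<in> W" by (simp only: iW)
        then have "k (?i w) = ?i w" by (rule k(2))
        then show ?thesis
          unfolding Aut_conj_apply[OF X(1,2) a k(1) wX] by (simp only: AutG_inv(3)[OF X(1,2) a wX])
      qed
      then show ?case
        using AutG_m_closed[OF X(1,2) AutG_m_closed[OF X(1,2) a k(1)] iA] by (simp add: K_def)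
    next
      case (5 k)
      then have k: "k \<in> Aut X" "\<And>w. w \<in> W \<Longrightarrow> k w = w" by (auto simp: K_def)
      obtain m where m: "\<And>c. c \<in> T \<Longrightarrow> c [^] (p ^ m) = \<one>" using T_exponent by blast
      note XQ = XQ[OF X(1,2)]
      obtain h where h: "M (X <#> Q) h" "\<And>x. x \<in> X \<Longrightarrow> h x = k x" "h ` Q = Q"
        using ext[OF AutD(1)[OF k(1)]] PW X(3) k(2) by blast
      have hX: "h ` X = X" using h(2) AutD(2)[OF k(1)] by simp
      have him: "h ` (X <#> Q) = X <#> Q" using M_set_mult_img[OF h(1) X(1) Q(1)] hX h(3) by simp
      have hW: "h w = w" if "w \<in> W" for w using h(2) k(2) X(3) that by auto
      let ?d = "h ^^ (p ^ m)"
      have d: "M (X <#> Q) ?d" "?d ` (X <#> Q) = X <#> Q" using M_funpow[OF h(1) him] by auto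
      have dQ: "?d q = q" if q: "q \<in> Q" for q
      proof -
        define c where "c = inv q \<otimes> h q"
        have hq: "h q \<in> Q" using h(3) q by blast
        have cQ: "c \<in> Q" unfolding c_def using subgroup.m_closed[OF Q(1) subgroup.m_inv_closed[OF Q(1) q] hq] .
        \<comment> \<open>As \<open>h\<close> is trivial on the normal subgroup \<open>W\<close>,
          the elements \<open>q\<close> and \<open>h q\<close> induce the same conjugation on
          \<open>W\<close>; their quotient \<open>c\<close> centralizes \<open>W\<close> and is then
          fixed by \<open>h\<close>.\<close>
        have "conj_by c w = w" if w: "w \<in> W" for w
        proof -
          have wG: "w \<in> carrier G" using w WG by blast
          have qw: "conj_by q w \<in> W" using normal_in_conj[OF W _ w] q Q(2) by blast
          have "conj_by q w = h (conj_by q w)" using hW[OF qw] by simp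
          also have "\<dots> = conj_by (h q) w"
            using M_conj_by[OF h(1), of q w] hW[OF w] q w XQ X(3) by auto
          finally have "conj_by (inv q) (conj_by (h q) w) = w" using conj_by_inv1[OF QG[OF q] wG] by simp
          then show ?thesis using QG[OF q] QG[OF hq] wG by (simp add: c_def conj_by_comp)
        qed
        then have "c \<in> cent_in W" using cQ Q(2) by (auto simp: cent_in_def)
        then have "h c = c" using CQW[OF cQ] hW by blast
        moreover have "h q = q \<otimes> c" using QG[OF q] QG[OF hq] by (simp add: c_def m_assoc[symmetric])
        ultimately have "?d q = q \<otimes> c [^] (p ^ m)"
          using M_shift[OF h(1) _ _ _ _ , of q c] him XQ(3) q cQ by blast
        then show ?thesis using m[of c] cQ Q(2) QG[OF q] by auto
      qed
      have "(?d ^^ (p ^ m)) x = x" if x: "x \<in> X" for x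
      proof -
        have xXQ: "x \<in> X <#> Q" using x XQ(2) by blast
        define c where "c = inv x \<otimes> ?d x"
        have dx: "?d x \<in> X <#> Q" using d(2) xXQ by blast
        have dxT: "?d x \<in> T" using M_dom[OF d(1)] dx by blast
        have xT: "x \<in> T" using x X(2) by blast
        have cT: "c \<in> T"
          unfolding c_def using subgroup.m_closed[OF T_sub subgroup.m_inv_closed[OF T_sub xT] dxT] .
        \<comment> \<open>The same comparison with \<open>Q\<close> in place of \<open>W\<close>:
          \<open>?d\<close> is trivial on \<open>Q\<close>, so \<open>x\<close> and
          \<open>?d x\<close> act on \<open>Q\<close> in the same way.\<close>
        have "conj_by c q = q" if q: "q \<in> Q" for q
        proof -
          have "x \<in> norm_in T Q" using xT Q(3) by simp
          then have xq: "conj_by x q \<in> Q" using norm_inD q by blast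
          have "conj_by x q = ?d (conj_by x q)" using dQ[OF xq] by simp
          also have "\<dots> = conj_by (?d x) q"
            using M_conj_by[OF d(1) xXQ, of q] dQ[OF q] q XQ(3) by auto
          finally have "conj_by (inv x) (conj_by (?d x) q) = q"
            using conj_by_inv1[OF TG[OF xT] QG[OF q]] by simp
          then show ?thesis using TG[OF xT] TG[OF dxT] QG[OF q] by (simp add: c_def conj_by_comp)
        qed
        then have cQ: "c \<in> Q" using cT Q(4) by (auto simp: cent_in_def)
        have "?d x = x \<otimes> c" using TG[OF xT] TG[OF dxT] by (simp add: c_def m_assoc[symmetric])
        then have "(?d ^^ (p ^ m)) x = x \<otimes> c [^] (p ^ m)"
          using M_shift[OF d(1) _ xXQ _ _ dQ[OF cQ]] d(2) cQ XQ(3) by blast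
        then show ?thesis using m[OF cT] TG[OF xT] by simp
      qed
      then have hx: "(h ^^ (p ^ (m + m))) x = x" if "x \<in> X" for x
        using that by (simp add: funpow_mult power_add)
      have "(k ^^ n) x = (h ^^ n) x \<and> (h ^^ n) x \<in> X" if "x \<in> X" for n x
        using that h(2) hX by (induction n) auto
      then show ?case using hx by metis
    qed
    moreover have "restrict (conj_by b) X \<in> K" if "b \<in> D" "b \<in> norm_in T X" for b
      using norm_in_restrict_Aut[OF X(1,2) that(2)] that(1) X(3) by (auto simp: K_def D_def cent_in_def)
    ultimately show "\<exists>K n. K \<lhd> AutG X \<and> card K = p ^ n \<and> (\<forall>b \<in> D. b \<in> norm_in T X \<longrightarrow> restrict (conj_by b) X \<in> K)"
      by blast
  qed
  then have "D \<subseteq> W" using gr by blast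
  then show ?thesis using W PW by (auto simp: D_def)
qed

end

section \<open>Consequences of largeness\<close>

context fus
begin

lemma central_element_T:
  assumes Y: "subgroup Y G" "Y \<subseteq> T" and N: "subgroup N G" "N \<subseteq> Y" "N \<noteq> {\<one>}"
    and nrm: "\<And>y x. y \<in> Y \<Longrightarrow> x \<in> N \<Longrightarrow> conj_by y x \<in> N"
  shows "\<exists>z \<in> N. z \<noteq> \<one> \<and> (\<forall>y \<in> Y. conj_by z y = y)"
proof -
  let ?Y = "G\<lparr>carrier := Y\<rparr>"
  interpret Y: group ?Y by (rule subgroup_imp_group[OF Y(1)])
  obtain n where n: "card Y = p ^ n" using sub_p_power[OF Y] by blast
  have N': "subgroup N ?Y" using subgroup_incl[OF N(1) Y(1) N(2)] .
  have "y \<otimes>\<^bsub>?Y\<^esub> x \<otimes>\<^bsub>?Y\<^esub> inv\<^bsub>?Y\<^esub> y \<in> N" if "y \<in> Y" "x \<in> N" for y x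
    using nrm[OF that] m_inv_consistent[OF Y(1) that(1)] by (simp add: conj_by_def)
  then obtain z where z: "z \<in> N" "z \<noteq> \<one>" "\<forall>y \<in> Y. y \<otimes> z = z \<otimes> y"
    using Y.central_element[OF prime_p _ _ N', of Y n] Y.subgroup_self sub_finite[OF Y(2)] n N(2,3) by auto
  have "conj_by z y = y" if y: "y \<in> Y" for y
    using z y N(2) Y(2) T_carrier conj_by_commute[of z y] by (metis subsetD)
  then show ?thesis using z by blast
qed

end

text \<open>Subgroups of \<open>Z(Q)\<close> are given as subgroups of both \<open>Q\<close> and
  \<open>cent_in Q\<close>. The inclusion of normalizers is assumed in predicate form.\<close>

locale fus_large = fus p G T M
  for p :: nat and G :: "('a, 'b) monoid_scheme" (structure) and T M +
  fixes Q :: "'a set"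
  assumes sat: saturated_M
    and Q_sub: "subgroup Q G" and Q_T: "Q \<subseteq> T" and Q_cent: "cent_in Q \<subseteq> Q"
    and Q_large: "\<lbrakk>subgroup U G; U \<subseteq> Q; U \<subseteq> cent_in Q; U \<noteq> {\<one>}; nfus U X f\<rbrakk> \<Longrightarrow> nfus Q X f"
begin

text \<open>An automorphism of \<open>R \<ge> Q\<close> normalizes \<open>Z(R) \<le> Z(Q)\<close>, hence \<open>Q\<close>.\<close>

lemma large_invariant:
  assumes "M R f" "Q \<subseteq> R"
  shows "f ` Q = Q"
proof (cases "Q = {\<one>}")
  case True
  then show ?thesis using M_one[OF assms(1)] by simp
next
  case False
  define C where "C = {R. subgroup R G \<and> R \<subseteq> T \<and> Q \<subseteq> R}"
  have "R \<in> C" using assms M_sub M_dom by (auto simp: C_def)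
  then show ?thesis
  proof (rule alperin_induct[where Good = "\<lambda>R f. f ` Q = Q", OF sat, rotated 5])
    show "M R f" by fact
    fix X Y f h
    assume *: "f ` Q = Q" "X \<in> C" "X \<subseteq> Y" "M Y f" "M X h" "\<And>x. x \<in> X \<Longrightarrow> h x = f x"
    then have "h ` Q = f ` Q" by (intro image_cong) (auto simp: C_def)
    then show "h ` Q = Q" using *(1) by simp
  next
    fix X f h assume "f ` Q = Q" "h ` Q = Q"
    then show "(h \<circ> f) ` Q = Q" by (simp only: image_comp[symmetric])
  next
    fix X f assume *: "X \<in> C" "M X f" "f ` Q = Q"
    have "f ` Q \<subseteq> f ` X" using *(1) by (auto simp: C_def)
    then show "f ` X \<in> C" using M_img_sub[OF *(2)] M_img[OF *(2)] *(3) by (simp add: C_def)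
  next
    fix X Y assume "X \<in> C" "X \<subseteq> Y" "subgroup Y G" "Y \<subseteq> T"
    then show "Y \<in> C" by (auto simp: C_def)
  next
    fix X a assume *: "X \<in> C" "M X a" "a ` X = X"
    have X: "subgroup X G" "X \<subseteq> T" "Q \<subseteq> X" using *(1) by (auto simp: C_def)
    have XG: "X \<subseteq> carrier G" using X(2) T_carrier by blast
    define Z where "Z = X \<inter> cent_in X"
    have Z: "subgroup Z G" using subgroups_Inter_pair[OF X(1) cent_in_subgroup[OF XG]] by (simp add: Z_def)
    have ZX: "Z \<subseteq> X" by (auto simp: Z_def)
    have ZT: "Z \<subseteq> T" using ZX X(2) by blast
    have Zc: "Z \<subseteq> cent_in Q" using cent_in_antimono[OF X(3)] by (auto simp: Z_def)
    have ZQ: "Z \<subseteq> Q" using Zc Q_cent by blast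
    \<comment> \<open>A trivial \<open>Q\<close> was split off so that every \<open>X\<close>
      containing \<open>Q\<close> is non-trivial and thus has a non-trivial centre.\<close>
    have "X \<noteq> {\<one>}" using X(3) False subgroup.one_closed[OF Q_sub] by auto
    then obtain z where z: "z \<in> X" "z \<noteq> \<one>" "\<forall>y \<in> X. conj_by z y = y"
      using central_element_T[OF X(1,2) X(1) _ _ conj_by_in_subgroup[OF X(1)]] by blast
    have "z \<in> Z" using z(1,3) X(2) by (auto simp: Z_def cent_in_def)
    then have Z1: "Z \<noteq> {\<one>}" using z(2) by auto
    have XN: "X \<subseteq> norm_in T Z"
    proof
      fix x assume x: "x \<in> X"
      show "x \<in> norm_in T Z"
      proof (rule norm_inI[OF sub_finite[OF ZT] _ T_carrier])
        show "Z \<subseteq> carrier G" using ZT T_carrier by blast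
        show "x \<in> T" using x X(2) by blast
        show "conj_by x y \<in> Z" if "y \<in> Z" for y
          using cent_in_swap[OF XG _ x, of y] that by (simp add: Z_def)
      qed
    qed
    have "a x \<in> Z" if "x \<in> Z" for x
      using M_cent[OF *(2) order_refl, of x] that *(3) by (auto simp: Z_def)
    then have "a ` Z \<subseteq> Z" by blast
    then have aZ: "a ` Z = Z" using card_subset_eq[OF sub_finite[OF ZT]] M_card[OF *(2) ZX] by blast
    have "nfus Z X a" by (rule nfusI[OF Z ZT X(1) XN *(2) order_refl ZX aZ]) simp
    then have "nfus Q X a" by (rule Q_large[OF Z ZQ Zc Z1])
    then obtain h where h: "\<forall>x \<in> X. h x = a x" "h ` Q = Q" by (auto simp: nfus_def)
    then have "h ` Q = a ` Q" using X(3) by (intro image_cong) auto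
    then show "a ` Q = Q" using h(2) by simp
  qed
qed

lemma Q_norm: "norm_in T Q = T"
  using large_invariant[OF M_conj[OF Q_sub Q_T] order_refl] by (auto simp: norm_in_def)

text \<open>\<open>Q\<close> and \<open>cent_in Q\<close> are normal in \<open>T\<close>, so
  everything that normalizes \<open>P\<close> also normalizes \<open>P \<inter> Z(Q)\<close>. This
  last property is what places morphisms of the normalizer of \<open>P\<close> that are trivial on
  \<open>P\<close> into the normalizer of \<open>U\<close>.\<close>

lemma large_meets_center:
  assumes P: "subgroup P G" "P \<subseteq> T" "P \<noteq> {\<one>}" "Q \<subseteq> norm_in T P"
  shows "\<exists>U. subgroup U G \<and> U \<subseteq> P \<and> U \<subseteq> Q \<and> U \<subseteq> cent_in Q \<and> U \<noteq> {\<one>} \<and> norm_in T P \<subseteq> norm_in T U"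
proof -
  have TG: "t \<in> carrier G" if "t \<in> T" for t using T_carrier that by blast
  have QG: "Q \<subseteq> carrier G" using Q_T T_carrier by blast
  note cs = cent_in_subgroup[OF QG]
  have PQ: "subgroup (P \<inter> Q) G" by (rule subgroups_Inter_pair[OF P(1) Q_sub])
  have TQ: "conj_by t q \<in> Q" if "t \<in> T" "q \<in> Q" for t q using Q_norm norm_inD that by metis
  have QP: "conj_by q x \<in> P" if "q \<in> Q" "x \<in> P" for q x using P(4) norm_inD that by blast
  have PQ1: "P \<inter> Q \<noteq> {\<one>}"
  proof
    assume 1: "P \<inter> Q = {\<one>}"
    have "x \<in> cent_in Q" if x: "x \<in> P" for x
    proof -
      have xT: "x \<in> T" using x P(2) by blast
      have "conj_by x q = q" if q: "q \<in> Q" for q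
      proof -
        have qG: "q \<in> carrier G" using q QG by blast
        \<comment> \<open>The commutator of \<open>x\<close> and \<open>q\<close> is bracketed in
          two ways, once to see it in \<open>Q\<close> and once to see it in
          \<open>P\<close>.\<close>
        have "conj_by x q \<otimes> inv q \<in> Q"
          using TQ[OF xT q] subgroup.m_closed[OF Q_sub] subgroup.m_inv_closed[OF Q_sub q] by blast
        moreover have "x \<otimes> conj_by q (inv x) \<in> P"
          using subgroup.m_closed[OF P(1) x] QP[OF q subgroup.m_inv_closed[OF P(1) x]] by blast
        moreover have "x \<otimes> conj_by q (inv x) = conj_by x q \<otimes> inv q"
          using TG[OF xT] qG by (simp add: conj_by_def m_assoc)
        ultimately have "conj_by x q \<otimes> inv q = \<one>" using 1 by auto
        then show ?thesis using TG[OF xT] qG by (metis conj_by_closed inv_closed inv_equality inv_inv)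
      qed
      then show ?thesis using xT by (simp add: cent_in_def)
    qed
    then have "P \<subseteq> Q" using Q_cent by blast
    then show False using 1 P(3) by auto
  qed
  have nPQ: "conj_by q x \<in> P \<inter> Q" if "q \<in> Q" "x \<in> P \<inter> Q" for q x
    using QP TQ Q_T that by blast
  obtain z where z: "z \<in> P \<inter> Q" "z \<noteq> \<one>" "\<forall>y \<in> Q. conj_by z y = y"
    using central_element_T[OF Q_sub Q_T PQ _ PQ1 nPQ] by blast
  define U where "U = P \<inter> Q \<inter> cent_in Q"
  have "subgroup U G" unfolding U_def by (rule subgroups_Inter_pair[OF PQ cs])
  moreover have "z \<in> U" using z Q_T by (auto simp: U_def cent_in_def)
  moreover have "norm_in T P \<subseteq> norm_in T U"
  proof
    fix x assume x: "x \<in> norm_in T P"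
    then have xT: "x \<in> T" using norm_in_subset by blast
    have xc: "x \<in> norm_in T (cent_in Q)" using norm_in_cent[OF Q_T Q_norm] xT by simp
    have UT: "U \<subseteq> T" using Q_T by (auto simp: U_def)
    show "x \<in> norm_in T U"
    proof (rule norm_inI[OF sub_finite[OF UT] _ T_carrier xT])
      show "U \<subseteq> carrier G" using UT T_carrier by blast
      show "conj_by x y \<in> U" if "y \<in> U" for y
        using that norm_inD[OF x] norm_inD[OF xc] TQ[OF xT] by (simp add: U_def)
    qed
  qed
  ultimately show ?thesis using z(2) by (intro exI[of _ U]) (auto simp: U_def)
qed

lemma nfus_normal: "subgroup P G \<Longrightarrow> P \<subseteq> T \<Longrightarrow> normal_in (norm_in T P) (nfus P) P"
  unfolding normal_in_def
proof (intro conjI allI impI)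
  assume P: "subgroup P G" "P \<subseteq> T"
  show "subgroup P G" by fact
  show "P \<subseteq> norm_in T P" by (rule subgroup_in_norm_in[OF P])
  show "norm_in (norm_in T P) P = norm_in T P" by (auto simp: norm_in_def)
  fix X f assume "nfus P X f"
  then obtain h where h: "M (X <#> P) h" "\<forall>x \<in> X. h x = f x" "h ` P = P"
    and X: "subgroup X G" "X \<subseteq> norm_in T P" by (auto simp: nfus_def)
  note XP = norm_prod[OF P X]
  have "nfus P (X <#> P) h" by (rule nfusI[OF P XP(1,2) h(1) order_refl XP(5) h(3)]) simp
  then show "\<exists>h. nfus P (X <#> P) h \<and> (\<forall>x \<in> X. h x = f x) \<and> h ` P = P" using h by blast
qed

text \<open>Largeness supplies the extension over \<open>Q\<close> that is required for morphisms
  trivial on \<open>P\<close>. For a conjugate of \<open>W\<close> under \<open>f\<close>, the map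
  \<open>k\<close> from \<open>FN\<close> makes \<open>k \<circ> f\<close> a morphism of the
  normalizer of \<open>P\<close>, which fixes \<open>W\<close>; the centralizer of the conjugate
  lies in the domain of \<open>k\<close>, as it centralizes the image of \<open>P\<close>.\<close>

theorem normalizer_core:
  assumes P: "subgroup P G" "P \<subseteq> T" "P \<noteq> {\<one>}" "Q \<subseteq> norm_in T P"
    and FN: "\<And>f. M P f \<Longrightarrow> \<exists>h. M (norm_in T (f ` P)) h \<and> h ` f ` P = P"
  shows "\<exists>W. normal_in (norm_in T P) (nfus P) W \<and> (\<forall>f. M W f \<longrightarrow> cent_in (f ` W) \<subseteq> f ` W)"
proof -
  define N where "N = norm_in T P"
  interpret E: fus p G N "nfus P" unfolding N_def by (rule nfus_fus[OF P(1,2)])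
  have satE: "E.saturated_M" unfolding N_def by (rule nfus_saturated[OF sat P(1,2) FN])
  interpret E: fus_normal p G N "nfus P" P
    using nfus_normal[OF P(1,2)] satE by unfold_locales (auto simp: N_def)
  have NT: "N \<subseteq> T" by (simp add: N_def norm_in_subset)
  have QN: "Q \<subseteq> N" using P(4) by (simp add: N_def)
  have E_cent: "E.cent_in Z = N \<inter> cent_in Z" for Z
    using NT by (auto simp: E.cent_in_def cent_in_def)
  obtain U where U: "subgroup U G" "U \<subseteq> P" "U \<subseteq> Q" "U \<subseteq> cent_in Q" "U \<noteq> {\<one>}" "N \<subseteq> norm_in T U"
    using large_meets_center[OF P] by (auto simp: N_def)
  have UT: "U \<subseteq> T" using U(3) Q_T by blast
  have "\<exists>W. normal_in N (nfus P) W \<and> P \<subseteq> W \<and> E.cent_in W \<subseteq> W"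
  proof (rule E.self_centralizing_core[OF Q_sub QN])
    show "norm_in N Q = N" using Q_norm NT by (auto simp: norm_in_def)
    show "E.cent_in Q \<subseteq> Q" using Q_cent by (auto simp: E_cent)
    fix X f assume f: "nfus P X f" "P \<subseteq> X" "\<And>x. x \<in> P \<Longrightarrow> f x = x"
    have X: "subgroup X G" "X \<subseteq> N" using E.M_sub[OF f(1)] E.M_dom[OF f(1)] .
    have Mf: "M X f" by (rule nfus_M[OF P(1) f(1)])
    have XU: "X \<subseteq> norm_in T U" "U \<subseteq> X" using X(2) U(2,6) f(2) by blast+
    have fU: "f ` U = U" using f(3) U(2) by force
    have "nfus U X f" by (rule nfusI[OF U(1) UT X(1) XU(1) Mf order_refl XU(2) fU]) simp
    then have "nfus Q X f" by (rule Q_large[OF U(1,3,4,5)])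
    then obtain h where h: "M (X <#> Q) h" "\<forall>x \<in> X. h x = f x" "h ` Q = Q" by (auto simp: nfus_def)
    have XQ: "X \<subseteq> X <#> Q" "X <#> Q \<subseteq> N"
      using set_mult_left[OF X(1) Q_sub] set_mult_least[OF E.T_sub X(2) QN] .
    have PXQ: "P \<subseteq> X <#> Q" using XQ(1) f(2) by blast
    have "h ` P = P" using h(2) f(2,3) by force
    then have "nfus P (X <#> Q) h"
      using nfusI[OF P(1,2) M_sub[OF h(1)] _ h(1) order_refl PXQ] XQ(2) by (simp add: N_def)
    then show "\<exists>h. nfus P (X <#> Q) h \<and> (\<forall>x \<in> X. h x = f x) \<and> h ` Q = Q" using h by blast
  qed
  then obtain W where W: "normal_in N (nfus P) W" "P \<subseteq> W" "E.cent_in W \<subseteq> W" by blast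
  have Ws: "subgroup W G" "W \<subseteq> N" using normal_in_subgroup[OF W(1)] normal_in_subset[OF W(1)] .
  \<comment> \<open>Elements centralizing \<open>W\<close> centralize \<open>P\<close> and so lie in
    \<open>N\<close>; the centralizers of \<open>W\<close> in \<open>T\<close> and in
    \<open>N\<close> coincide.\<close>
  have cW: "cent_in W \<subseteq> W"
  proof -
    have "cent_in W \<subseteq> N" using cent_in_antimono[OF W(2)] cent_in_norm by (auto simp: N_def)
    then show ?thesis using W(3) by (auto simp: E_cent)
  qed
  have "cent_in (f ` W) \<subseteq> f ` W" if f: "M W f" for f
  proof
    fix c assume c: "c \<in> cent_in (f ` W)"
    have MP: "M P f" using M_res[OF f P(1) W(2)] by simp
    obtain k where k: "M (norm_in T (f ` P)) k" "k ` f ` P = P" using FN[OF MP] by blast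
    have fWN: "f ` W \<subseteq> norm_in T (f ` P)"
      using M_norm[OF f W(2)] Ws(2) by (auto simp: N_def)
    have Mkf: "M W (k \<circ> f)" using M_comp[OF f k(1) fWN] .
    have kfP: "(k \<circ> f) ` P = P" using k(2) by (simp only: image_comp[symmetric])
    have "nfus P W (k \<circ> f)"
      by (rule nfusI[OF P(1,2) Ws(1) Ws(2)[unfolded N_def] Mkf order_refl W(2) kfP]) simp
    then have "(k \<circ> f) ` W = W" using normal_in_stable[OF W(1) _ order_refl Ws(1)] by blast
    then have kfW: "k ` f ` W = W" by (simp only: image_comp[symmetric])
    have "f ` P \<subseteq> f ` W" using W(2) by blast
    then have cN: "c \<in> norm_in T (f ` P)" using cent_in_antimono c cent_in_norm by blast
    have "k c \<in> cent_in (k ` f ` W)" using M_cent[OF k(1) fWN cN c] .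
    then have "k c \<in> k ` f ` W" using kfW cW by auto
    then show "c \<in> f ` W"
      using inj_on_image_mem_iff[OF M_inj[OF k(1)] cN fWN] by simp
  qed
  then show ?thesis using W(1) by (auto simp: N_def)
qed

end

section \<open>Translation to fusion systems given by morphism sets\<close>

context fus
begin

abbreviation "GT \<equiv> G\<lparr>carrier := T\<rparr>"

text \<open>Back to morphism sets, where functions are extensional and a codomain is
  recorded.\<close>

definition homs :: "'a hom_sets" where
  "homs X Y = {f \<in> extensional X. M X f \<and> f ` X \<subseteq> Y \<and> subgroup Y G \<and> Y \<subseteq> T}"

lemma GT_group: "group GT"
  by (rule subgroup_imp_group[OF T_sub])

lemma GT_inv: "t \<in> T \<Longrightarrow> inv\<^bsub>GT\<^esub> t = inv t"
  by (rule m_inv_consistent[OF T_sub])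

lemma GT_subgroup: "subgroup X GT \<longleftrightarrow> subgroup X G \<and> X \<subseteq> T"
  using subgroup_incl[OF _ T_sub] incl_subgroup[OF T_sub] subgroup.subset[of X GT] by auto

lemma GT_conj_map: "t \<in> T \<Longrightarrow> conj_map GT t X = restrict (conj_by t) X"
  by (auto simp: conj_map_def conj_by_def GT_inv fun_eq_iff)

lemma GT_normalizer:
  assumes "X \<subseteq> T" shows "normalizer GT X = norm_in T X"
proof -
  have "g <#\<^bsub>GT\<^esub> X #>\<^bsub>GT\<^esub> inv\<^bsub>GT\<^esub> g = conj_by g ` X" if "g \<in> T" for g
    using that by (auto simp: l_coset_def r_coset_def conj_by_def GT_inv)
  then show ?thesis using assms by (auto simp: normalizer_def stabilizer_def norm_in_def)
qed

lemma homs_restrict: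
  "M X f \<Longrightarrow> f ` X \<subseteq> Y \<Longrightarrow> subgroup Y G \<Longrightarrow> Y \<subseteq> T \<Longrightarrow> restrict f X \<in> homs X Y"
  using M_restrict by (auto simp: homs_def)

lemma homs_restrict_T: "M X f \<Longrightarrow> restrict f X \<in> homs X T"
  using homs_restrict M_img T_sub by blast

lemma homs_M: "f \<in> homs X Y \<Longrightarrow> M X f"
  by (simp add: homs_def)

lemma homs_fusion_system: "fusion_system p GT homs"
proof -
  have "finite_p_group p GT"
    using GT_group prime_p T_card by (simp add: finite_p_group_def finite_p_group_axioms_def)
  moreover have "fusion_system_axioms GT homs"
  proof (rule fusion_system_axioms.intro)
    fix f X Y assume f: "f \<in> homs X Y"
    then have f': "f \<in> extensional X" "M X f" "f ` X \<subseteq> Y" "subgroup Y G" "Y \<subseteq> T" by (auto simp: homs_def)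
    show "subgroup X GT \<and> subgroup Y GT"
      using f' M_sub M_dom by (auto simp: GT_subgroup)
    show "f \<in> mon (GT\<lparr>carrier := X\<rparr>) (GT\<lparr>carrier := Y\<rparr>) \<inter> extensional X"
      using f' M_mult M_inj by (auto simp: mon_def hom_def)
    show "f \<in> homs X (f ` X)"
      using f' M_img_sub M_img by (auto simp: homs_def)
    have "inv_into X f ` f ` X \<subseteq> X" using M_inv_img[OF f'(2)] by simp
    then show "restrict (inv_into X f) (f ` X) \<in> homs (f ` X) X"
      using homs_restrict[OF M_inv[OF f'(2)]] M_sub[OF f'(2)] M_dom[OF f'(2)] by blast
    show "compose X g f \<in> homs X Z" if g: "g \<in> homs Y Z" for g Z
    proof -
      have g': "M Y g" "g ` Y \<subseteq> Z" "subgroup Z G" "Z \<subseteq> T" using g by (auto simp: homs_def)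
      have "(g \<circ> f) ` X \<subseteq> Z" using f'(3) g'(2) by auto
      then have "restrict (g \<circ> f) X \<in> homs X Z"
        using homs_restrict[OF M_comp[OF f'(2) g'(1) f'(3)]] g' by blast
      then show ?thesis by (simp add: compose_def o_def)
    qed
  next
    fix X Y g
    assume "subgroup X GT" "subgroup Y GT" "g \<in> carrier GT" "conj_map GT g X ` X \<subseteq> Y"
    then have *: "subgroup X G" "X \<subseteq> T" "subgroup Y G" "Y \<subseteq> T" "g \<in> T" "conj_by g ` X \<subseteq> Y"
      by (auto simp: GT_subgroup GT_conj_map)
    then show "conj_map GT g X \<in> homs X Y"
      using homs_restrict[OF M_conj] by (simp add: GT_conj_map)
  qed
  ultimately show ?thesis by (simp add: fusion_system_def)
qed

lemma homs_self: "X \<subseteq> T \<Longrightarrow> subgroup X G \<Longrightarrow> homs X X = Aut X"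
proof -
  assume X: "X \<subseteq> T" "subgroup X G"
  have "f ` X = X" if "M X f" "f ` X \<subseteq> X" for f
    using card_subset_eq[OF sub_finite[OF X(1)] that(2)] M_card[OF that(1)] by blast
  then show ?thesis using X by (auto simp: homs_def Aut_def)
qed

lemma homs_fully_automized:
  assumes X: "subgroup X G" "X \<subseteq> T"
  shows "fully_automized p GT homs X \<longleftrightarrow> fully_aut X"
proof -
  have "inner_aut GT X = Aut_inner X"
    using X(2) norm_in_subset[of T X]
    by (force simp: inner_aut_def Aut_inner_def GT_normalizer GT_conj_map)
  then show ?thesis
    using homs_self[OF X(2,1)] by (simp add: fully_automized_def fully_aut_def fs_aut_def AutG_def)
qed

lemma GT_N_phi:
  assumes f: "M Y f" "f ` Y = X"
  shows "N_phi GT Y X f = N_of Y f"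
proof -
  note Y = M_sub[OF f(1)] M_dom[OF f(1)]
  have XT: "X \<subseteq> T" using M_img[OF f(1)] f(2) by simp
  let ?c = "\<lambda>g. compose X (compose Y f (conj_map GT g Y)) (restrict (inv_into Y f) X)"
  have c: "?c g (f y) = f (conj_by g y)" if "g \<in> T" "y \<in> Y" for g y
    using that f(2) M_inv_f[OF f(1)] by (auto simp: compose_def GT_conj_map)
  have "?c g \<in> inner_aut GT X \<longleftrightarrow> (\<exists>t \<in> norm_in T X. \<forall>y \<in> Y. f (conj_by g y) = conj_by t (f y))"
    if g: "g \<in> T" for g
  proof
    assume "?c g \<in> inner_aut GT X"
    then obtain t where t: "t \<in> norm_in T X" "?c g = restrict (conj_by t) X"
      using norm_in_subset[of T X] by (auto simp: inner_aut_def GT_normalizer[OF XT] GT_conj_map subset_eq)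
    have "f (conj_by g y) = conj_by t (f y)" if y: "y \<in> Y" for y
      using c[OF g y] fun_cong[OF t(2), of "f y"] y f(2) by auto
    then show "\<exists>t \<in> norm_in T X. \<forall>y \<in> Y. f (conj_by g y) = conj_by t (f y)" using t(1) by blast
  next
    assume "\<exists>t \<in> norm_in T X. \<forall>y \<in> Y. f (conj_by g y) = conj_by t (f y)"
    then obtain t where t: "t \<in> norm_in T X" "\<And>y. y \<in> Y \<Longrightarrow> f (conj_by g y) = conj_by t (f y)" by blast
    have tT: "t \<in> T" using t(1) norm_in_subset by blast
    have "?c g = conj_map GT t X"
    proof (rule extensionalityI[where A = X])
      show "?c g \<in> extensional X" by simp
      show "conj_map GT t X \<in> extensional X" by (simp add: conj_map_def)
      fix x assume "x \<in> X"
      then obtain y where y: "y \<in> Y" "x = f y" using f(2) by blast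
      then show "?c g x = conj_map GT t X x"
        using c[OF g y(1)] t(2)[OF y(1)] f(2) tT by (auto simp: GT_conj_map)
    qed
    then show "?c g \<in> inner_aut GT X"
      using t(1) by (auto simp: inner_aut_def GT_normalizer[OF XT])
  qed
  then show ?thesis
    using f(2) norm_in_subset[of T Y] by (auto simp: N_phi_def N_of_def GT_normalizer[OF Y(2)])
qed

lemma N_of_restrict: "M Y f \<Longrightarrow> N_of Y (restrict f Y) = N_of Y f"
  using norm_inD by (fastforce simp: N_of_def)

lemma homs_receptive:
  assumes X: "subgroup X G" "X \<subseteq> T"
  shows "receptive GT homs X \<longleftrightarrow> recept X"
proof
  assume r: "receptive GT homs X"
  show "recept X" unfolding recept_def
  proof (intro allI impI)
    fix Y f assume "M Y f \<and> f ` Y = X"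
    then have f: "M Y f" "f ` Y = X" by auto
    have f': "M Y (restrict f Y)" "restrict f Y ` Y = X" using M_restrict[OF f(1)] f(2) by auto
    have "restrict f Y \<in> fs_iso homs Y X"
      using homs_restrict[OF f(1) _ X] f(2) by (simp add: fs_iso_def)
    then obtain h where h: "h \<in> homs (N_phi GT Y X (restrict f Y)) (carrier GT)"
      "\<forall>x \<in> Y. h x = restrict f Y x" using r unfolding receptive_def by blast
    then have "M (N_of Y f) h" using homs_M GT_N_phi[OF f'] N_of_restrict[OF f(1)] by metis
    then show "\<exists>h. M (N_of Y f) h \<and> (\<forall>y \<in> Y. h y = f y)" using h(2) by auto
  qed
next
  assume r: "recept X"
  show "receptive GT homs X" unfolding receptive_def
  proof (intro allI ballI)
    fix Y f assume "f \<in> fs_iso homs Y X"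
    then have f: "M Y f" "f ` Y = X" by (auto simp: fs_iso_def homs_def)
    obtain h where h: "M (N_of Y f) h" "\<forall>y \<in> Y. h y = f y" using r f unfolding recept_def by blast
    have "restrict h (N_of Y f) \<in> homs (N_of Y f) T" by (rule homs_restrict_T[OF h(1)])
    moreover have "\<forall>y \<in> Y. restrict h (N_of Y f) y = f y" using h(2) N_of_contains[OF f(1)] by auto
    ultimately show "\<exists>h \<in> homs (N_phi GT Y X f) (carrier GT). \<forall>x \<in> Y. h x = f x"
      unfolding GT_N_phi[OF f] by (intro bexI[of _ "restrict h (N_of Y f)"]) simp_all
  qed
qed

lemma GT_conjugates: "fs_conjugates GT homs X = {f ` X |f. M X f}"
proof -
  have "\<exists>g. f ` X = g ` X \<and> g \<in> homs X T" if "M X f" for f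
    using homs_restrict_T[OF that] by (intro exI[of _ "restrict f X"]) auto
  then show ?thesis using homs_M by (auto simp: fs_conjugates_def)
qed

text \<open>One direction imports the saturation of the given fusion system, the other exports that
  of the normalizer of \<open>P\<close>.\<close>

lemma homs_saturated:
  "saturated_fusion_system p GT homs \<longleftrightarrow> saturated_M"
proof -
  have "(\<exists>P \<in> fs_conjugates GT homs X. fully_automized p GT homs P \<and> receptive GT homs P)
      \<longleftrightarrow> (\<exists>f. M X f \<and> fully_aut (f ` X) \<and> recept (f ` X))" for X
    using homs_fully_automized homs_receptive M_img M_img_sub by (auto simp: GT_conjugates)
  then show ?thesis
    using homs_fusion_system
    by (simp add: saturated_fusion_system_def saturated_fusion_system_axioms_def saturated_M_def GT_subgroup)
qed

lemma homs_normalizer: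
  assumes P: "subgroup P G" "P \<subseteq> T"
  shows "fs_normalizer GT homs P = fus.homs G (norm_in T P) (nfus P)"
proof -
  interpret E: fus p G "norm_in T P" "nfus P" by (rule nfus_fus[OF P])
  have sm: "X <#>\<^bsub>GT\<^esub> P = X <#> P" for X by (simp add: set_mult_def)
  have "f \<in> fs_normalizer GT homs P X Y \<longleftrightarrow> f \<in> E.homs X Y" for f X Y
  proof
    assume "f \<in> fs_normalizer GT homs P X Y"
    then obtain h where f: "f \<in> homs X Y" "X \<subseteq> norm_in T P" "Y \<subseteq> norm_in T P"
      and h: "h \<in> homs (X <#> P) (Y <#> P)" "\<forall>x \<in> X. h x = f x" "h ` P = P"
      by (auto simp: fs_normalizer_def GT_normalizer[OF P(2)] sm)
    have "nfus P X f" using homs_M[OF h(1)] h(2,3) f(2) M_sub[OF homs_M[OF f(1)]] by (auto simp: nfus_def)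
    then show "f \<in> E.homs X Y" using f by (auto simp: E.homs_def homs_def)
  next
    assume "f \<in> E.homs X Y"
    then have f: "f \<in> extensional X" "nfus P X f" "f ` X \<subseteq> Y" "subgroup Y G" "Y \<subseteq> norm_in T P"
      by (auto simp: E.homs_def)
    then obtain h where h: "M (X <#> P) h" "\<And>x. x \<in> X \<Longrightarrow> h x = f x" "h ` P = P"
      and X: "subgroup X G" "X \<subseteq> norm_in T P" by (auto simp: nfus_def)
    note XP = norm_prod[OF P X] and YP = norm_prod[OF P f(4,5)]
    have "h ` (X <#> P) = f ` X <#> P"
      using M_set_mult_img[OF h(1) X(1) P(1)] h(2,3) by (metis image_cong)
    then have "h ` (X <#> P) \<subseteq> Y <#> P" using mono_set_mult[OF f(3) order_refl] by simp
    then have "restrict h (X <#> P) \<in> homs (X <#> P) (Y <#> P)"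
      using homs_restrict[OF h(1)] YP by blast
    moreover have "\<forall>x \<in> X. restrict h (X <#> P) x = f x" using h(2) XP(4) by auto
    moreover have "restrict h (X <#> P) ` P = h ` P" using XP(5) by (intro image_cong) auto
    ultimately have "\<exists>h \<in> homs (X <#> P) (Y <#> P). (\<forall>x \<in> X. h x = f x) \<and> h ` P = P"
      using h(3) by metis
    moreover have "Y \<subseteq> T" using f(5) norm_in_subset by blast
    then have "f \<in> homs X Y"
      using f nfus_M[OF P(1) f(2)] by (auto simp: homs_def)
    ultimately show "f \<in> fs_normalizer GT homs P X Y"
      using X(2) f(5) by (simp add: fs_normalizer_def GT_normalizer[OF P(2)] sm)
  qed
  then show ?thesis by (intro ext) auto
qed

text \<open>Equality of the underlying groups means that \<open>R\<close> is normal in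
  \<open>T\<close>. Given this, equality of the morphism sets reduces to one inclusion, since
  morphisms of the normalizer are morphisms of the whole system.\<close>

lemma fs_normal_iff: "fs_normal GT homs R \<longleftrightarrow> normal_in T M R"
proof (cases "subgroup R G \<and> R \<subseteq> T")
  case True
  then have R: "subgroup R G" "R \<subseteq> T" by auto
  have "GT = normalizer_group GT R \<longleftrightarrow> norm_in T R = T"
  proof
    assume "GT = normalizer_group GT R"
    then have "carrier GT = carrier (normalizer_group GT R)" by (rule arg_cong)
    then show "norm_in T R = T" by (simp add: GT_normalizer[OF R(2)])
  next
    assume "norm_in T R = T"
    then show "GT = normalizer_group GT R" by (simp add: GT_normalizer[OF R(2)])
  qed
  moreover have "homs = fus.homs G (norm_in T R) (nfus R) \<longleftrightarrow>
      (\<forall>X f. M X f \<longrightarrow> (\<exists>h. M (X <#> R) h \<and> (\<forall>x \<in> X. h x = f x) \<and> h ` R = R))"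
    if n: "norm_in T R = T"
  proof -
    interpret E: fus p G T "nfus R" by (rule nfus_fus[OF R, unfolded n])
    have nf: "nfus R X f \<longleftrightarrow> M X f \<and> (\<exists>h. M (X <#> R) h \<and> (\<forall>x \<in> X. h x = f x) \<and> h ` R = R)" for X f
    proof
      assume nf: "nfus R X f"
      then show "M X f \<and> (\<exists>h. M (X <#> R) h \<and> (\<forall>x \<in> X. h x = f x) \<and> h ` R = R)"
        using nfus_M[OF R(1) nf] unfolding nfus_def by blast
    next
      assume f: "M X f \<and> (\<exists>h. M (X <#> R) h \<and> (\<forall>x \<in> X. h x = f x) \<and> h ` R = R)"
      then have "subgroup X G" "X \<subseteq> T" using M_sub M_dom by blast+
      then show "nfus R X f" using f unfolding nfus_def n by blast
    qed
    have "homs = E.homs \<longleftrightarrow> (\<forall>X f. M X f \<longrightarrow> nfus R X f)"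
    proof
      assume eq: "homs = E.homs"
      show "\<forall>X f. M X f \<longrightarrow> nfus R X f"
      proof (intro allI impI)
        fix X f assume "M X f"
        then have "restrict f X \<in> homs X T" by (rule homs_restrict_T)
        then have "restrict f X \<in> E.homs X T" by (simp only: eq)
        then have "nfus R X (restrict f X)" by (rule E.homs_M)
        then show "nfus R X f" by (rule E.M_cong) simp
      qed
    next
      assume "\<forall>X f. M X f \<longrightarrow> nfus R X f"
      then have "M X f \<longleftrightarrow> nfus R X f" for X f using nfus_M[OF R(1)] by blast
      then show "homs = E.homs" by (intro ext) (auto simp: homs_def E.homs_def)
    qed
    then show ?thesis unfolding n using nf by blast
  qed
  ultimately show ?thesis
    using R by (auto simp: fs_normal_def normal_in_def GT_subgroup homs_normalizer[OF R])
next
  case False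
  then show ?thesis by (auto simp: fs_normal_def normal_in_def GT_subgroup)
qed

text \<open>\<open>GREATEST\<close> is taken with respect to inclusion, so it has the expected value
  because one normal subgroup contains all others.\<close>

lemma fs_core_greatest:
  "normal_in T M (fs_core GT homs)" "normal_in T M R \<Longrightarrow> R \<subseteq> fs_core GT homs"
proof -
  obtain W where W: "normal_in T M W" "\<And>R. normal_in T M R \<Longrightarrow> R \<subseteq> W"
    using normal_in_greatest[OF T_sub finite_T, of M] M_mult M_sub M_dom M_one by metis
  have "fs_core GT homs = W"
    unfolding fs_core_def fs_normal_iff by (rule Greatest_equality) (use W in auto)
  then show "normal_in T M (fs_core GT homs)" "normal_in T M R \<Longrightarrow> R \<subseteq> fs_core GT homs"
    using W by auto
qed

lemma GT_centralizer:
  assumes "H \<subseteq> T" shows "centralizer GT H = cent_in H"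
proof -
  have "t \<otimes> h = h \<otimes> t \<longleftrightarrow> conj_by t h = h" if "t \<in> T" "h \<in> H" for t h
    using that assms T_carrier conj_by_commute[of t h] by auto
  then show ?thesis unfolding centralizer_def cent_in_def by auto
qed

lemma GT_centric:
  "centric GT homs R \<longleftrightarrow> subgroup R G \<and> R \<subseteq> T \<and> (\<forall>f. M R f \<longrightarrow> cent_in (f ` R) \<subseteq> f ` R)"
proof -
  have "(\<forall>P \<in> fs_conjugates GT homs R. centralizer GT P \<subseteq> P) \<longleftrightarrow>
      (\<forall>f. M R f \<longrightarrow> centralizer GT (f ` R) \<subseteq> f ` R)"
    unfolding GT_conjugates by blast
  also have "\<dots> \<longleftrightarrow> (\<forall>f. M R f \<longrightarrow> cent_in (f ` R) \<subseteq> f ` R)"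
    using GT_centralizer[OF M_img] by simp
  finally show ?thesis unfolding centric_def GT_subgroup by blast
qed

end

text \<open>Inclusions are conjugations by \<one>, so a codomain may be exchanged for any subgroup
  that contains the image. Hence the morphisms into \<open>carrier S\<close> determine
  \<open>F\<close>.\<close>

lemma (in fusion_system) fus_of_fusion_system:
  "fus p S (carrier S) (\<lambda>X f. restrict f X \<in> F X (carrier S))"
    and homs_of_fusion_system: "fus.homs S (carrier S) (\<lambda>X f. restrict f X \<in> F X (carrier S)) = F"
proof -
  define M where "M = (\<lambda>X f. restrict f X \<in> F X (carrier S))"
  have incl: "f \<in> F X Z" if f: "f \<in> F X Y" and Z: "subgroup Z S" and "f ` X \<subseteq> Z" for f X Y Z
  proof -
    have 1: "f \<in> F X (f ` X)" by (rule onto_image[OF f])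
    have fX: "subgroup (f ` X) S" using objects[OF 1] by simp
    have c: "conj_map S \<one> (f ` X) y = y" if "y \<in> f ` X" for y
      using subgroup.mem_carrier[OF fX that] that by (simp add: conj_map_def)
    have "conj_map S \<one> (f ` X) \<in> F (f ` X) Z"
      by (rule inner[OF fX Z one_closed]) (use c \<open>f ` X \<subseteq> Z\<close> in auto)
    then have "compose X (conj_map S \<one> (f ` X)) f \<in> F X Z" by (rule comp[OF 1])
    moreover have "compose X (conj_map S \<one> (f ` X)) f = f"
      using monomorphisms[OF f] c by (intro extensionalityI[where A = X]) (auto simp: compose_def)
    ultimately show ?thesis by simp
  qed
  have Fext: "restrict f X = f" if "f \<in> F X Y" for f X Y
    using monomorphisms[OF that] by (simp add: extensional_restrict)
  have Mhom: "f ` X \<subseteq> carrier S" "inj_on f X" "x \<in> X \<Longrightarrow> y \<in> X \<Longrightarrow> f (x \<otimes> y) = f x \<otimes> f y" "subgroup X S"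
    if "M X f" for X f x y
  proof -
    have m: "restrict f X \<in> mon (S\<lparr>carrier := X\<rparr>) (S\<lparr>carrier := carrier S\<rparr>)" and X: "subgroup X S"
      using that monomorphisms objects unfolding M_def by blast+
    show "subgroup X S" by fact
    show "f ` X \<subseteq> carrier S" using m by (force simp: mon_def hom_def Pi_iff)
    show "inj_on f X" using m by (simp add: mon_def inj_on_def)
    show "x \<in> X \<Longrightarrow> y \<in> X \<Longrightarrow> f (x \<otimes> y) = f x \<otimes> f y"
      using m subgroup.m_closed[OF X] by (auto simp: mon_def hom_def)
  qed
  have Mimg: "restrict f X \<in> F X (f ` X)" "subgroup (f ` X) S" if "M X f" for X f
  proof -
    have "restrict f X ` X = f ` X" by simp
    then show *: "restrict f X \<in> F X (f ` X)" using that onto_image unfolding M_def by metis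
    show "subgroup (f ` X) S" using objects[OF *] by simp
  qed
  interpret f: fus p S "carrier S" M
  proof (rule fus.intro[OF is_group fus_axioms.intro])
    show "prime p" by (rule prime_p)
    show "subgroup (carrier S) S" by (rule subgroup_self)
    show "\<exists>n. card (carrier S) = p ^ n" using order_S by (simp add: order_def)
    fix X f assume f: "M X f"
    show "subgroup X S" "X \<subseteq> carrier S" "f ` X \<subseteq> carrier S" "inj_on f X"
      using Mhom(1,2,4)[OF f] subgroup.subset[OF Mhom(4)[OF f]] by auto
    show "f (x \<otimes> y) = f x \<otimes> f y" if "x \<in> X" "y \<in> X" for x y using Mhom(3)[OF f that] .
    show "M Y h" if Y: "subgroup Y S" "Y \<subseteq> X" and h: "\<And>y. y \<in> Y \<Longrightarrow> h y = f y" for Y h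
    proof -
      have c: "conj_map S \<one> Y y = y" if "y \<in> Y" for y
        using subgroup.mem_carrier[OF Y(1) that] that by (simp add: conj_map_def)
      have "conj_map S \<one> Y \<in> F Y X"
        by (rule inner[OF Y(1) Mhom(4)[OF f] one_closed]) (use c Y(2) in auto)
      then have "compose Y (restrict f X) (conj_map S \<one> Y) \<in> F Y (carrier S)"
        using comp f unfolding M_def by blast
      moreover have "compose Y (restrict f X) (conj_map S \<one> Y) = restrict h Y"
        using c h Y(2) by (auto simp: compose_def fun_eq_iff restrict_def)
      ultimately show ?thesis by (simp add: M_def)
    qed
    show "M X (h \<circ> f)" if h: "M Y h" and "f ` X \<subseteq> Y" for Y h
    proof -
      have "restrict f X \<in> F X Y"
        using incl[OF Mimg(1)[OF f] Mhom(4)[OF h]] that(2) by simp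
      then have "compose X (restrict h Y) (restrict f X) \<in> F X (carrier S)"
        using comp h unfolding M_def by blast
      moreover have "compose X (restrict h Y) (restrict f X) = restrict (h \<circ> f) X"
        using that(2) by (auto simp: compose_def fun_eq_iff restrict_def)
      ultimately show ?thesis by (simp add: M_def)
    qed
    have inv: "restrict (inv_into X (restrict f X)) (f ` X) \<in> F (f ` X) X"
      using inverse_image[OF Mimg(1)[OF f]] by simp
    have "inv_into X (restrict f X) = inv_into X f"
      by (auto simp: inv_into_def fun_eq_iff intro!: arg_cong[where f = Eps])
    then show "M (f ` X) (inv_into X f)"
      using incl[OF inv subgroup_self] Mhom(4)[OF f] subgroup.subset inv_into_into
      unfolding M_def by (metis (no_types, lifting) image_restrict_eq image_subsetI subsetD)
  next
    fix X g assume "subgroup X S" "X \<subseteq> carrier S" "g \<in> carrier S"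
    then have "conj_map S g X \<in> F X (carrier S)"
      by (intro inner subgroup_self) (auto simp: conj_map_def)
    moreover have "conj_map S g X = restrict (conj_by g) X"
      by (auto simp: conj_map_def conj_by_def fun_eq_iff)
    ultimately show "M X (conj_by g)" by (simp add: M_def)
  qed
  show "fus p S (carrier S) (\<lambda>X f. restrict f X \<in> F X (carrier S))"
    using f.fus_axioms by (simp add: M_def)
  have "f \<in> f.homs X Y \<longleftrightarrow> f \<in> F X Y" for f X Y
  proof
    assume "f \<in> f.homs X Y"
    then have f: "f \<in> extensional X" "M X f" "f ` X \<subseteq> Y" "subgroup Y S" by (auto simp: f.homs_def)
    then have "f \<in> F X (carrier S)" by (simp add: M_def extensional_restrict)
    then show "f \<in> F X Y" using incl f(3,4) by blast
  next
    assume f: "f \<in> F X Y"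
    have Y: "subgroup Y S" "X \<subseteq> carrier S" using objects[OF f] subgroup.subset by auto
    have fY: "f ` X \<subseteq> Y" using monomorphisms[OF f] by (auto simp: mon_def hom_def)
    then have "f \<in> F X (carrier S)" using incl[OF f subgroup_self] subgroup.subset[OF Y(1)] by blast
    then show "f \<in> f.homs X Y"
      using monomorphisms[OF f] Y fY subgroup.subset[OF Y(1)] Fext[OF f]
      unfolding f.homs_def by (simp add: M_def)
  qed
  then have "f.homs = F" by (intro ext) auto
  then show "fus.homs S (carrier S) (\<lambda>X f. restrict f X \<in> F X (carrier S)) = F" by (simp add: M_def)
qed

section \<open>Subcentric subgroups and parabolic characteristic\<close>

context fus_large
begin

text \<open>Let \<open>R\<close> be a fully automized and receptive conjugate of \<open>P\<close>.
  Morphisms from \<open>R\<close> can be reversed on full normalizers, which gives \<open>FN\<close>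
  and also shows that \<open>R\<close> is fully normalized. The map from \<open>N\<^sub>T(P)\<close>
  that takes \<open>P\<close> to \<open>R\<close> fixes \<open>Q\<close>, so \<open>Q\<close>
  normalizes \<open>R\<close> too.\<close>

lemma large_subcentric:
  assumes P: "subgroup P G" "P \<subseteq> T" "P \<noteq> {\<one>}" "Q \<subseteq> norm_in T P"
  shows "subcentric GT homs P"
proof -
  obtain f where f: "M P f" "fully_aut (f ` P)" "recept (f ` P)"
    using sat P unfolding saturated_M_def by blast
  define R where "R = f ` P"
  have R: "subgroup R G" "R \<subseteq> T" using M_img_sub[OF f(1)] M_img[OF f(1)] by (auto simp: R_def)
  have R1: "R \<noteq> {\<one>}"
  proof
    assume "R = {\<one>}"
    then have "card P = 1" using M_card[OF f(1) order_refl] by (simp add: R_def)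
    then obtain x where "P = {x}" by (rule card_1_singletonE)
    then show False using P(3) subgroup.one_closed[OF P(1)] by auto
  qed
  obtain h where h: "M (norm_in T P) h" "h ` P = R"
    using extend_to_normalizer[OF f(2,3,1)] by (auto simp: R_def)
  have "h q \<in> norm_in T R" if "q \<in> Q" for q
  proof -
    have "q \<in> norm_in T P" using that P(4) by blast
    then show ?thesis using M_norm[OF h(1) subgroup_in_norm_in[OF P(1,2)]] h(2) by simp
  qed
  then have "h ` Q \<subseteq> norm_in T R" by (rule image_subsetI)
  then have QR: "Q \<subseteq> norm_in T R" unfolding large_invariant[OF h(1) P(4)] .
  have FN: "\<exists>k. M (norm_in T (g ` R)) k \<and> k ` g ` R = R" if g: "M R g" for g
    using extend_to_normalizer[OF f(2,3)[folded R_def] M_inv[OF g]] M_inv_img[OF g] by simp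
  interpret E: fus p G "norm_in T R" "nfus R" by (rule nfus_fus[OF R])
  obtain W where W: "normal_in (norm_in T R) (nfus R) W" "\<And>g. M W g \<Longrightarrow> cent_in (g ` W) \<subseteq> g ` W"
    using normalizer_core[OF R R1 QR FN] by blast
  define V where "V = fs_core E.GT E.homs"
  have V: "subgroup V G" "V \<subseteq> norm_in T R" "W \<subseteq> V"
    using normal_in_subgroup normal_in_subset E.fs_core_greatest W(1) by (auto simp: V_def)
  \<comment> \<open>Centralizers shrink as groups grow, so \<open>V\<close> inherits the property
    from its subgroup \<open>W\<close>.\<close>
  have "cent_in (g ` V) \<subseteq> g ` V" if g: "M V g" for g
  proof -
    have "M W g" using M_res[OF g normal_in_subgroup[OF W(1)] V(3)] by simp
    then have "cent_in (g ` W) \<subseteq> g ` W" by (rule W(2))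
    then show ?thesis using V(3) cent_in_antimono[of "g ` W" "g ` V"] by blast
  qed
  moreover have "V \<subseteq> T" using V(2) norm_in_subset by blast
  ultimately have "centric GT homs V" using V(1) unfolding GT_centric by blast
  moreover have "fs_core (normalizer_group GT R) (fs_normalizer GT homs R) = V"
    by (simp add: V_def homs_normalizer[OF R] GT_normalizer[OF R(2)])
  moreover have "fully_normalized GT homs R"
  proof -
    have "card (normalizer GT (g ` R)) \<le> card (normalizer GT R)" if g: "M R g" for g
    proof -
      obtain k where k: "M (norm_in T (g ` R)) k" "k ` g ` R = R" using FN[OF g] by blast
      have gR: "g ` R \<subseteq> norm_in T (g ` R)" using subgroup_in_norm_in[OF M_img_sub[OF g] M_img[OF g]] .
      have "k ` norm_in T (g ` R) \<subseteq> norm_in T R" using M_norm[OF k(1) gR] k(2) by auto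
      then have "card (norm_in T (g ` R)) \<le> card (norm_in T R)"
        using M_inj[OF k(1)] sub_finite[OF norm_in_subset] card_inj_on_le by blast
      then show ?thesis using GT_normalizer M_img[OF g] R(2) by simp
    qed
    then show ?thesis using R by (auto simp: fully_normalized_def GT_subgroup GT_conjugates)
  qed
  moreover have "R \<in> fs_conjugates GT homs P" using f(1) by (auto simp: GT_conjugates R_def)
  ultimately show ?thesis using P by (auto simp: subcentric_def GT_subgroup)
qed

text \<open>A normal \<open>P\<close> need not be the fully automized and receptive member of its
  class. But the map onto that member extends to an automorphism \<open>h\<close> of
  \<open>T\<close>, and composing with its inverse gives \<open>FN\<close> for \<open>P\<close>
  itself.\<close>

lemma large_parabolic: "parabolic_characteristic p GT homs"
proof -
  have "constrained p (normalizer_group GT P) (fs_normalizer GT homs P)"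
    if n: "P \<lhd> GT" and P1: "P \<noteq> {\<one>}" for P
  proof -
    have P: "subgroup P G" "P \<subseteq> T" using normal_imp_subgroup[OF n] by (auto simp: GT_subgroup)
    have "t \<in> norm_in T P" if t: "t \<in> T" for t
    proof (rule norm_inI[OF sub_finite[OF P(2)] _ T_carrier t])
      show "P \<subseteq> carrier G" using P(2) T_carrier by blast
      show "conj_by t x \<in> P" if "x \<in> P" for x
        using normal.inv_op_closed2[OF n, of t x] t that by (simp add: conj_by_def GT_inv)
    qed
    then have PT: "norm_in T P = T" using norm_in_subset by blast
    obtain f where f: "M P f" "fully_aut (f ` P)" "recept (f ` P)"
      using sat P unfolding saturated_M_def by blast
    obtain h where h: "M T h" "h ` P = f ` P"
      using extend_to_normalizer[OF f(2,3,1)] PT by auto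
    have hT: "h ` T = T" using card_subset_eq[OF finite_T M_img[OF h(1)]] M_card[OF h(1)] by simp
    have h': "M T (inv_into T h)" "inv_into T h ` f ` P = P"
    proof -
      show "M T (inv_into T h)" using M_inv[OF h(1)] hT by simp
      show "inv_into T h ` f ` P = P" using M_inv_cancel[OF h(1) P(2)] h(2) by simp
    qed
    have FN: "\<exists>k. M (norm_in T (g ` P)) k \<and> k ` g ` P = P" if g: "M P g" for g
    proof -
      have "M (g ` P) (f \<circ> inv_into P g)" using M_comp[OF M_inv[OF g] f(1)] M_inv_img[OF g] by simp
      moreover have "(f \<circ> inv_into P g) ` g ` P = f ` P"
        using M_inv_img[OF g] by (metis image_comp)
      ultimately obtain k where k: "M (norm_in T (g ` P)) k" "k ` g ` P = f ` P"
        using extend_to_normalizer[OF f(2,3), of "g ` P" "f \<circ> inv_into P g"] by blast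
      have "M (norm_in T (g ` P)) (inv_into T h \<circ> k)" using M_comp[OF k(1) h'(1) M_img[OF k(1)]] .
      moreover have "(inv_into T h \<circ> k) ` g ` P = P" using k(2) h'(2) by (simp only: image_comp[symmetric])
      ultimately show ?thesis by blast
    qed
    interpret E: fus p G "norm_in T P" "nfus P" by (rule nfus_fus[OF P])
    obtain W where W: "normal_in (norm_in T P) (nfus P) W" "\<And>g. M W g \<Longrightarrow> cent_in (g ` W) \<subseteq> g ` W"
      using normalizer_core[OF P P1 _ FN] Q_T PT by blast
    have "centric E.GT E.homs W"
      unfolding E.GT_centric
    proof (intro conjI allI impI)
      show "subgroup W G" "W \<subseteq> norm_in T P" using normal_in_subgroup normal_in_subset W(1) by blast+
      fix g assume "nfus P W g"
      then have "M W g" by (rule nfus_M[OF P(1)])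
      then have "cent_in (g ` W) \<subseteq> g ` W" by (rule W(2))
      then show "E.cent_in (g ` W) \<subseteq> g ` W" by (auto simp: E.cent_in_def cent_in_def PT)
    qed
    moreover have "fs_normal E.GT E.homs W" using W(1) by (simp add: E.fs_normal_iff)
    moreover have "saturated_fusion_system p E.GT E.homs"
      unfolding E.homs_saturated by (rule nfus_saturated[OF sat P FN])
    ultimately show ?thesis
      by (auto simp: constrained_def homs_normalizer[OF P] GT_normalizer[OF P(2)])
  qed
  then show ?thesis using sat by (simp add: parabolic_characteristic_def homs_saturated)
qed

end

theorem lemma4p5:
  fixes p :: nat and S :: "('a, 'b) monoid_scheme" and F :: "'a hom_sets" and Q :: "'a set"
  assumes "saturated_fusion_system p S F"
    and "large S F Q"
  shows "(weakly_closed S F Q \<and> centric S F Q) \<and>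
    (\<forall>P. subgroup P S \<and> P \<noteq> {\<one>\<^bsub>S\<^esub>} \<and> Q \<subseteq> normalizer S P \<longrightarrow> subcentric S F P) \<and>
    parabolic_characteristic p S F"
proof -
  interpret S: saturated_fusion_system p S F by fact
  define M where "M = (\<lambda>X f. restrict f X \<in> F X (carrier S))"
  interpret f: fus p S "carrier S" M unfolding M_def by (rule S.fus_of_fusion_system)
  have F: "f.homs = F" unfolding M_def by (rule S.homs_of_fusion_system)
  have SS: "S\<lparr>carrier := carrier S\<rparr> = S" by simp
  have Q: "subgroup Q S" "centralizer S Q \<subseteq> Q"
    and lar: "\<And>U X Y. \<lbrakk>subgroup U S; U \<subseteq> center (S\<lparr>carrier := Q\<rparr>); U \<noteq> {\<one>\<^bsub>S\<^esub>}\<rbrakk>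
      \<Longrightarrow> fs_normalizer S F U X Y \<subseteq> fs_normalizer S F Q X Y"
    using assms(2) unfolding large_def by blast+
  have QS: "Q \<subseteq> carrier S" using Q(1) subgroup.subset by blast
  have nmz: "fs_normalizer S F P = fus.homs S (S.norm_in (carrier S) P) (f.nfus P)"
    if "subgroup P S" for P
    using f.homs_normalizer[OF that subgroup.subset[OF that]] unfolding F SS .
  interpret f: fus_large p S "carrier S" M Q
  proof (rule fus_large.intro[OF f.fus_axioms fus_large_axioms.intro])
    show "f.saturated_M" using f.homs_saturated assms(1) unfolding F SS by simp
    show "subgroup Q S" "Q \<subseteq> carrier S" by fact+
    show "f.cent_in Q \<subseteq> Q" using f.GT_centralizer[OF QS] Q(2) unfolding SS by simp
    fix U X f
    assume U: "subgroup U S" "U \<subseteq> Q" "U \<subseteq> f.cent_in Q" "U \<noteq> {\<one>\<^bsub>S\<^esub>}" and nf: "f.nfus U X f"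
    have US: "U \<subseteq> carrier S" using U(2) QS by blast
    interpret u: fus p S "S.norm_in (carrier S) U" "f.nfus U" by (rule f.nfus_fus[OF U(1) US])
    interpret q: fus p S "S.norm_in (carrier S) Q" "f.nfus Q" by (rule f.nfus_fus[OF Q(1) QS])
    have "U \<subseteq> centralizer S Q" using f.GT_centralizer[OF QS] U(3) unfolding SS by simp
    then have "U \<subseteq> center (S\<lparr>carrier := Q\<rparr>)"
      using U(2) by (auto simp: center_def centralizer_def)
    \<comment> \<open>A morphism set needs a codomain; \<open>N\<^sub>S(U)\<close> contains the
      image, and the predicate form drops it again afterwards.\<close>
    moreover have "restrict f X \<in> fs_normalizer S F U X (S.norm_in (carrier S) U)"
      unfolding nmz[OF U(1)] by (rule u.homs_restrict_T[OF nf])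
    ultimately have "restrict f X \<in> fs_normalizer S F Q X (S.norm_in (carrier S) U)"
      using lar[OF U(1) _ U(4)] by blast
    then have "f.nfus Q X (restrict f X)" unfolding nmz[OF Q(1)] by (rule q.homs_M)
    then show "f.nfus Q X f" by (rule q.M_cong) simp
  qed
  have inv: "\<phi> ` Q = Q" if "M Q \<phi>" for \<phi> using f.large_invariant[OF that] by simp
  have "weakly_closed S F Q"
    unfolding weakly_closed_def using Q(1) inv f.homs_M[unfolded F] by blast
  moreover have "centric S F Q"
    using f.GT_centric[of Q] inv Q(1) QS f.Q_cent unfolding F SS by simp
  moreover have "subcentric S F P"
    if "subgroup P S \<and> P \<noteq> {\<one>\<^bsub>S\<^esub>} \<and> Q \<subseteq> normalizer S P" for P
  proof -
    have P: "P \<subseteq> carrier S" using that subgroup.subset by blast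
    then show ?thesis
      using f.large_subcentric[of P] f.GT_normalizer[OF P] that unfolding F SS by simp
  qed
  moreover have "parabolic_characteristic p S F"
    using f.large_parabolic unfolding F SS .
  ultimately show ?thesis by blast
qed

end
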